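(* Let $0<\varrho<1$ and let $\{\omega_{ij}\}_{i,j\in\mathbb Z_+}$ be independent with $\omega_{00}=0$, $\omega_{i0}\sim\mathrm{Exp}(1-\varrho)$ for $i\ge1$, $\omega_{0j}\sim\mathrm{Exp}(\varrho)$ for $j\ge1$, and $\omega_{ij}\sim\mathrm{Exp}(1)$ for $i,j\ge1$. Let $Z^\varrho(t)$ be the (signed) exit point of the maximal path from $(0,0)$ to $(\lfloor(1-\varrho)^2t\rfloor,\lfloor\varrho^2t\rfloor)$. (a) For every $t_0>0$ there exists a finite constant $C=C(t_0,\varrho)$ such that, for all $a>0$ and $t\ge t_0$, \[ \mathbf P\{Z^\varrho(t)\ge at^{2/3}\}\le Ca^{-3}. \] (b) For every $\varepsilon>0$ there is a $\delta>0$ such that for all large enough $t$, \[ \mathbf P\{1\le Z^\varrho(t)\le\delta t^{2/3}\}\le\varepsilon. \]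
   Context: $\mathbb Z_+=\{0,1,2,\dots\}$; $\mathrm{Exp}(r)$ is the exponential distribution with rate $r$. For $(m,n)\in\mathbb Z_+^2$, an up-right path from $(0,0)$ to $(m,n)$ uses steps $(1,0)$ and $(0,1)$; the maximal path $\widehat\pi$ to $(m,n)$ is the almost surely unique up-right path from $(0,0)$ to $(m,n)$ maximizing $\sum_{(p,q)\in\pi}\omega_{pq}$. The exit point of $\widehat\pi$ is the last point of $\widehat\pi$ lying on the boundary $\{(i,j)\in\mathbb Z_+^2: i=0\text{ or }j=0\}$. It is encoded by the integer $Z$: if the exit point is $(z,0)$ with $z>0$ then $Z=z$; if it is $(0,z)$ with $z>0$ then $Z=-z$. $Z^\varrho(t)$ is this variable for $(m,n)=(\lfloor(1-\varrho)^2t\rfloor,\lfloor\varrho^2t\rfloor)$. *)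

theory Defs
  imports "HOL-Probability.Probability"
begin

definition up_right_step :: "nat \<times> nat \<Rightarrow> nat \<times> nat \<Rightarrow> bool" where
  "up_right_step p q \<longleftrightarrow> q = (fst p + 1, snd p) \<or> q = (fst p, snd p + 1)"

definition up_right_path :: "nat \<Rightarrow> nat \<Rightarrow> (nat \<times> nat) list \<Rightarrow> bool" where
  "up_right_path m n \<pi> \<longleftrightarrow>
     \<pi> \<noteq> [] \<and> hd \<pi> = (0, 0) \<and> last \<pi> = (m, n) \<and> successively up_right_step \<pi>"

definition path_weight :: "(nat \<times> nat \<Rightarrow> real) \<Rightarrow> (nat \<times> nat) list \<Rightarrow> real" where
  "path_weight w \<pi> = (\<Sum>p\<in>set \<pi>. w p)"

definition is_maximal_path ::
    "(nat \<times> nat \<Rightarrow> real) \<Rightarrow> nat \<Rightarrow> nat \<Rightarrow> (nat \<times> nat) list \<Rightarrow> bool" where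
  "is_maximal_path w m n \<pi> \<longleftrightarrow>
     up_right_path m n \<pi> \<and> (\<forall>\<pi>'. up_right_path m n \<pi>' \<longrightarrow> path_weight w \<pi>' \<le> path_weight w \<pi>)"

text \<open>
  The maximizer is only almost surely unique.  On the null set of ties the value below is
  unspecified, but it depends on the weights only through the (finite) set of maximizers, so
  events defined in terms of it are measurable and have the right probability.
\<close>

definition maximal_path ::
    "(nat \<times> nat \<Rightarrow> real) \<Rightarrow> nat \<Rightarrow> nat \<Rightarrow> (nat \<times> nat) list" where
  "maximal_path w m n = (THE \<pi>. is_maximal_path w m n \<pi>)"

definition exit_point :: "(nat \<times> nat) list \<Rightarrow> nat \<times> nat" where
  "exit_point \<pi> = last (filter (\<lambda>(i, j). i = 0 \<or> j = 0) \<pi>)"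

text \<open>
  The degenerate exit point \<open>(0, 0)\<close>, which occurs only for \<open>(m, n) = (0, 0)\<close>, gets the code \<open>0\<close>.
\<close>

definition signed_exit :: "nat \<times> nat \<Rightarrow> int" where
  "signed_exit p = (if snd p = 0 then int (fst p) else - int (snd p))"

definition Z_exit :: "(nat \<times> nat \<Rightarrow> real) \<Rightarrow> real \<Rightarrow> real \<Rightarrow> int" where
  "Z_exit w \<rho> t =
     signed_exit (exit_point (maximal_path w (nat \<lfloor>(1 - \<rho>)\<^sup>2 * t\<rfloor>) (nat \<lfloor>\<rho>\<^sup>2 * t\<rfloor>)))"

locale stationary_lpp = prob_space M
  for M :: "'a measure" and \<omega> :: "nat \<times> nat \<Rightarrow> 'a \<Rightarrow> real" and \<rho> :: real +
  assumes indep: "indep_vars (\<lambda>_. borel) \<omega> UNIV"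
    and origin: "\<forall>x\<in>space M. \<omega> (0, 0) x = 0"
    and horizontal: "\<forall>i\<ge>1. distributed M lborel (\<omega> (i, 0)) (exponential_density (1 - \<rho>))"
    and vertical: "\<forall>j\<ge>1. distributed M lborel (\<omega> (0, j)) (exponential_density \<rho>)"
    and bulk: "\<forall>i\<ge>1. \<forall>j\<ge>1. distributed M lborel (\<omega> (i, j)) (exponential_density 1)"

end

theory Submission
  imports Defs
begin

text \<open>
  Write \<open>z = 1 - \<rho>\<close>, \<open>G\<close> for the last-passage time, and \<open>I\<close>, \<open>J\<close> for its horizontal and vertical increments.
  By Burke's theorem (\<open>burke_rectangle\<close>) the increments along a down-right path are independent
  exponential variables with the rates \<open>z\<close> and \<open>1 - z\<close> of the boundary. Changing the rate of the
  horizontal boundary is an exponential tilt by the boundary sum, and combined with Burke's theorem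
  this gives an exact formula for \<open>E exp ((p - z) G)\<close> when the horizontal rate is \<open>p\<close> (\<open>lpp_mgf\<close>). Markov's
  inequality for two such models then shows that the maximal path rarely leaves through the
  horizontal axis if the endpoint is steeper than the characteristic direction \<open>(z\<^sup>2, (1 - z)\<^sup>2)\<close>
  (\<open>exit_bound\<close>).

  Upper tail. The path exits beyond \<open>k\<close> precisely when, seen from \<open>(k, 0)\<close>, it exits horizontally. The
  environment seen from \<open>(k, 0)\<close> is again stationary, and its endpoint \<open>(m - k, n)\<close> is too steep by \<open>k\<close>.
  The exit bound gives \<open>C exp (- c k\<^sup>3 / t\<^sup>2)\<close>, that is \<open>C exp (- c a\<^sup>3)\<close> for \<open>k = a t\<^bsup>2/3\<^esup>\<close>, which is stronger
  than the cubic decay.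

  Small exit points. On \<open>{1 \<le> Z \<le> \<delta> t\<^bsup>2/3\<^esup>}\<close> the weight of the best path that leaves the axis at \<open>x\<close>, as a
  function of \<open>x\<close>, has its maximum within the first \<open>\<delta> t\<^bsup>2/3\<^esup>\<close> points. The increments of this function are
  boundary weights minus increments of the bulk passage time to the endpoint. Reverse the picture and
  attach a stationary boundary of rate \<open>z - b t\<^bsup>-1/3\<^esup>\<close> at the endpoint: the exit bound, applied to the
  reversed model, shows that with high probability its increments dominate those of the bulk. Thus the
  function grows at least as fast as a random walk whose steps are differences of independent
  exponential variables, and whose drift over \<open>t\<^bsup>2/3\<^esup>\<close> steps has the order of its fluctuations. Such a
  walk rarely attains its maximum within a small initial fraction of the steps (\<open>walk_max_chernoff\<close>,
  \<open>walk_stays_below\<close>).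
\<close>

section \<open>Families of independent exponential variables\<close>

definition exp_measure :: "real \<Rightarrow> real measure" where
  "exp_measure a = density lborel (\<lambda>y. ennreal (exponential_density a y))"

lemma sets_exp_measure [simp, measurable_cong]: "sets (exp_measure a) = sets borel"
  by (simp add: exp_measure_def)

lemma space_exp_measure [simp]: "space (exp_measure a) = UNIV"
  by (simp add: exp_measure_def)

lemma prob_space_exp_measure: "0 < a \<Longrightarrow> prob_space (exp_measure a)"
  unfolding exp_measure_def by (rule prob_space_exponential_density)

lemma sigma_finite_exp_measure: "sigma_finite_measure (exp_measure a)"
  unfolding exp_measure_def
  by (subst sigma_finite_measure.sigma_finite_iff_density_finite[OF sigma_finite_lborel]) auto

text \<open>
  Joint independence and the exponential marginals are packed into one product formula for
  nonnegative functions of finitely many coordinates. In this form reindexing, rescaling, changing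
  the density of one coordinate and passing to a subfamily are immediate, and the probability
  measure may change while the variables stay the same.
\<close>

definition exp_family ::
    "'a measure \<Rightarrow> 'i set \<Rightarrow> ('i \<Rightarrow> 'a \<Rightarrow> real) \<Rightarrow> ('i \<Rightarrow> real) \<Rightarrow> bool" where
  "exp_family M S X r \<longleftrightarrow> prob_space M \<and> (\<forall>e\<in>S. 0 < r e \<and> X e \<in> borel_measurable M) \<and>
     (\<forall>J f. finite J \<longrightarrow> J \<subseteq> S \<longrightarrow> (\<forall>e\<in>J. f e \<in> borel_measurable borel) \<longrightarrow>
        (\<integral>\<^sup>+x. (\<Prod>e\<in>J. f e (X e x)) \<partial>M) = (\<Prod>e\<in>J. \<integral>\<^sup>+y. f e y \<partial>exp_measure (r e)))"

lemma exp_familyD: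
  assumes "exp_family M S X r"
  shows "prob_space M" "e \<in> S \<Longrightarrow> 0 < r e" "e \<in> S \<Longrightarrow> X e \<in> borel_measurable M"
  using assms by (auto simp: exp_family_def)

lemma exp_family_prod:
  fixes f :: "'i \<Rightarrow> real \<Rightarrow> ennreal"
  assumes "exp_family M S X r" "finite J" "J \<subseteq> S" "\<And>e. e \<in> J \<Longrightarrow> f e \<in> borel_measurable borel"
  shows "(\<integral>\<^sup>+x. (\<Prod>e\<in>J. f e (X e x)) \<partial>M) = (\<Prod>e\<in>J. \<integral>\<^sup>+y. f e y \<partial>exp_measure (r e))"
  using assms unfolding exp_family_def by blast

lemma exp_family_single:
  fixes f :: "real \<Rightarrow> ennreal"
  assumes "exp_family M S X r" "e \<in> S" "f \<in> borel_measurable borel"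
  shows "(\<integral>\<^sup>+x. f (X e x) \<partial>M) = (\<integral>\<^sup>+y. f y \<partial>exp_measure (r e))"
  using exp_family_prod[OF assms(1), of "{e}" "\<lambda>_. f"] assms by simp

lemma exp_family_subset:
  "exp_family M S X r \<Longrightarrow> T \<subseteq> S \<Longrightarrow> exp_family M T X r"
  unfolding exp_family_def by (meson subset_iff)

lemma exp_family_cong:
  assumes "exp_family M S X r" "\<And>e. e \<in> S \<Longrightarrow> Y e = X e" "\<And>e. e \<in> S \<Longrightarrow> q e = r e"
  shows "exp_family M S Y q"
proof -
  have "(\<integral>\<^sup>+x. (\<Prod>e\<in>J. f e (Y e x)) \<partial>M) = (\<Prod>e\<in>J. \<integral>\<^sup>+y. f e y \<partial>exp_measure (q e))"
    if J: "finite J" "J \<subseteq> S" "\<forall>e\<in>J. f e \<in> borel_measurable borel" for J and f :: "'b \<Rightarrow> real \<Rightarrow> ennreal"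
  proof -
    have "(\<Prod>e\<in>J. f e (Y e x)) = (\<Prod>e\<in>J. f e (X e x))" for x
      using J assms(2) by (intro prod.cong) auto
    moreover have "(\<Prod>e\<in>J. \<integral>\<^sup>+y. f e y \<partial>exp_measure (q e)) = (\<Prod>e\<in>J. \<integral>\<^sup>+y. f e y \<partial>exp_measure (r e))"
      using J assms(3) by (intro prod.cong) auto
    ultimately show ?thesis using exp_family_prod[OF assms(1) J(1,2), of f] J by auto
  qed
  with assms exp_familyD[OF assms(1)] show ?thesis unfolding exp_family_def by auto
qed

text \<open>
  The product formula for indicators fixes the joint law on boxes, which is all that a product of
  \<open>\<sigma>\<close>-finite measures needs. This gives access to Fubini.
\<close>

lemma exp_family_law:
  assumes F: "exp_family M S X r" and J: "finite J" "J \<subseteq> S"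
  shows "distr M (Pi\<^sub>M J (\<lambda>_. borel)) (\<lambda>x. \<lambda>e\<in>J. X e x) = Pi\<^sub>M J (\<lambda>e. exp_measure (r e))"
proof -
  interpret product_sigma_finite "\<lambda>e. exp_measure (r e)"
    by (simp add: product_sigma_finite_def sigma_finite_exp_measure)
  have [measurable]: "\<And>e. e \<in> J \<Longrightarrow> X e \<in> borel_measurable M" using exp_familyD[OF F] J by auto
  show ?thesis
  proof (rule PiM_eqI[OF J(1)])
    show "sets (distr M (Pi\<^sub>M J (\<lambda>_. borel)) (\<lambda>x. \<lambda>e\<in>J. X e x)) = sets (Pi\<^sub>M J (\<lambda>e. exp_measure (r e)))"
      unfolding sets_distr by (intro sets_PiM_cong) auto
  next
    fix A :: "'b \<Rightarrow> real set" assume A: "\<And>e. e \<in> J \<Longrightarrow> A e \<in> sets (exp_measure (r e))"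
    have A'[measurable]: "\<And>e. e \<in> J \<Longrightarrow> A e \<in> sets borel" using A by simp
    have "emeasure (distr M (Pi\<^sub>M J (\<lambda>_. borel)) (\<lambda>x. \<lambda>e\<in>J. X e x)) (Pi\<^sub>E J A)
        = emeasure M ((\<lambda>x. \<lambda>e\<in>J. X e x) -` (Pi\<^sub>E J A) \<inter> space M)"
      using J A by (intro emeasure_distr sets_PiM_I_finite) (auto intro!: measurable_restrict)
    also have "\<dots> = (\<integral>\<^sup>+x. indicator ((\<lambda>x. \<lambda>e\<in>J. X e x) -` (Pi\<^sub>E J A) \<inter> space M) x \<partial>M)"
      using J A by (intro nn_integral_indicator[symmetric] measurable_sets[where A="Pi\<^sub>M J (\<lambda>_. borel)"] sets_PiM_I_finite)
        (auto intro!: measurable_restrict)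
    also have "\<dots> = (\<integral>\<^sup>+x. (\<Prod>e\<in>J. indicator (A e) (X e x)) \<partial>M)"
    proof (intro nn_integral_cong)
      fix x assume "x \<in> space M"
      then show "indicator ((\<lambda>x. \<lambda>e\<in>J. X e x) -` (Pi\<^sub>E J A) \<inter> space M) x = (\<Prod>e\<in>J. indicator (A e) (X e x) :: ennreal)"
        using J(1) by (auto simp: indicator_def PiE_iff prod_zero_iff)
    qed
    also have "\<dots> = (\<Prod>e\<in>J. \<integral>\<^sup>+y. indicator (A e) y \<partial>exp_measure (r e))"
      using A' by (intro exp_family_prod[OF F J]) auto
    also have "\<dots> = (\<Prod>e\<in>J. emeasure (exp_measure (r e)) (A e))"
      using A by (intro prod.cong) auto
    finally show "emeasure (distr M (Pi\<^sub>M J (\<lambda>_. borel)) (\<lambda>x. \<lambda>e\<in>J. X e x)) (Pi\<^sub>E J A)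
       = (\<Prod>e\<in>J. emeasure (exp_measure (r e)) (A e))" .
  qed
qed

text \<open>
  Independence of one coordinate from a finite block of others, as an iterated integral in which
  the block is still integrated over the original probability space. Every computation below that
  treats one or several coordinates separately is an iteration of this formula, so no product
  space has to be carried along.
\<close>

lemma exp_family_peel:
  fixes H :: "real \<Rightarrow> ('i \<Rightarrow> real) \<Rightarrow> ennreal"
  assumes F: "exp_family M S X r" and J: "finite J" "J \<subseteq> S" and a: "a \<in> S" "a \<notin> J"
    and H: "(\<lambda>(y, g). H y g) \<in> borel_measurable (borel \<Otimes>\<^sub>M Pi\<^sub>M J (\<lambda>_. borel))"
  shows "(\<integral>\<^sup>+x. H (X a x) (\<lambda>e\<in>J. X e x) \<partial>M)
       = (\<integral>\<^sup>+y. (\<integral>\<^sup>+x. H y (\<lambda>e\<in>J. X e x) \<partial>M) \<partial>exp_measure (r a))"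
proof -
  interpret product_sigma_finite "\<lambda>e. exp_measure (r e)"
    by (simp add: product_sigma_finite_def sigma_finite_exp_measure)
  let ?K = "insert a J"
  have K: "finite ?K" "?K \<subseteq> S" using J a by auto
  have [measurable]: "\<And>e. e \<in> ?K \<Longrightarrow> X e \<in> borel_measurable M" using exp_familyD[OF F] K by auto
  have J_meas[measurable]: "(\<lambda>x. \<lambda>e\<in>J. X e x) \<in> M \<rightarrow>\<^sub>M Pi\<^sub>M J (\<lambda>_. borel)"
    by (rule measurable_restrict) auto
  have K_meas[measurable]: "(\<lambda>x. \<lambda>e\<in>?K. X e x) \<in> M \<rightarrow>\<^sub>M Pi\<^sub>M ?K (\<lambda>_. borel)"
    by (rule measurable_restrict) auto
  let ?h = "\<lambda>f. H (f a) (restrict f J)"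
  have c1: "(\<lambda>f. (f a, restrict f J)) \<in> Pi\<^sub>M ?K (\<lambda>_. borel) \<rightarrow>\<^sub>M borel \<Otimes>\<^sub>M Pi\<^sub>M J (\<lambda>_. borel)"
    by (intro measurable_Pair measurable_component_singleton measurable_restrict_subset) auto
  have h0: "?h \<in> borel_measurable (Pi\<^sub>M ?K (\<lambda>_. borel))"
    using measurable_compose[OF c1 H] by simp
  have hK: "?h \<in> borel_measurable (Pi\<^sub>M ?K (\<lambda>e. exp_measure (r e)))"
    using h0 by (simp cong: measurable_cong_sets sets_PiM_cong)
  have Hy: "(\<lambda>g. H y g) \<in> borel_measurable (Pi\<^sub>M J (\<lambda>_. borel))" for y
    using measurable_compose[OF measurable_Pair1' H, of y] by simp
  have "(\<integral>\<^sup>+x. H (X a x) (\<lambda>e\<in>J. X e x) \<partial>M) = (\<integral>\<^sup>+x. ?h (\<lambda>e\<in>?K. X e x) \<partial>M)"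
    by (intro nn_integral_cong arg_cong2[where f=H]) (auto simp: fun_eq_iff)
  also have "\<dots> = (\<integral>\<^sup>+f. ?h f \<partial>distr M (Pi\<^sub>M ?K (\<lambda>_. borel)) (\<lambda>x. \<lambda>e\<in>?K. X e x))"
    by (rule nn_integral_distr[symmetric, OF K_meas]) (use h0 in simp)
  also have "\<dots> = (\<integral>\<^sup>+f. ?h f \<partial>Pi\<^sub>M ?K (\<lambda>e. exp_measure (r e)))"
    by (simp add: exp_family_law[OF F K])
  also have "\<dots> = (\<integral>\<^sup>+y. \<integral>\<^sup>+g. ?h (g(a := y)) \<partial>Pi\<^sub>M J (\<lambda>e. exp_measure (r e)) \<partial>exp_measure (r a))"
    by (rule product_nn_integral_insert_rev[OF J(1) a(2) hK])
  also have "\<dots> = (\<integral>\<^sup>+y. \<integral>\<^sup>+g. H y g \<partial>Pi\<^sub>M J (\<lambda>e. exp_measure (r e)) \<partial>exp_measure (r a))"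
  proof (intro nn_integral_cong)
    fix y g assume "g \<in> space (Pi\<^sub>M J (\<lambda>e. exp_measure (r e)))"
    then have "restrict (g(a := y)) J = g"
      using a by (auto simp: space_PiM fun_eq_iff PiE_iff extensional_def restrict_def)
    then show "?h (g(a := y)) = H y g" by simp
  qed
  also have "\<dots> = (\<integral>\<^sup>+y. \<integral>\<^sup>+g. H y g \<partial>distr M (Pi\<^sub>M J (\<lambda>_. borel)) (\<lambda>x. \<lambda>e\<in>J. X e x) \<partial>exp_measure (r a))"
    by (simp add: exp_family_law[OF F J])
  also have "\<dots> = (\<integral>\<^sup>+y. (\<integral>\<^sup>+x. H y (\<lambda>e\<in>J. X e x) \<partial>M) \<partial>exp_measure (r a))"
    by (intro nn_integral_cong nn_integral_distr[OF J_meas]) (use Hy in simp)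
  finally show ?thesis .
qed

lemma exp_measure_nn_integral:
  assumes "f \<in> borel_measurable borel"
  shows "(\<integral>\<^sup>+y. f y \<partial>exp_measure a) = (\<integral>\<^sup>+y. ennreal (exponential_density a y) * f y \<partial>lborel)"
  unfolding exp_measure_def using assms by (subst nn_integral_density) auto

lemma AE_exp_measure_nonneg: "AE y in exp_measure a. 0 \<le> y"
  unfolding exp_measure_def
  by (subst AE_density) (auto intro!: AE_I2 simp: exponential_density_def)

lemma exp_family_AE:
  assumes F: "exp_family M S X r" and e: "e \<in> S" and P: "Measurable.pred borel P"
    and ae: "AE y in exp_measure (r e). P y"
  shows "AE x in M. P (X e x)"
proof -
  have [measurable]: "X e \<in> borel_measurable M" using exp_familyD[OF F] e by auto
  note P[measurable]
  have "(\<integral>\<^sup>+x. indicator {y. \<not> P y} (X e x) \<partial>M) = (\<integral>\<^sup>+y. indicator {y. \<not> P y} y \<partial>exp_measure (r e))"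
    by (rule exp_family_single[OF F e]) simp
  also have "\<dots> = 0"
    by (subst nn_integral_0_iff_AE) (use ae in \<open>auto simp: indicator_def\<close>)
  finally have "AE x in M. indicator {y. \<not> P y} (X e x) = (0::ennreal)"
    by (subst (asm) nn_integral_0_iff_AE) auto
  then show ?thesis by eventually_elim (auto simp: indicator_def split: if_splits)
qed

lemma exp_family_AE_nonneg: "exp_family M S X r \<Longrightarrow> e \<in> S \<Longrightarrow> AE x in M. 0 \<le> X e x"
  by (rule exp_family_AE[OF _ _ _ AE_exp_measure_nonneg]) auto

lemma exp_family_reindex:
  assumes F: "exp_family M S X r" and inj: "inj_on \<sigma> T" and sub: "\<sigma> ` T \<subseteq> S"
  shows "exp_family M T (\<lambda>e. X (\<sigma> e)) (\<lambda>e. r (\<sigma> e))"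
proof -
  have "(\<integral>\<^sup>+x. (\<Prod>e\<in>J. f e (X (\<sigma> e) x)) \<partial>M) = (\<Prod>e\<in>J. \<integral>\<^sup>+y. f e y \<partial>exp_measure (r (\<sigma> e)))"
    if J: "finite J" "J \<subseteq> T" and f: "\<forall>e\<in>J. f e \<in> borel_measurable borel" for J and f :: "'c \<Rightarrow> real \<Rightarrow> ennreal"
  proof -
    have inj': "inj_on \<sigma> J" using inj J(2) by (rule inj_on_subset)
    define g where "g e = f (inv_into J \<sigma> e)" for e
    have "(\<integral>\<^sup>+x. (\<Prod>e\<in>\<sigma> ` J. g e (X e x)) \<partial>M) = (\<Prod>e\<in>\<sigma> ` J. \<integral>\<^sup>+y. g e y \<partial>exp_measure (r e))"
      using J sub f by (intro exp_family_prod[OF F]) (auto simp: g_def inv_into_into)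
    then show ?thesis
      by (simp add: prod.reindex[OF inj'] g_def inv_into_f_f[OF inj'] cong: prod.cong)
  qed
  then show ?thesis using sub exp_familyD[OF F] unfolding exp_family_def by auto
qed

lemma exp_measure_scale:
  assumes "0 < a" "0 < c" "f \<in> borel_measurable borel"
  shows "(\<integral>\<^sup>+y. f (c * y) \<partial>exp_measure a) = (\<integral>\<^sup>+y. f y \<partial>exp_measure (a / c))"
proof -
  note [measurable] = assms(3)
  have "(\<integral>\<^sup>+y. f y \<partial>exp_measure (a / c)) = (\<integral>\<^sup>+y. ennreal (exponential_density (a / c) y) * f y \<partial>lborel)"
    by (intro exp_measure_nn_integral assms)
  also have "\<dots> = c * (\<integral>\<^sup>+y. ennreal (exponential_density (a / c) (0 + c * y)) * f (0 + c * y) \<partial>lborel)"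
    using assms by (subst nn_integral_real_affine[where c=c and t=0]) auto
  also have "\<dots> = (\<integral>\<^sup>+y. c * (ennreal (exponential_density (a / c) (0 + c * y)) * f (0 + c * y)) \<partial>lborel)"
    by (subst nn_integral_cmult) auto
  also have "\<dots> = (\<integral>\<^sup>+y. ennreal (exponential_density a y) * f (c * y) \<partial>lborel)"
  proof (intro nn_integral_cong)
    fix y
    have "ennreal c * ennreal (exponential_density (a / c) (c * y)) = ennreal (exponential_density a y)"
      using assms(1,2) by (subst ennreal_mult'[symmetric]) (auto simp: exponential_density_def mult_less_0_iff)
    then show "ennreal c * (ennreal (exponential_density (a / c) (0 + c * y)) * f (0 + c * y)) = ennreal (exponential_density a y) * f (c * y)"
      by (simp add: mult.assoc[symmetric])
  qed
  also have "\<dots> = (\<integral>\<^sup>+y. f (c * y) \<partial>exp_measure a)"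
    by (intro exp_measure_nn_integral[symmetric]) simp
  finally show ?thesis ..
qed

lemma exp_family_scale:
  assumes F: "exp_family M S X r" and c: "\<And>e. e \<in> S \<Longrightarrow> 0 < c e"
  shows "exp_family M S (\<lambda>e x. c e * X e x) (\<lambda>e. r e / c e)"
proof -
  have "(\<integral>\<^sup>+x. (\<Prod>e\<in>J. f e (c e * X e x)) \<partial>M) = (\<Prod>e\<in>J. \<integral>\<^sup>+y. f e y \<partial>exp_measure (r e / c e))"
    if J: "finite J" "J \<subseteq> S" and f: "\<forall>e\<in>J. f e \<in> borel_measurable borel" for J and f :: "'b \<Rightarrow> real \<Rightarrow> ennreal"
  proof -
    have "(\<lambda>y. f e (c e * y)) \<in> borel_measurable borel" if "e \<in> J" for e
      by (rule measurable_compose[where N=borel]) (use f that in auto)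
    then have "(\<integral>\<^sup>+x. (\<Prod>e\<in>J. f e (c e * X e x)) \<partial>M) = (\<Prod>e\<in>J. \<integral>\<^sup>+y. f e (c e * y) \<partial>exp_measure (r e))"
      using J f by (intro exp_family_prod[OF F, where f="\<lambda>e y. f e (c e * y)"]) auto
    also have "\<dots> = (\<Prod>e\<in>J. \<integral>\<^sup>+y. f e y \<partial>exp_measure (r e / c e))"
      using J f c exp_familyD[OF F] by (intro prod.cong exp_measure_scale) auto
    finally show ?thesis .
  qed
  then show ?thesis using c exp_familyD[OF F] unfolding exp_family_def by auto
qed

section \<open>The local Burke property\<close>

lemma exponential_density_measurable [measurable]: "exponential_density a \<in> borel_measurable borel"
  by (rule borel_measurable_erlang_density)

lemma nn_integral_exp_measure_measurable [measurable (raw)]: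
  assumes "(\<lambda>(x, y). f x y) \<in> borel_measurable (N \<Otimes>\<^sub>M borel)"
  shows "(\<lambda>x. \<integral>\<^sup>+y. f x y \<partial>exp_measure b) \<in> borel_measurable N"
proof -
  interpret sigma_finite_measure "exp_measure b" by (rule sigma_finite_exp_measure)
  have "(\<lambda>(x, y). f x y) \<in> borel_measurable (N \<Otimes>\<^sub>M exp_measure b)"
    using assms by (simp cong: measurable_cong_sets sets_pair_measure_cong)
  then show ?thesis by (rule borel_measurable_nn_integral)
qed

text \<open>
  The density of \<open>I - J\<close> for independent \<open>I ~ Exp(z)\<close> and \<open>J ~ Exp(1 - z)\<close>, an asymmetric Laplace law.
\<close>

definition difference_density :: "real \<Rightarrow> real \<Rightarrow> real" where
  "difference_density z d = z * (1 - z) * (if 0 < d then exp (- z * d) else exp ((1 - z) * d))"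

text \<open>
  The joint density \<open>z (1 - z) exp (- z i - (1 - z) j)\<close> factorises in the coordinates
  \<open>x = min i j\<close> and \<open>d = i - j\<close>: since the two rates add up to \<open>1\<close>, the minimum is
  \<open>Exp(1)\<close> and independent of the difference.
\<close>

lemma min_difference_law:
  fixes h :: "real \<Rightarrow> real \<Rightarrow> ennreal"
  assumes z: "0 < z" "z < 1" and h[measurable]: "(\<lambda>(x, d). h x d) \<in> borel_measurable (borel \<Otimes>\<^sub>M borel)"
  shows "(\<integral>\<^sup>+i. \<integral>\<^sup>+j. h (min i j) (i - j) \<partial>exp_measure (1 - z) \<partial>exp_measure z)
       = (\<integral>\<^sup>+x. \<integral>\<^sup>+d. ennreal (difference_density z d) * h x d \<partial>lborel \<partial>exp_measure 1)"
proof -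
  have [measurable]: "difference_density z \<in> borel_measurable borel"
    unfolding difference_density_def by measurable
  let ?e = "\<lambda>a y. ennreal (exponential_density a y)"
  let ?g = "\<lambda>i j. ?e z i * (?e (1 - z) j * h (min i j) (i - j))"
  have "(\<integral>\<^sup>+i. \<integral>\<^sup>+j. h (min i j) (i - j) \<partial>exp_measure (1 - z) \<partial>exp_measure z)
      = (\<integral>\<^sup>+i. ?e z i * (\<integral>\<^sup>+j. ?e (1 - z) j * h (min i j) (i - j) \<partial>lborel) \<partial>lborel)"
    by (simp add: exp_measure_nn_integral)
  also have "\<dots> = (\<integral>\<^sup>+i. \<integral>\<^sup>+j. ?g i j \<partial>lborel \<partial>lborel)"
    by (simp add: nn_integral_cmult)
  also have "\<dots> = (\<integral>\<^sup>+j. \<integral>\<^sup>+i. ?g i j \<partial>lborel \<partial>lborel)"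
    by (rule lborel_pair.Fubini') measurable
  also have "\<dots> = (\<integral>\<^sup>+j. \<integral>\<^sup>+d. ?g (j + d) j \<partial>lborel \<partial>lborel)"
  proof (rule nn_integral_cong)
    fix j :: real
    have "(\<integral>\<^sup>+i. ?g i j \<partial>lborel) = ennreal \<bar>1\<bar> * (\<integral>\<^sup>+d. ?g (j + 1 * d) j \<partial>lborel)"
      by (rule nn_integral_real_affine) auto
    then show "(\<integral>\<^sup>+i. ?g i j \<partial>lborel) = (\<integral>\<^sup>+d. ?g (j + d) j \<partial>lborel)" by simp
  qed
  also have "\<dots> = (\<integral>\<^sup>+d. \<integral>\<^sup>+j. ?g (j + d) j \<partial>lborel \<partial>lborel)"
    by (rule lborel_pair.Fubini') measurable
  also have "\<dots> = (\<integral>\<^sup>+d. \<integral>\<^sup>+x. ?e 1 x * (ennreal (difference_density z d) * h x d) \<partial>lborel \<partial>lborel)"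
  proof (rule nn_integral_cong)
    fix d :: real
    show "(\<integral>\<^sup>+j. ?g (j + d) j \<partial>lborel) = (\<integral>\<^sup>+x. ?e 1 x * (ennreal (difference_density z d) * h x d) \<partial>lborel)"
    proof (cases "0 < d")
      case True
      have "?e z (j + d) * ?e (1 - z) j = ?e 1 j * ennreal (difference_density z d)" for j
        using z True
        by (auto simp: ennreal_mult'[symmetric] exponential_density_def difference_density_def
              exp_add[symmetric] algebra_simps intro!: arg_cong[where f=ennreal])
      then have "?g (j + d) j = ?e 1 j * (ennreal (difference_density z d) * h j d)" for j
        using True by (simp add: mult.assoc[symmetric])
      then show ?thesis by simp
    next
      case False
      have "?e z x * ?e (1 - z) (x - d) = ?e 1 x * ennreal (difference_density z d)" for x
        using z False
        by (auto simp: ennreal_mult'[symmetric] exponential_density_def difference_density_def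
              exp_add[symmetric] algebra_simps intro!: arg_cong[where f=ennreal])
      then have eq: "?g x (x - d) = ?e 1 x * (ennreal (difference_density z d) * h x d)" for x
        using False by (simp add: mult.assoc[symmetric])
      have "(\<integral>\<^sup>+j. ?g (j + d) j \<partial>lborel) = (\<integral>\<^sup>+x. ?g (x - d + d) (x - d) \<partial>lborel)"
        by (subst nn_integral_real_affine[where c=1 and t="- d"]) auto
      then show ?thesis using eq by simp
    qed
  qed
  also have "\<dots> = (\<integral>\<^sup>+x. \<integral>\<^sup>+d. ?e 1 x * (ennreal (difference_density z d) * h x d) \<partial>lborel \<partial>lborel)"
    by (rule lborel_pair.Fubini') measurable
  also have "\<dots> = (\<integral>\<^sup>+x. \<integral>\<^sup>+d. ennreal (difference_density z d) * h x d \<partial>lborel \<partial>exp_measure 1)"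
    by (simp add: exp_measure_nn_integral nn_integral_cmult)
  finally show ?thesis .
qed

text \<open>
  The map \<open>(I, J, w) \<mapsto> (w + (I - J)\<^sup>+, w + (J - I)\<^sup>+)\<close> preserves \<open>Exp(z) \<otimes> Exp(1 - z)\<close>:
  \<open>(I, J)\<close> itself is \<open>(x + (I - J)\<^sup>+, x + (J - I)\<^sup>+)\<close> with \<open>x = min I J\<close>, and \<open>x\<close> and \<open>w\<close> are both
  \<open>Exp(1)\<close> variables independent of \<open>I - J\<close>, so one may replace the other.
\<close>

lemma burke_integral:
  fixes F :: "real \<Rightarrow> real \<Rightarrow> ennreal"
  assumes z: "0 < z" "z < 1" and F[measurable]: "(\<lambda>(x, y). F x y) \<in> borel_measurable (borel \<Otimes>\<^sub>M borel)"
  shows "(\<integral>\<^sup>+i. \<integral>\<^sup>+j. \<integral>\<^sup>+w. F (w + max 0 (i - j)) (w + max 0 (j - i)) \<partial>exp_measure 1 \<partial>exp_measure (1 - z) \<partial>exp_measure z)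
       = (\<integral>\<^sup>+i. \<integral>\<^sup>+j. F i j \<partial>exp_measure (1 - z) \<partial>exp_measure z)"
proof -
  interpret E1: prob_space "exp_measure 1" by (rule prob_space_exp_measure) simp
  let ?h = "\<lambda>w d. F (w + max 0 d) (w + max 0 (- d))"
  have "(\<integral>\<^sup>+i. \<integral>\<^sup>+j. \<integral>\<^sup>+w. F (w + max 0 (i - j)) (w + max 0 (j - i)) \<partial>exp_measure 1 \<partial>exp_measure (1 - z) \<partial>exp_measure z)
     = (\<integral>\<^sup>+i. \<integral>\<^sup>+j. (\<lambda>_ d. \<integral>\<^sup>+w. ?h w d \<partial>exp_measure 1) (min i j) (i - j) \<partial>exp_measure (1 - z) \<partial>exp_measure z)"
    by simp
  also have "\<dots> = (\<integral>\<^sup>+x. \<integral>\<^sup>+d. ennreal (difference_density z d) * (\<integral>\<^sup>+w. ?h w d \<partial>exp_measure 1) \<partial>lborel \<partial>exp_measure 1)"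
    by (rule min_difference_law[OF z]) measurable
  \<comment> \<open>The minimum has been exchanged for \<open>w\<close>; what remains depends on the difference alone.\<close>
  also have "\<dots> = (\<integral>\<^sup>+d. ennreal (difference_density z d) * (\<integral>\<^sup>+w. ?h w d \<partial>exp_measure 1) \<partial>lborel)"
    using E1.emeasure_space_1 by simp
  also have "\<dots> = (\<integral>\<^sup>+d. \<integral>\<^sup>+w. ennreal (difference_density z d) * ?h w d \<partial>exp_measure 1 \<partial>lborel)"
    by (simp add: nn_integral_cmult)
  also have "\<dots> = (\<integral>\<^sup>+w. \<integral>\<^sup>+d. ennreal (difference_density z d) * ?h w d \<partial>lborel \<partial>exp_measure 1)"
  proof -
    interpret pair_sigma_finite "exp_measure 1" lborel
      by (simp add: pair_sigma_finite_def sigma_finite_exp_measure sigma_finite_lborel)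
    show ?thesis by (rule Fubini') (unfold difference_density_def, measurable)
  qed
  also have "\<dots> = (\<integral>\<^sup>+i. \<integral>\<^sup>+j. ?h (min i j) (i - j) \<partial>exp_measure (1 - z) \<partial>exp_measure z)"
    by (rule min_difference_law[OF z, symmetric]) measurable
  also have "\<dots> = (\<integral>\<^sup>+i. \<integral>\<^sup>+j. F i j \<partial>exp_measure (1 - z) \<partial>exp_measure z)"
    by (intro nn_integral_cong arg_cong2[where f=F]) (auto simp: min_def max_def)
  finally show ?thesis .
qed

text \<open>
  One step of the queueing recursion, performed in place: the arrival \<open>a\<close> and service \<open>b\<close> are
  overwritten by their outputs and the bulk weight \<open>c\<close> is used up. The other coordinates are
  spectators, so the whole family keeps its independence and its rates.
\<close>

lemma burke_step:
  assumes F: "exp_family M S X r" and abc: "a \<in> S" "b \<in> S" "c \<in> S" "a \<noteq> b" "a \<noteq> c" "b \<noteq> c"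
    and r: "r a = z" "r b = 1 - z" "r c = 1"
    and Ya: "\<And>x. Y a x = X c x + max 0 (X a x - X b x)"
    and Yb: "\<And>x. Y b x = X c x + max 0 (X b x - X a x)"
    and Y: "\<And>e. e \<in> S - {a, b, c} \<Longrightarrow> Y e = X e"
  shows "exp_family M (S - {c}) Y r"
proof -
  have z: "0 < z" "z < 1" using exp_familyD(2)[OF F, of a] exp_familyD(2)[OF F, of b] abc r by auto
  have Xm[measurable]: "\<And>e. e \<in> S \<Longrightarrow> X e \<in> borel_measurable M" by (rule exp_familyD(3)[OF F])
  have [measurable]: "X a \<in> borel_measurable M" "X b \<in> borel_measurable M" "X c \<in> borel_measurable M"
    using abc by auto
  have Ya': "Y a = (\<lambda>x. X c x + max 0 (X a x - X b x))" and Yb': "Y b = (\<lambda>x. X c x + max 0 (X b x - X a x))"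
    using Ya Yb by auto
  have Ym: "Y e \<in> borel_measurable M" if "e \<in> S - {c}" for e
  proof (cases "e = a \<or> e = b")
    case True
    then show ?thesis unfolding Ya' Yb' by (auto simp: Ya' Yb')
  next
    case False
    then show ?thesis using Y[of e] that by auto
  qed
  have main: "(\<integral>\<^sup>+x. (\<Prod>e\<in>J. f e (Y e x)) \<partial>M) = (\<Prod>e\<in>J. \<integral>\<^sup>+y. f e y \<partial>exp_measure (r e))"
    if J: "finite J" "J \<subseteq> S - {c}" and f: "\<forall>e\<in>J. f e \<in> borel_measurable borel"
    for J and f :: "'b \<Rightarrow> real \<Rightarrow> ennreal"
  proof -
    \<comment> \<open>Padding with the constant \<open>1\<close> allows to assume that both updated coordinates occur in the product.\<close>
    define g where "g e = (if e \<in> J then f e else (\<lambda>_. 1))" for e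
    have g[measurable]: "g e \<in> borel_measurable borel" for e using f by (auto simp: g_def)
    define J0 where "J0 = J - {a, b}"
    have J0: "finite J0" "J0 \<subseteq> S" "a \<notin> J0" "b \<notin> J0" "c \<notin> J0" using J by (auto simp: J0_def)
    have J0': "Y e = X e" if "e \<in> J0" for e using Y[of e] that J by (auto simp: J0_def)
    have split: "(\<Prod>e\<in>J. p e) = q a * q b * (\<Prod>e\<in>J0. p e)"
      if "\<And>e. e \<in> J \<Longrightarrow> q e = p e" "\<And>e. e \<notin> J \<Longrightarrow> e \<in> {a,b} \<Longrightarrow> q e = 1" for p q :: "'b \<Rightarrow> ennreal"
    proof -
      have "(\<Prod>e\<in>J. p e) = (\<Prod>e\<in>J. q e)" using that by (intro prod.cong) auto
      also have "\<dots> = (\<Prod>e\<in>insert a (insert b J0). q e)"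
        using that J by (intro prod.mono_neutral_left) (auto simp: J0_def)
      also have "\<dots> = q a * q b * (\<Prod>e\<in>J0. q e)" using J0 abc by (simp add: mult.assoc)
      also have "(\<Prod>e\<in>J0. q e) = (\<Prod>e\<in>J0. p e)" using that by (intro prod.cong) (auto simp: J0_def)
      finally show ?thesis .
    qed
    define P where "P G = (\<Prod>e\<in>J0. g e (G e))" for G :: "'b \<Rightarrow> real"
    have Pm: "P \<in> borel_measurable (Pi\<^sub>M K (\<lambda>_. borel))" if "J0 \<subseteq> K" for K
      unfolding P_def
    proof (rule borel_measurable_prod_ennreal)
      fix e assume "e \<in> J0"
      then have "(\<lambda>G. G e) \<in> Pi\<^sub>M K (\<lambda>_. borel :: real measure) \<rightarrow>\<^sub>M borel"
        using that by (intro measurable_component_singleton) auto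
      then show "(\<lambda>G. g e (G e)) \<in> borel_measurable (Pi\<^sub>M K (\<lambda>_. borel))"
        by (rule measurable_compose[OF _ g])
    qed
    define U where "U u v = g a u * g b v" for u v
    have [measurable]: "(\<lambda>(u, v). U u v) \<in> borel_measurable (borel \<Otimes>\<^sub>M borel)"
      unfolding U_def by measurable
    let ?E = "\<lambda>e. exp_measure (r e)"
    let ?R = "\<lambda>K x. \<lambda>e\<in>K. X e x"
    let ?K1 = "insert b (insert c J0)" and ?K2 = "insert c J0"
    have sub: "?K1 \<subseteq> S" "?K2 \<subseteq> S" "finite ?K1" "finite ?K2" "a \<notin> ?K1" "b \<notin> ?K2" using J0 abc by auto
    have "(\<integral>\<^sup>+x. (\<Prod>e\<in>J. f e (Y e x)) \<partial>M) = (\<integral>\<^sup>+x. U (Y a x) (Y b x) * P (?R J0 x) \<partial>M)"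
    proof (intro nn_integral_cong)
      fix x
      have "(\<Prod>e\<in>J. f e (Y e x)) = g a (Y a x) * g b (Y b x) * (\<Prod>e\<in>J0. f e (Y e x))"
        by (rule split[where q="\<lambda>e. g e (Y e x)"]) (auto simp: g_def)
      also have "(\<Prod>e\<in>J0. f e (Y e x)) = P (?R J0 x)"
        unfolding P_def using J0' by (intro prod.cong) (auto simp: g_def J0_def)
      finally show "(\<Prod>e\<in>J. f e (Y e x)) = U (Y a x) (Y b x) * P (?R J0 x)" by (simp add: U_def)
    qed
    also have "\<dots> = (\<integral>\<^sup>+x. (\<lambda>i G. U (G c + max 0 (i - G b)) (G c + max 0 (G b - i)) * P G) (X a x) (?R ?K1 x) \<partial>M)"
      using abc by (simp add: Ya Yb P_def cong: prod.cong)
    also have "\<dots> = (\<integral>\<^sup>+i. \<integral>\<^sup>+x. (\<lambda>i G. U (G c + max 0 (i - G b)) (G c + max 0 (G b - i)) * P G) i (?R ?K1 x) \<partial>M \<partial>?E a)"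
    proof (rule exp_family_peel[OF F sub(3,1) abc(1) sub(5)])
      have [measurable]: "P \<in> borel_measurable (Pi\<^sub>M ?K1 (\<lambda>_. borel))" by (rule Pm) auto
      show "(\<lambda>(i, G). U (G c + max 0 (i - G b)) (G c + max 0 (G b - i)) * P G)
        \<in> borel_measurable (borel \<Otimes>\<^sub>M Pi\<^sub>M ?K1 (\<lambda>_. borel))" by measurable
    qed
    also have "\<dots> = (\<integral>\<^sup>+i. \<integral>\<^sup>+x. (\<lambda>j G. U (G c + max 0 (i - j)) (G c + max 0 (j - i)) * P G) (X b x) (?R ?K2 x) \<partial>M \<partial>?E a)"
      using abc by (simp add: P_def cong: prod.cong)
    also have "\<dots> = (\<integral>\<^sup>+i. \<integral>\<^sup>+j. \<integral>\<^sup>+x. (\<lambda>j G. U (G c + max 0 (i - j)) (G c + max 0 (j - i)) * P G) j (?R ?K2 x) \<partial>M \<partial>?E b \<partial>?E a)"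
    proof (rule nn_integral_cong, rule exp_family_peel[OF F sub(4,2) abc(2) sub(6)])
      fix i
      have [measurable]: "P \<in> borel_measurable (Pi\<^sub>M ?K2 (\<lambda>_. borel))" by (rule Pm) auto
      show "(\<lambda>(j, G). U (G c + max 0 (i - j)) (G c + max 0 (j - i)) * P G)
        \<in> borel_measurable (borel \<Otimes>\<^sub>M Pi\<^sub>M ?K2 (\<lambda>_. borel))" by measurable
    qed
    also have "\<dots> = (\<integral>\<^sup>+i. \<integral>\<^sup>+j. \<integral>\<^sup>+x. (\<lambda>w G. U (w + max 0 (i - j)) (w + max 0 (j - i)) * P G) (X c x) (?R J0 x) \<partial>M \<partial>?E b \<partial>?E a)"
      using abc by (simp add: P_def cong: prod.cong)
    also have "\<dots> = (\<integral>\<^sup>+i. \<integral>\<^sup>+j. \<integral>\<^sup>+w. \<integral>\<^sup>+x. (\<lambda>w G. U (w + max 0 (i - j)) (w + max 0 (j - i)) * P G) w (?R J0 x) \<partial>M \<partial>?E c \<partial>?E b \<partial>?E a)"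
    proof (rule nn_integral_cong, rule nn_integral_cong, rule exp_family_peel[OF F J0(1,2) abc(3) J0(5)])
      fix i j
      have [measurable]: "P \<in> borel_measurable (Pi\<^sub>M J0 (\<lambda>_. borel))" by (rule Pm) auto
      show "(\<lambda>(w, G). U (w + max 0 (i - j)) (w + max 0 (j - i)) * P G)
        \<in> borel_measurable (borel \<Otimes>\<^sub>M Pi\<^sub>M J0 (\<lambda>_. borel))" by measurable
    qed
    also have "\<dots> = (\<integral>\<^sup>+i. \<integral>\<^sup>+j. \<integral>\<^sup>+w. U (w + max 0 (i - j)) (w + max 0 (j - i)) * (\<integral>\<^sup>+x. P (?R J0 x) \<partial>M) \<partial>?E c \<partial>?E b \<partial>?E a)"
    proof -
      have [measurable]: "P \<in> borel_measurable (Pi\<^sub>M J0 (\<lambda>_. borel))" by (rule Pm) auto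
      have R0[measurable]: "?R J0 \<in> M \<rightarrow>\<^sub>M Pi\<^sub>M J0 (\<lambda>_. borel)" using J0 by (intro measurable_restrict Xm) auto
      show ?thesis by (simp add: nn_integral_cmult measurable_compose[OF R0])
    qed
    also have "\<dots> = (\<integral>\<^sup>+i. \<integral>\<^sup>+j. \<integral>\<^sup>+w. U (w + max 0 (i - j)) (w + max 0 (j - i)) \<partial>exp_measure 1 \<partial>exp_measure (1 - z) \<partial>exp_measure z) * (\<integral>\<^sup>+x. P (?R J0 x) \<partial>M)"
      by (simp add: nn_integral_multc r)
    also have "\<dots> = (\<integral>\<^sup>+i. \<integral>\<^sup>+j. U i j \<partial>?E b \<partial>?E a) * (\<integral>\<^sup>+x. P (?R J0 x) \<partial>M)"
      by (subst burke_integral[OF z]) (auto simp: r)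
    also have "(\<integral>\<^sup>+i. \<integral>\<^sup>+j. U i j \<partial>?E b \<partial>?E a) = (\<integral>\<^sup>+i. g a i \<partial>?E a) * (\<integral>\<^sup>+j. g b j \<partial>?E b)"
      unfolding U_def by (simp add: nn_integral_multc nn_integral_cmult)
    also have "(\<integral>\<^sup>+x. P (?R J0 x) \<partial>M) = (\<integral>\<^sup>+x. (\<Prod>e\<in>J0. g e (X e x)) \<partial>M)"
      by (simp add: P_def cong: prod.cong)
    also have "\<dots> = (\<Prod>e\<in>J0. \<integral>\<^sup>+y. g e y \<partial>?E e)"
      by (rule exp_family_prod[OF F J0(1,2)]) simp
    also have "\<dots> = (\<Prod>e\<in>J0. \<integral>\<^sup>+y. f e y \<partial>?E e)"
      by (intro prod.cong) (auto simp: g_def J0_def)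
    also have "(\<integral>\<^sup>+i. g a i \<partial>?E a) * (\<integral>\<^sup>+j. g b j \<partial>?E b) * (\<Prod>e\<in>J0. \<integral>\<^sup>+y. f e y \<partial>?E e) = (\<Prod>e\<in>J. \<integral>\<^sup>+y. f e y \<partial>?E e)"
    proof (rule split[symmetric])
      fix e assume e: "e \<notin> J" "e \<in> {a, b}"
      then interpret prob_space "?E e" using abc exp_familyD(2)[OF F, of e] by (intro prob_space_exp_measure) auto
      show "(\<integral>\<^sup>+y. g e y \<partial>?E e) = 1" using e emeasure_space_1 by (simp add: g_def)
    qed (simp add: g_def)
    finally show ?thesis .
  qed
  show ?thesis
    unfolding exp_family_def using main Ym exp_familyD[OF F] by auto
qed

section \<open>Last-passage times and their increments\<close>

text \<open>
  Last-passage times from the origin. Both boundaries and the bulk sit in one weight function,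
  which makes the two axes interchangeable; the origin counts with weight zero.
\<close>

fun lpp :: "(nat \<times> nat \<Rightarrow> real) \<Rightarrow> nat \<Rightarrow> nat \<Rightarrow> real" where
  "lpp w 0 0 = 0"
| "lpp w (Suc i) 0 = lpp w i 0 + w (Suc i, 0)"
| "lpp w 0 (Suc j) = lpp w 0 j + w (0, Suc j)"
| "lpp w (Suc i) (Suc j) = w (Suc i, Suc j) + max (lpp w i (Suc j)) (lpp w (Suc i) j)"

text \<open>
  Meant for \<open>i \<ge> 1\<close> (and \<open>vinc\<close> for \<open>j \<ge> 1\<close>); on the axis itself the truncated subtraction makes
  the increment zero.
\<close>

definition hinc :: "(nat \<times> nat \<Rightarrow> real) \<Rightarrow> nat \<Rightarrow> nat \<Rightarrow> real" where
  "hinc w i j = lpp w i j - lpp w (i - 1) j"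

definition vinc :: "(nat \<times> nat \<Rightarrow> real) \<Rightarrow> nat \<Rightarrow> nat \<Rightarrow> real" where
  "vinc w i j = lpp w i j - lpp w i (j - 1)"

lemma hinc_0 [simp]: "hinc w (Suc i) 0 = w (Suc i, 0)" by (simp add: hinc_def)
lemma vinc_0 [simp]: "vinc w 0 (Suc j) = w (0, Suc j)" by (simp add: vinc_def)

lemma hinc_Suc: "hinc w (Suc i) (Suc j) = w (Suc i, Suc j) + max 0 (hinc w (Suc i) j - vinc w i (Suc j))"
  by (simp add: hinc_def vinc_def)

lemma vinc_Suc: "vinc w (Suc i) (Suc j) = w (Suc i, Suc j) + max 0 (vinc w i (Suc j) - hinc w (Suc i) j)"
  by (simp add: hinc_def vinc_def)

lemma lpp_cong:
  assumes "\<And>a b. a \<le> i \<Longrightarrow> b \<le> j \<Longrightarrow> (a, b) \<noteq> (0, 0) \<Longrightarrow> w (a, b) = w' (a, b)"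
  shows "lpp w i j = lpp w' i j"
  using assms by (induction w i j rule: lpp.induct) auto

lemma lpp_mono:
  assumes "\<And>p. w p \<le> w' p"
  shows "lpp w i j \<le> lpp w' i j"
  using assms by (induction w i j rule: lpp.induct) (auto intro!: add_mono max.mono)

lemma lpp_nonneg:
  assumes "\<And>p. 0 \<le> w p"
  shows "0 \<le> lpp w i j"
proof (induction "i + j" arbitrary: i j rule: less_induct)
  case less
  consider "i = 0" "j = 0" | a where "i = Suc a" "j = 0" | b where "i = 0" "j = Suc b" | a b where "i = Suc a" "j = Suc b"
    by (cases i; cases j) auto
  then show ?case
  proof cases
    case (2 a) then show ?thesis using less[of a 0] assms by simp
  next
    case (3 b) then show ?thesis using less[of 0 b] assms by simp
  next
    case (4 a b) then show ?thesis using less[of a "Suc b"] assms[of "(Suc a, Suc b)"] by simp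
  qed simp
qed

lemma lpp_transpose: "lpp (\<lambda>(i, j). w (j, i)) i j = lpp w j i"
  by (induction w j i rule: lpp.induct) (auto simp: max.commute)

lemma lpp_step_right: "lpp w i j + w (Suc i, j) \<le> lpp w (Suc i) j"
  by (cases j) auto

lemma lpp_step_up: "lpp w i j + w (i, Suc j) \<le> lpp w i (Suc j)"
  by (cases i) auto

lemma vinc_nonneg: "(\<And>p. 0 \<le> w p) \<Longrightarrow> 0 \<le> vinc w i j"
  using lpp_step_up[of w i "j - 1"] by (cases j) (auto simp: vinc_def intro: order_trans[rotated])

lemma lpp_eq_sum_vinc: "lpp w i j = (\<Sum>a\<in>{1..i}. w (a, 0)) + (\<Sum>b\<in>{1..j}. vinc w i b)"
proof -
  have "lpp w i 0 = (\<Sum>a\<in>{1..i}. w (a, 0))" by (induction i) auto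
  moreover have "lpp w i j = lpp w i 0 + (\<Sum>b\<in>{1..j}. vinc w i b)"
  proof (induction j)
    case (Suc j)
    moreover have "vinc w i (Suc j) = lpp w i (Suc j) - lpp w i j" by (simp add: vinc_def)
    ultimately show ?case by simp
  qed simp
  ultimately show ?thesis by simp
qed

text \<open>
  The coupling that drives the comparison arguments. The recursion for the increments is
  increasing in the incoming increment of the same direction and decreasing in the other one, so
  raising the horizontal boundary and lowering the vertical one raises every horizontal increment
  and lowers every vertical one.
\<close>

lemma increments_compare:
  assumes bulk: "\<And>i j. w (Suc i, Suc j) = w' (Suc i, Suc j)"
    and row: "\<And>i. w (Suc i, 0) \<le> w' (Suc i, 0)" and col: "\<And>j. w' (0, Suc j) \<le> w (0, Suc j)"
  shows "hinc w (Suc i) j \<le> hinc w' (Suc i) j \<and> vinc w' i (Suc j) \<le> vinc w i (Suc j)"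
proof (induction "i + j" arbitrary: i j rule: less_induct)
  case less
  have "hinc w (Suc i) j \<le> hinc w' (Suc i) j"
  proof (cases j)
    case (Suc j')
    then show ?thesis using less[of i j'] by (auto simp: hinc_Suc bulk)
  qed (simp add: row)
  moreover have "vinc w' i (Suc j) \<le> vinc w i (Suc j)"
  proof (cases i)
    case (Suc i')
    then show ?thesis using less[of i' j] by (auto simp: vinc_Suc bulk)
  qed (simp add: col)
  ultimately show ?case ..
qed

text \<open>
  Setting a boundary to zero closes it: as the weights are nonnegative, a path gains nothing by
  following a boundary of zeros instead of entering the bulk at \<open>(1, 1)\<close>. So \<open>lpp (hor w)\<close> and
  \<open>lpp (ver w)\<close> are the passage times of the paths that leave the boundary through the horizontal and
  the vertical axis respectively.
\<close>

definition hor :: "(nat \<times> nat \<Rightarrow> real) \<Rightarrow> nat \<times> nat \<Rightarrow> real" where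
  "hor w = (\<lambda>(i, j). if i = 0 then 0 else w (i, j))"

definition ver :: "(nat \<times> nat \<Rightarrow> real) \<Rightarrow> nat \<times> nat \<Rightarrow> real" where
  "ver w = (\<lambda>(i, j). if j = 0 then 0 else w (i, j))"

lemma hor_simps [simp]: "hor w (0, j) = 0" "hor w (Suc i, j) = w (Suc i, j)"
  by (simp_all add: hor_def)

lemma ver_simps [simp]: "ver w (i, 0) = 0" "ver w (i, Suc j) = w (i, Suc j)"
  by (simp_all add: ver_def)

lemma lpp_hor_0: "lpp (hor w) 0 j = 0" by (induction j) auto
lemma lpp_ver_0: "lpp (ver w) i 0 = 0" by (induction i) auto
lemma lpp_hor_axis: "lpp (hor w) i 0 = lpp w i 0" by (induction i) auto
lemma lpp_ver_axis: "lpp (ver w) 0 j = lpp w 0 j" by (induction j) auto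

lemma lpp_max:
  assumes w: "\<And>p. 0 \<le> w p"
  shows "lpp w i j = max (lpp (hor w) i j) (lpp (ver w) i j)"
proof (induction "i + j" arbitrary: i j rule: less_induct)
  case less
  have nn: "0 \<le> lpp w i j" by (rule lpp_nonneg[OF w])
  consider "j = 0" | "i = 0" | a b where "i = Suc a" "j = Suc b" by (cases i; cases j) auto
  then show ?case
  proof cases
    case 1 then show ?thesis using nn by (simp add: lpp_ver_0 lpp_hor_axis)
  next
    case 2 then show ?thesis using nn by (simp add: lpp_hor_0 lpp_ver_axis)
  next
    case (3 a b)
    then show ?thesis using less[of a "Suc b"] less[of "Suc a" b] by (simp add: max_def)
  qed
qed

text \<open>
  A horizontal exit becomes more favourable as the endpoint moves to the right: closing the vertical
  boundary increases the horizontal increments, closing the horizontal one decreases them.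
\<close>

lemma hor_minus_ver_mono:
  assumes "\<And>p. 0 \<le> w p" "i \<le> i'"
  shows "lpp (hor w) i j - lpp (ver w) i j \<le> lpp (hor w) i' j - lpp (ver w) i' j"
  using assms(2)
proof (induction rule: dec_induct)
  case (step k)
  have "hinc (ver w) (Suc k) j \<le> hinc (hor w) (Suc k) j"
  proof (rule conjunct1[OF increments_compare])
    show "ver w (Suc a, Suc b) = hor w (Suc a, Suc b)" for a b by simp
    show "ver w (Suc a, 0) \<le> hor w (Suc a, 0)" for a using assms(1)[of "(Suc a, 0)"] by simp
    show "hor w (0, Suc b) \<le> ver w (0, Suc b)" for b using assms(1)[of "(0, Suc b)"] by simp
  qed
  then show ?case using step by (simp add: hinc_def)
qed simp

text \<open>
  The environment seen from \<open>(k, 0)\<close>. The columns to the left are summarised by the vertical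
  increments along the line \<open>i = k\<close>, which act as the new vertical boundary.
\<close>

definition shift :: "nat \<Rightarrow> (nat \<times> nat \<Rightarrow> real) \<Rightarrow> nat \<times> nat \<Rightarrow> real" where
  "shift k w = (\<lambda>(i, j). if i = 0 then vinc w k j else w (k + i, j))"

lemma shift_simps [simp]:
  "shift k w (0, j) = vinc w k j" "shift k w (Suc i, j) = w (Suc (k + i), j)"
  by (simp_all add: shift_def)

lemma lpp_shift: "lpp w (k + i) j = lpp w k 0 + lpp (shift k w) i j"
proof (induction "i + j" arbitrary: i j rule: less_induct)
  case less
  consider "i = 0" "j = 0" | a where "i = Suc a" "j = 0" | b where "i = 0" "j = Suc b" | a b where "i = Suc a" "j = Suc b"
    by (cases i; cases j) auto
  then show ?case
  proof cases
    case (2 a)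
    then show ?thesis using less[of a 0] by simp
  next
    case (3 b)
    then show ?thesis using less[of 0 b] by (simp add: vinc_def)
  next
    case (4 a b)
    then show ?thesis using less[of a "Suc b"] less[of "Suc a" b] by (simp add: max_def)
  qed simp
qed

lemma lpp_measurable:
  assumes "\<And>a b. a \<le> i \<Longrightarrow> b \<le> j \<Longrightarrow> (a, b) \<noteq> (0, 0) \<Longrightarrow> w (a, b) \<in> borel_measurable M"
  shows "(\<lambda>x. lpp (\<lambda>p. w p x) i j) \<in> borel_measurable M"
  using assms
proof (induction "i + j" arbitrary: i j rule: less_induct)
  case less
  consider "i = 0" "j = 0" | a where "i = Suc a" "j = 0" | b where "i = 0" "j = Suc b" | a b where "i = Suc a" "j = Suc b"
    by (cases i; cases j) auto
  then show ?case
  proof cases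
    case (2 a)
    have "(\<lambda>x. lpp (\<lambda>p. w p x) a 0) \<in> borel_measurable M" by (rule less.hyps) (use 2 less.prems in auto)
    moreover have "w (Suc a, 0) \<in> borel_measurable M" using less.prems[of "Suc a" 0] 2 by simp
    ultimately show ?thesis by (simp add: 2)
  next
    case (3 b)
    have "(\<lambda>x. lpp (\<lambda>p. w p x) 0 b) \<in> borel_measurable M" by (rule less.hyps) (use 3 less.prems in auto)
    moreover have "w (0, Suc b) \<in> borel_measurable M" using less.prems[of 0 "Suc b"] 3 by simp
    ultimately show ?thesis by (simp add: 3)
  next
    case (4 a b)
    have "(\<lambda>x. lpp (\<lambda>p. w p x) a (Suc b)) \<in> borel_measurable M" by (rule less.hyps) (use 4 less.prems in auto)
    moreover have "(\<lambda>x. lpp (\<lambda>p. w p x) (Suc a) b) \<in> borel_measurable M" by (rule less.hyps) (use 4 less.prems in auto)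
    moreover have "w (Suc a, Suc b) \<in> borel_measurable M" using less.prems[of "Suc a" "Suc b"] 4 by simp
    ultimately show ?thesis by (simp add: 4)
  qed simp
qed

section \<open>The Burke property along down-right paths\<close>

text \<open>
  The bulk points processed so far form a Young diagram \<open>P\<close>, with column heights \<open>c\<close> and row lengths
  \<open>r\<close>; a point may be added when it is an inner corner of the complement.
\<close>

inductive young :: "nat \<Rightarrow> nat \<Rightarrow> (nat \<Rightarrow> nat) \<Rightarrow> (nat \<Rightarrow> nat) \<Rightarrow> (nat \<times> nat) set \<Rightarrow> bool" for m n where
  empty: "young m n (\<lambda>_. 0) (\<lambda>_. 0) {}"
| add: "young m n c r P \<Longrightarrow> i < m \<Longrightarrow> j < n \<Longrightarrow> c (Suc i) = j \<Longrightarrow> r (Suc j) = i \<Longrightarrow>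
    young m n (c(Suc i := Suc j)) (r(Suc j := Suc i)) (insert (Suc i, Suc j) P)"

lemma young_subset:
  assumes "young m n c r P"
  shows "P \<subseteq> {(i, j). 1 \<le> i \<and> i \<le> m \<and> 1 \<le> j \<and> j \<le> n \<and> j \<le> c i}"
  using assms
proof induction
  case (add c r P i j)
  then show ?case by (fastforce simp: le_Suc_eq)
qed simp

lemma young_rectangle:
  "\<exists>P. young m n (\<lambda>i. if 1 \<le> i \<and> i \<le> m then n else 0) (\<lambda>j. if 1 \<le> j \<and> j \<le> n then m else 0) P"
proof -
  define c where "c k l = (\<lambda>i. if 1 \<le> i \<and> i \<le> k then n else if i = Suc k then l else 0)" for k l
  define r where "r k l = (\<lambda>j. if 1 \<le> j \<and> j \<le> l then Suc k else if 1 \<le> j \<and> j \<le> n then k else 0)" for k l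
  have c1: "(c k l)(Suc k := Suc l) = c k (Suc l)" for k l
    unfolding c_def by (rule ext) simp
  have r1: "(r k l)(Suc l := Suc k) = r k (Suc l)" for k l
  proof
    fix j show "((r k l)(Suc l := Suc k)) j = r k (Suc l) j"
      unfolding r_def by (cases "j = Suc l"; cases "j \<le> l") simp_all
  qed
  have c2: "c k n = c (Suc k) 0" for k
  proof
    fix i show "c k n i = c (Suc k) 0 i"
      unfolding c_def by (cases "i = Suc k"; cases "i \<le> k") simp_all
  qed
  have r2: "r k n = r (Suc k) 0" for k
  proof
    fix j show "r k n j = r (Suc k) 0 j"
      unfolding r_def by (cases "j = 0") simp_all
  qed
  have c3: "c 0 0 = (\<lambda>_. 0)" and r3: "r 0 0 = (\<lambda>_. 0)"
    unfolding c_def r_def by (rule ext; simp)+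
  have col: "\<exists>P. young m n (c k l) (r k l) P"
    if "k < m" "l \<le> n" and P0: "\<exists>P. young m n (c k 0) (r k 0) P" for k l
    using that(2)
  proof (induction l)
    case (Suc l)
    then obtain P where P: "young m n (c k l) (r k l) P" by auto
    have "young m n ((c k l)(Suc k := Suc l)) ((r k l)(Suc l := Suc k)) (insert (Suc k, Suc l) P)"
      by (rule young.add[OF P]) (use that Suc in \<open>auto simp: c_def r_def\<close>)
    then show ?case unfolding c1 r1 by (rule exI)
  qed (rule P0)
  have full: "\<exists>P. young m n (c k 0) (r k 0) P" if "k \<le> m" for k
    using that
  proof (induction k)
    case 0
    show ?case unfolding c3 r3 by (rule exI, rule young.empty)
  next
    case (Suc k)
    have "\<exists>P. young m n (c k n) (r k n) P" by (rule col) (use Suc in auto)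
    then show ?case unfolding c2 r2 .
  qed
  have "c m 0 = (\<lambda>i. if 1 \<le> i \<and> i \<le> m then n else 0)" "r m 0 = (\<lambda>j. if 1 \<le> j \<and> j \<le> n then m else 0)"
    unfolding c_def r_def by (rule ext; simp)+
  with full[of m] show ?thesis by simp
qed

text \<open>
  Boundary rates \<open>a\<close>, \<open>b\<close> and bulk rate \<open>1\<close> are prescribed on the box \<open>m \<times> n\<close> only. The index set
  \<open>S\<close> may be larger: its other coordinates are independent variables that can be used elsewhere in an
  argument.
\<close>

definition stationary ::
    "'a measure \<Rightarrow> (nat \<times> nat) set \<Rightarrow> (nat \<times> nat \<Rightarrow> 'a \<Rightarrow> real) \<Rightarrow> (nat \<times> nat \<Rightarrow> real) \<Rightarrow> real \<Rightarrow> real \<Rightarrow> nat \<Rightarrow> nat \<Rightarrow> bool" where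
  "stationary M S w r a b m n \<longleftrightarrow> exp_family M S w r \<and>
     (\<forall>i<m. (Suc i, 0) \<in> S \<and> r (Suc i, 0) = a) \<and> (\<forall>j<n. (0, Suc j) \<in> S \<and> r (0, Suc j) = b) \<and>
     (\<forall>i<m. \<forall>j<n. (Suc i, Suc j) \<in> S \<and> r (Suc i, Suc j) = 1)"

text \<open>
  The increments along the outer boundary of the diagram, stored in the boundary slots \<open>(i, 0)\<close> and
  \<open>(0, j)\<close> of the columns and rows to which they belong.
\<close>

definition edge :: "(nat \<times> nat \<Rightarrow> real) \<Rightarrow> (nat \<Rightarrow> nat) \<Rightarrow> (nat \<Rightarrow> nat) \<Rightarrow> nat \<times> nat \<Rightarrow> real" where
  "edge w c r = (\<lambda>(i, j). if i = 0 \<and> j = 0 then w (0, 0) else if j = 0 then hinc w i (c i)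
     else if i = 0 then vinc w (r j) j else w (i, j))"

text \<open>
  Adding a corner to the diagram is exactly one in-place step \<open>burke_step\<close>.
\<close>

lemma burke_young:
  assumes st: "stationary M S w q z (1 - z) m n" and y: "young m n c r P"
  shows "exp_family M (S - P) (\<lambda>p x. edge (\<lambda>p. w p x) c r p) q"
  using y
proof induction
  case empty
  have "(\<lambda>x. edge (\<lambda>p. w p x) (\<lambda>_. 0) (\<lambda>_. 0) p) = w p" for p
    by (cases p; cases "fst p"; cases "snd p") (auto simp: edge_def)
  then show ?case using st by (simp add: stationary_def)
next
  case (add c r P i j)
  have not_in: "(Suc i, Suc j) \<notin> P" "(0, b) \<notin> P" "(a, 0) \<notin> P" for a b
    using young_subset[OF add.hyps(1)] add.hyps by auto
  have "S - insert (Suc i, Suc j) P = (S - P) - {(Suc i, Suc j)}" by auto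
  moreover have "exp_family M ((S - P) - {(Suc i, Suc j)})
    (\<lambda>p x. edge (\<lambda>p. w p x) (c(Suc i := Suc j)) (r(Suc j := Suc i)) p) q"
  proof (rule burke_step[OF add.IH, where a = "(Suc i, 0)" and b = "(0, Suc j)" and z = z])
    fix x
    show "edge (\<lambda>p. w p x) (c(Suc i := Suc j)) (r(Suc j := Suc i)) (Suc i, 0) =
         edge (\<lambda>p. w p x) c r (Suc i, Suc j) +
         max 0 (edge (\<lambda>p. w p x) c r (Suc i, 0) - edge (\<lambda>p. w p x) c r (0, Suc j))"
      using add.hyps by (simp add: edge_def hinc_Suc)
    show "edge (\<lambda>p. w p x) (c(Suc i := Suc j)) (r(Suc j := Suc i)) (0, Suc j) =
         edge (\<lambda>p. w p x) c r (Suc i, Suc j) +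
         max 0 (edge (\<lambda>p. w p x) c r (0, Suc j) - edge (\<lambda>p. w p x) c r (Suc i, 0))"
      using add.hyps by (simp add: edge_def vinc_Suc)
  next
    fix e assume "e \<in> S - P - {(Suc i, 0), (0, Suc j), (Suc i, Suc j)}"
    then show "(\<lambda>x. edge (\<lambda>p. w p x) (c(Suc i := Suc j)) (r(Suc j := Suc i)) e) = (\<lambda>x. edge (\<lambda>p. w p x) c r e)"
      by (cases e) (auto simp: edge_def)
  qed (use st add.hyps not_in in \<open>auto simp: stationary_def\<close>)
  ultimately show ?case by (simp only:)
qed

text \<open>
  Burke's theorem in the form used below: on the top and right sides of a rectangle the increments
  are again independent exponential variables with the boundary rates, jointly independent of all
  weights outside the rectangle.
\<close>

lemma burke_rectangle:
  assumes st: "stationary M S w q z (1 - z) m n"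
  shows "exp_family M (S - {1..m} \<times> {1..n})
    (\<lambda>p x. edge (\<lambda>p. w p x) (\<lambda>i. if 1 \<le> i \<and> i \<le> m then n else 0) (\<lambda>j. if 1 \<le> j \<and> j \<le> n then m else 0) p) q"
proof -
  obtain P where P: "young m n (\<lambda>i. if 1 \<le> i \<and> i \<le> m then n else 0) (\<lambda>j. if 1 \<le> j \<and> j \<le> n then m else 0) P"
    using young_rectangle by blast
  show ?thesis
    by (rule exp_family_subset[OF burke_young[OF st P]]) (use young_subset[OF P] in auto)
qed

section \<open>Exponential tilting and an exact moment generating function\<close>

lemma exp_measure_tilt:
  assumes "0 < a" "0 < b" and [measurable]: "f \<in> borel_measurable borel"
  shows "(\<integral>\<^sup>+y. ennreal (b / a * exp ((a - b) * y)) * f y \<partial>exp_measure a) = (\<integral>\<^sup>+y. f y \<partial>exp_measure b)"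
proof -
  have "ennreal (exponential_density a y) * (ennreal (b / a * exp ((a - b) * y)) * f y) = ennreal (exponential_density b y) * f y" for y
  proof -
    have "ennreal (exponential_density a y) * ennreal (b / a * exp ((a - b) * y)) = ennreal (exponential_density b y)"
      using assms(1,2)
      by (auto simp: ennreal_mult'[symmetric] exponential_density_def field_simps exp_add[symmetric])
    then show ?thesis by (simp add: mult.assoc[symmetric])
  qed
  then show ?thesis by (simp add: exp_measure_nn_integral)
qed

lemma exp_measure_mgf:
  assumes "0 < a" "s < a"
  shows "(\<integral>\<^sup>+y. ennreal (exp (s * y)) \<partial>exp_measure a) = ennreal (a / (a - s))"
proof -
  interpret prob_space "exp_measure (a - s)" by (rule prob_space_exp_measure) (use assms in simp)
  have "ennreal (a / (a - s)) = ennreal (a / (a - s)) * (\<integral>\<^sup>+y. 1 \<partial>exp_measure (a - s))"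
    using emeasure_space_1 by simp
  also have "\<dots> = ennreal (a / (a - s)) * (\<integral>\<^sup>+y. ennreal ((a - s) / a * exp ((a - (a - s)) * y)) * 1 \<partial>exp_measure a)"
    by (subst exp_measure_tilt) (use assms in auto)
  also have "\<dots> = (\<integral>\<^sup>+y. ennreal (a / (a - s)) * (ennreal ((a - s) / a * exp ((a - (a - s)) * y)) * 1) \<partial>exp_measure a)"
    by (rule nn_integral_cmult[symmetric]) measurable
  also have "\<dots> = (\<integral>\<^sup>+y. ennreal (exp (s * y)) \<partial>exp_measure a)"
    using assms by (intro nn_integral_cong) (simp add: ennreal_mult'[symmetric])
  finally show ?thesis ..
qed

text \<open>
  A factor \<open>exp ((r - b) X)\<close> turns \<open>Exp(r)\<close> into \<open>Exp(b)\<close>; by independence the tilted measure leaves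
  the other coordinates alone.
\<close>

lemma exp_family_tilt1:
  assumes F: "exp_family M S X r" and a: "a \<in> S" and b: "0 < b"
  shows "exp_family (density M (\<lambda>x. ennreal (b / r a * exp ((r a - b) * X a x)))) S X (r(a := b))"
proof -
  let ?g = "\<lambda>y. ennreal (b / r a * exp ((r a - b) * y))"
  let ?N = "density M (\<lambda>x. ?g (X a x))"
  have ra: "0 < r a" using exp_familyD(2)[OF F a] .
  have Xm[measurable]: "X e \<in> borel_measurable M" if "e \<in> S" for e using exp_familyD(3)[OF F that] .
  have gm[measurable]: "?g \<in> borel_measurable borel" by measurable
  have gX: "(\<lambda>x. ?g (X a x)) \<in> borel_measurable M" using a by measurable
  have main: "(\<integral>\<^sup>+x. (\<Prod>e\<in>J. f e (X e x)) \<partial>?N) = (\<Prod>e\<in>J. \<integral>\<^sup>+y. f e y \<partial>exp_measure ((r(a := b)) e))"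
    if J: "finite J" "J \<subseteq> S" and f: "\<forall>e\<in>J. f e \<in> borel_measurable borel" for J and f :: "'b \<Rightarrow> real \<Rightarrow> ennreal"
  proof -
    define h where "h e = (if e \<in> J then f e else (\<lambda>_. 1))" for e
    have hm[measurable]: "h e \<in> borel_measurable borel" for e using f by (auto simp: h_def)
    define K where "K = J - {a}"
    have K: "finite K" "K \<subseteq> S" "a \<notin> K" using J by (auto simp: K_def)
    have split: "(\<Prod>e\<in>J. p e) = q a * (\<Prod>e\<in>K. q e)"
      if "\<And>e. e \<in> J \<Longrightarrow> q e = p e" "a \<notin> J \<Longrightarrow> q a = 1" for p q :: "'b \<Rightarrow> ennreal"
    proof -
      have "(\<Prod>e\<in>J. p e) = (\<Prod>e\<in>J. q e)" using that by (intro prod.cong) auto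
      also have "\<dots> = (\<Prod>e\<in>insert a K. q e)"
        using that J by (intro prod.mono_neutral_left) (auto simp: K_def)
      finally show ?thesis using K by simp
    qed
    have prodm: "(\<lambda>x. \<Prod>e\<in>J. f e (X e x)) \<in> borel_measurable M"
    proof (rule borel_measurable_prod_ennreal)
      fix e assume e: "e \<in> J"
      show "(\<lambda>x. f e (X e x)) \<in> borel_measurable M"
        by (rule measurable_compose[OF Xm]) (use e J f in auto)
    qed
    have "(\<integral>\<^sup>+x. (\<Prod>e\<in>J. f e (X e x)) \<partial>?N) = (\<integral>\<^sup>+x. ?g (X a x) * (\<Prod>e\<in>J. f e (X e x)) \<partial>M)"
      by (rule nn_integral_density[OF gX prodm])
    also have "\<dots> = (\<integral>\<^sup>+x. (\<Prod>e\<in>insert a K. (h(a := \<lambda>y. ?g y * h a y)) e (X e x)) \<partial>M)"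
    proof (rule nn_integral_cong)
      fix x
      have "(\<Prod>e\<in>J. f e (X e x)) = h a (X a x) * (\<Prod>e\<in>K. h e (X e x))"
        by (rule split) (auto simp: h_def)
      moreover have "(\<Prod>e\<in>K. (h(a := \<lambda>y. ?g y * h a y)) e (X e x)) = (\<Prod>e\<in>K. h e (X e x))"
        using K by (intro prod.cong) auto
      ultimately show "?g (X a x) * (\<Prod>e\<in>J. f e (X e x)) = (\<Prod>e\<in>insert a K. (h(a := \<lambda>y. ?g y * h a y)) e (X e x))"
        using K by (simp add: mult.assoc)
    qed
    also have "\<dots> = (\<Prod>e\<in>insert a K. \<integral>\<^sup>+y. (h(a := \<lambda>y. ?g y * h a y)) e y \<partial>exp_measure (r e))"
      using K a by (intro exp_family_prod[OF F]) auto
    also have "\<dots> = (\<integral>\<^sup>+y. ?g y * h a y \<partial>exp_measure (r a)) * (\<Prod>e\<in>K. \<integral>\<^sup>+y. h e y \<partial>exp_measure ((r(a := b)) e))"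
    proof -
      have "(\<Prod>e\<in>K. \<integral>\<^sup>+y. (h(a := \<lambda>y. ?g y * h a y)) e y \<partial>exp_measure (r e)) =
        (\<Prod>e\<in>K. \<integral>\<^sup>+y. h e y \<partial>exp_measure ((r(a := b)) e))"
        using K by (intro prod.cong) auto
      then show ?thesis using K by simp
    qed
    also have "(\<integral>\<^sup>+y. ?g y * h a y \<partial>exp_measure (r a)) = (\<integral>\<^sup>+y. h a y \<partial>exp_measure ((r(a := b)) a))"
      by (subst exp_measure_tilt[OF ra b]) auto
    also have "(\<integral>\<^sup>+y. h a y \<partial>exp_measure ((r(a := b)) a)) * (\<Prod>e\<in>K. \<integral>\<^sup>+y. h e y \<partial>exp_measure ((r(a := b)) e)) =
       (\<Prod>e\<in>J. \<integral>\<^sup>+y. f e y \<partial>exp_measure ((r(a := b)) e))"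
    proof (rule split[symmetric])
      assume "a \<notin> J"
      interpret prob_space "exp_measure b" by (rule prob_space_exp_measure[OF b])
      show "(\<integral>\<^sup>+y. h a y \<partial>exp_measure ((r(a := b)) a)) = 1"
        using \<open>a \<notin> J\<close> emeasure_space_1 by (simp add: h_def)
    qed (simp add: h_def)
    finally show ?thesis .
  qed
  have "prob_space ?N"
  proof
    show "emeasure ?N (space ?N) = 1"
      using main[of "{}" "\<lambda>_ _. 1"] by simp
  qed
  then show ?thesis
    using main Xm exp_familyD(2)[OF F] b unfolding exp_family_def by auto
qed

lemma exp_family_tilt:
  assumes F: "exp_family M S X r" and A: "finite A" "A \<subseteq> S" and q: "\<And>a. a \<in> A \<Longrightarrow> 0 < q a"
  shows "exp_family (density M (\<lambda>x. \<Prod>a\<in>A. ennreal (q a / r a * exp ((r a - q a) * X a x)))) S X (\<lambda>e. if e \<in> A then q e else r e)"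
  using A q
proof (induction A rule: finite_induct)
  case empty
  then show ?case using F by (simp add: density_1)
next
  case (insert a A)
  let ?g = "\<lambda>a x. ennreal (q a / r a * exp ((r a - q a) * X a x))"
  have Xm: "X e \<in> borel_measurable M" if "e \<in> S" for e using exp_familyD(3)[OF F that] .
  have gm: "?g e \<in> borel_measurable M" if "e \<in> insert a A" for e
  proof -
    have [measurable]: "X e \<in> borel_measurable M" using Xm that insert by auto
    show ?thesis by measurable
  qed
  let ?r = "\<lambda>e. if e \<in> A then q e else r e"
  have "exp_family (density (density M (\<lambda>x. \<Prod>e\<in>A. ?g e x)) (\<lambda>x. ennreal (q a / ?r a * exp ((?r a - q a) * X a x)))) S X (?r(a := q a))"
    by (rule exp_family_tilt1) (use insert in auto)
  moreover have "?r(a := q a) = (\<lambda>e. if e \<in> insert a A then q e else r e)" by auto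
  moreover have "density (density M (\<lambda>x. \<Prod>e\<in>A. ?g e x)) (\<lambda>x. ennreal (q a / ?r a * exp ((?r a - q a) * X a x)))
     = density M (\<lambda>x. \<Prod>e\<in>insert a A. ?g e x)"
  proof -
    have pm: "(\<lambda>x. \<Prod>e\<in>A. ?g e x) \<in> borel_measurable M"
      by (rule borel_measurable_prod_ennreal) (rule gm, simp)
    have "density (density M (\<lambda>x. \<Prod>e\<in>A. ?g e x)) (?g a) = density M (\<lambda>x. (\<Prod>e\<in>A. ?g e x) * ?g a x)"
      by (rule density_density_eq[OF pm gm]) simp
    then show ?thesis using insert by (simp add: mult.commute)
  qed
  ultimately show ?case by (simp only:)
qed

text \<open>
  An exact moment generating function for the passage time with horizontal rate \<open>p\<close> and vertical rate
  \<open>1 - z\<close>. Split \<open>G(m, n)\<close> into the sum along the horizontal axis and the sum of the vertical increments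
  \<open>J\<close> on the line \<open>i = m\<close>. The exponential of \<open>p - z\<close> times the first sum is, up to the factor \<open>(p / z)\<^sup>m\<close>,
  the density that changes the horizontal rate from \<open>p\<close> to \<open>z\<close>. Under the changed measure the model is
  stationary, hence by Burke's theorem the \<open>J\<close> are independent \<open>Exp(1 - z)\<close> variables and their moment
  generating function is explicit.
\<close>

lemma lpp_mgf:
  assumes st: "stationary M S w r p (1 - z) m n" and pz: "0 < p" "p < 1" "0 < z" "z < 1"
  shows "(\<integral>\<^sup>+x. ennreal (exp ((p - z) * lpp (\<lambda>e. w e x) m n)) \<partial>M) = ennreal ((p / z) ^ m * ((1 - z) / (1 - p)) ^ n)"
proof -
  have F: "exp_family M S w r" using st by (simp add: stationary_def)
  let ?A = "(\<lambda>i. (i, 0::nat)) ` {1..m}"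
  have A: "finite ?A" "?A \<subseteq> S" and rA: "\<And>e. e \<in> ?A \<Longrightarrow> r e = p"
  proof -
    have "(i, 0) \<in> S \<and> r (i, 0) = p" if "i \<in> {1..m}" for i
      using st that by (cases i) (auto simp: stationary_def)
    then show "?A \<subseteq> S" "\<And>e. e \<in> ?A \<Longrightarrow> r e = p" by auto
  qed simp
  let ?D = "\<lambda>x. \<Prod>a\<in>?A. ennreal (z / r a * exp ((r a - z) * w a x))"
  let ?N = "density M ?D"
  let ?q = "\<lambda>e. if e \<in> ?A then z else r e"
  have N: "exp_family ?N S w ?q"
    using exp_family_tilt[OF F A, of "\<lambda>_. z"] pz by simp
  have "stationary ?N S w ?q z (1 - z) m n"
    using st N by (auto simp: stationary_def)
  note B = burke_rectangle[OF this]
  let ?Y = "\<lambda>e x. edge (\<lambda>e. w e x) (\<lambda>i. if 1 \<le> i \<and> i \<le> m then n else 0) (\<lambda>j. if 1 \<le> j \<and> j \<le> n then m else 0) e"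
  let ?J = "(\<lambda>j. (0::nat, j)) ` {1..n}"
  have Y: "?Y (0, j) x = vinc (\<lambda>e. w e x) m j" if "j \<in> {1..n}" for j x
    using that by (simp add: edge_def)
  have J: "(0, j) \<in> S - {1..m} \<times> {1..n}" "?q (0, j) = 1 - z" if "j \<in> {1..n}" for j
    using st that by (cases j; auto simp: stationary_def)+
  have Dm: "?D \<in> borel_measurable M"
  proof (rule borel_measurable_prod_ennreal)
    fix e assume "e \<in> ?A"
    then have [measurable]: "w e \<in> borel_measurable M" using A exp_familyD(3)[OF F] by auto
    show "(\<lambda>x. ennreal (z / r e * exp ((r e - z) * w e x))) \<in> borel_measurable M" by measurable
  qed
  have Gm: "(\<lambda>x. lpp (\<lambda>e. w e x) m' n') \<in> borel_measurable M" if "m' \<le> m" "n' \<le> n" for m' n'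
  proof (rule lpp_measurable)
    fix a b assume "a \<le> m'" "b \<le> n'" "(a, b) \<noteq> (0::nat, 0::nat)"
    then have "(a, b) \<in> S" using st that by (cases a; cases b) (auto simp: stationary_def)
    then show "w (a, b) \<in> borel_measurable M" by (rule exp_familyD(3)[OF F])
  qed
  have Vm: "(\<lambda>x. \<Prod>j\<in>{1..n}. ennreal (exp ((p - z) * vinc (\<lambda>e. w e x) m j))) \<in> borel_measurable M"
  proof (rule borel_measurable_prod_ennreal)
    fix j assume j: "j \<in> {1..n}"
    then have [measurable]: "(\<lambda>x. lpp (\<lambda>e. w e x) m j) \<in> borel_measurable M" "(\<lambda>x. lpp (\<lambda>e. w e x) m (j - 1)) \<in> borel_measurable M"
      by (auto intro!: Gm)
    show "(\<lambda>x. ennreal (exp ((p - z) * vinc (\<lambda>e. w e x) m j))) \<in> borel_measurable M"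
      unfolding vinc_def by measurable
  qed
  have "((1 - z) / (1 - p)) ^ n = (\<Prod>j\<in>{1..n}. (1 - z) / (1 - z - (p - z)))" by simp
  then have "ennreal (((1 - z) / (1 - p)) ^ n) = (\<Prod>j\<in>{1..n}. ennreal ((1 - z) / (1 - z - (p - z))))"
    using pz by (simp add: ennreal_power)
  also have "\<dots> = (\<Prod>j\<in>{1..n}. \<integral>\<^sup>+y. ennreal (exp ((p - z) * y)) \<partial>exp_measure (1 - z))"
    using pz by (intro prod.cong exp_measure_mgf[symmetric]) auto
  also have "\<dots> = (\<Prod>e\<in>?J. \<integral>\<^sup>+y. ennreal (exp ((p - z) * y)) \<partial>exp_measure (?q e))"
    using J by (subst prod.reindex) (auto simp: inj_on_def)
  also have "\<dots> = (\<integral>\<^sup>+x. (\<Prod>e\<in>?J. ennreal (exp ((p - z) * ?Y e x))) \<partial>?N)"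
    using J by (intro exp_family_prod[OF B, symmetric, where f="\<lambda>_ y. ennreal (exp ((p - z) * y))"]) auto
  also have "\<dots> = (\<integral>\<^sup>+x. (\<Prod>j\<in>{1..n}. ennreal (exp ((p - z) * vinc (\<lambda>e. w e x) m j))) \<partial>?N)"
  proof (rule nn_integral_cong)
    fix x
    have "(\<Prod>e\<in>?J. ennreal (exp ((p - z) * ?Y e x))) = (\<Prod>j\<in>{1..n}. ennreal (exp ((p - z) * ?Y (0, j) x)))"
      by (subst prod.reindex) (simp_all add: inj_on_def)
    also have "\<dots> = (\<Prod>j\<in>{1..n}. ennreal (exp ((p - z) * vinc (\<lambda>e. w e x) m j)))"
      by (rule prod.cong[OF refl]) (simp only: Y)
    finally show "(\<Prod>e\<in>?J. ennreal (exp ((p - z) * ?Y e x))) = (\<Prod>j\<in>{1..n}. ennreal (exp ((p - z) * vinc (\<lambda>e. w e x) m j)))" .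
  qed
  also have "\<dots> = (\<integral>\<^sup>+x. ?D x * (\<Prod>j\<in>{1..n}. ennreal (exp ((p - z) * vinc (\<lambda>e. w e x) m j))) \<partial>M)"
    by (rule nn_integral_density[OF Dm Vm])
  also have "\<dots> = (\<integral>\<^sup>+x. ennreal ((z / p) ^ m) * ennreal (exp ((p - z) * lpp (\<lambda>e. w e x) m n)) \<partial>M)"
  proof (rule nn_integral_cong)
    fix x
    have "?D x = (\<Prod>i\<in>{1..m}. ennreal (z / p * exp ((p - z) * w (i, 0) x)))"
      using rA by (subst prod.reindex) (auto simp: inj_on_def intro!: prod.cong)
    also have "\<dots> = ennreal ((z / p) ^ m * (\<Prod>i\<in>{1..m}. exp ((p - z) * w (i, 0) x)))"
      using pz by (subst prod_ennreal) (auto simp: prod.distrib prod_dividef power_divide)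
    also have "(\<Prod>i\<in>{1..m}. exp ((p - z) * w (i, 0) x)) = exp ((p - z) * (\<Sum>i\<in>{1..m}. w (i, 0) x))"
      by (simp add: exp_sum sum_distrib_left)
    finally have 1: "?D x = ennreal ((z / p) ^ m * exp ((p - z) * (\<Sum>i\<in>{1..m}. w (i, 0) x)))" .
    have 2: "(\<Prod>j\<in>{1..n}. ennreal (exp ((p - z) * vinc (\<lambda>e. w e x) m j))) = ennreal (exp ((p - z) * (\<Sum>j\<in>{1..n}. vinc (\<lambda>e. w e x) m j)))"
      by (subst prod_ennreal) (auto simp: exp_sum sum_distrib_left)
    have 3: "exp ((p - z) * lpp (\<lambda>e. w e x) m n) = exp ((p - z) * (\<Sum>i\<in>{1..m}. w (i, 0) x)) * exp ((p - z) * (\<Sum>j\<in>{1..n}. vinc (\<lambda>e. w e x) m j))"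
      by (subst lpp_eq_sum_vinc) (simp add: exp_add[symmetric] algebra_simps)
    show "?D x * (\<Prod>j\<in>{1..n}. ennreal (exp ((p - z) * vinc (\<lambda>e. w e x) m j))) = ennreal ((z / p) ^ m) * ennreal (exp ((p - z) * lpp (\<lambda>e. w e x) m n))"
      unfolding 1 2 3 using pz by (subst (1 2) ennreal_mult'[symmetric]) (auto simp: mult.assoc)
  qed
  also have "\<dots> = ennreal ((z / p) ^ m) * (\<integral>\<^sup>+x. ennreal (exp ((p - z) * lpp (\<lambda>e. w e x) m n)) \<partial>M)"
  proof (rule nn_integral_cmult)
    have [measurable]: "(\<lambda>x. lpp (\<lambda>e. w e x) m n) \<in> borel_measurable M" by (rule Gm) auto
    show "(\<lambda>x. ennreal (exp ((p - z) * lpp (\<lambda>e. w e x) m n))) \<in> borel_measurable M" by measurable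
  qed
  finally have *: "ennreal (((1 - z) / (1 - p)) ^ n) = ennreal ((z / p) ^ m) * (\<integral>\<^sup>+x. ennreal (exp ((p - z) * lpp (\<lambda>e. w e x) m n)) \<partial>M)" .
  have "ennreal ((p / z) ^ m * ((1 - z) / (1 - p)) ^ n) = ennreal ((p / z) ^ m) * (ennreal ((z / p) ^ m) * (\<integral>\<^sup>+x. ennreal (exp ((p - z) * lpp (\<lambda>e. w e x) m n)) \<partial>M))"
    using pz by (subst *[symmetric]) (simp add: ennreal_mult')
  also have "\<dots> = ennreal ((p / z) ^ m * (z / p) ^ m) * (\<integral>\<^sup>+x. ennreal (exp ((p - z) * lpp (\<lambda>e. w e x) m n)) \<partial>M)"
    using pz by (simp add: ennreal_mult' mult.assoc)
  also have "(p / z) ^ m * (z / p) ^ m = 1"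
    using pz by (simp add: power_mult_distrib[symmetric])
  finally show ?thesis by simp
qed

section \<open>Exit through the wrong axis\<close>

lemma stationary_scale:
  assumes st: "stationary M S w r a b m n" and s: "0 < s" "0 < u"
  shows "stationary M S (\<lambda>e x. (if snd e = 0 then s else if fst e = 0 then u else 1) * w e x)
     (\<lambda>e. r e / (if snd e = 0 then s else if fst e = 0 then u else 1)) (a / s) (b / u) m n"
proof -
  have "exp_family M S (\<lambda>e x. (if snd e = 0 then s else if fst e = 0 then u else 1) * w e x)
     (\<lambda>e. r e / (if snd e = 0 then s else if fst e = 0 then u else 1))"
    by (rule exp_family_scale) (use st s in \<open>auto simp: stationary_def\<close>)
  then show ?thesis using st by (simp add: stationary_def)
qed

lemma stationary_lpp_measurable:
  assumes st: "stationary M S w r a b m n" and le: "i \<le> m" "j \<le> n"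
  shows "(\<lambda>x. lpp (\<lambda>e. w e x) i j) \<in> borel_measurable M"
    and "(\<lambda>x. lpp (hor (\<lambda>e. w e x)) i j) \<in> borel_measurable M"
    and "(\<lambda>x. lpp (ver (\<lambda>e. w e x)) i j) \<in> borel_measurable M"
proof -
  have w: "w (a', b') \<in> borel_measurable M" if "a' \<le> i" "b' \<le> j" "(a', b') \<noteq> (0, 0)" for a' b'
  proof -
    have "(a', b') \<in> S" using st that le by (cases a'; cases b') (auto simp: stationary_def)
    then show ?thesis using st exp_familyD(3) by (auto simp: stationary_def)
  qed
  show "(\<lambda>x. lpp (\<lambda>e. w e x) i j) \<in> borel_measurable M"
    by (rule lpp_measurable) (rule w)
  show "(\<lambda>x. lpp (hor (\<lambda>e. w e x)) i j) \<in> borel_measurable M"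
  proof (rule lpp_measurable)
    fix a' b' assume "a' \<le> i" "b' \<le> j" "(a', b') \<noteq> (0::nat, 0::nat)"
    then show "(\<lambda>x. hor (\<lambda>e. w e x) (a', b')) \<in> borel_measurable M"
      using w by (cases a') simp_all
  qed
  show "(\<lambda>x. lpp (ver (\<lambda>e. w e x)) i j) \<in> borel_measurable M"
  proof (rule lpp_measurable)
    fix a' b' assume "a' \<le> i" "b' \<le> j" "(a', b') \<noteq> (0::nat, 0::nat)"
    then show "(\<lambda>x. ver (\<lambda>e. w e x) (a', b')) \<in> borel_measurable M"
      using w by (cases b') simp_all
  qed
qed

text \<open>
  How unlikely it is that the maximal path leaves through the horizontal axis when the endpoint
  \<open>(m, n)\<close> is steeper than the characteristic direction of \<open>z\<close>. Put \<open>p = z - h\<close> and \<open>q = z - 2 h\<close> and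
  increase the horizontal weights so that their rate becomes \<open>p\<close>; this only enlarges the event. On the
  event the passage time \<open>G\<^sub>2\<close> of the new model equals that of its horizontal paths, and therefore is at
  most the passage time \<open>G\<^sub>1\<close> of the model in which in addition the vertical rate is \<open>1 - q\<close>. So the
  probability is at most \<open>E exp (h (G\<^sub>1 - G\<^sub>2) / 2)\<close>, where a weighted arithmetic-geometric mean inequality
  separates the two exponentials, and both expectations are known exactly. The logarithm of their
  product is minus a second difference with step \<open>h\<close>, and its leading order is \<open>h\<^sup>2\<close> times the distance
  of the endpoint from the characteristic direction.
\<close>

lemma exit_bound:
  assumes st: "stationary M S w r z (1 - z) m n" and z: "0 < z" "z < 1" and h: "0 < h" "2 * h < z"
    and nn: "AE x in M. \<forall>e. 0 \<le> w e x"
  shows "measure M {x \<in> space M. lpp (ver (\<lambda>e. w e x)) m n \<le> lpp (hor (\<lambda>e. w e x)) m n}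
    \<le> exp (h\<^sup>2 / 2 * (real m / (z * (z - 2 * h)) - real n / (1 - z + h)\<^sup>2))"
proof -
  have F: "exp_family M S w r" using st by (simp add: stationary_def)
  interpret prob_space M by (rule exp_familyD(1)[OF F])
  define p q where "p = z - h" and "q = z - 2 * h"
  have pq: "0 < p" "p < 1" "0 < q" "q < 1" "p < z" "q < p" using z h by (auto simp: p_def q_def)
  define s u where "s = z / p" and "u = (1 - z) / (1 - q)"
  have su: "0 < s" "0 < u" "1 \<le> s" using pq z by (auto simp: s_def u_def)
  let ?W = "\<lambda>u e x. (if snd e = 0 then s else if fst e = 0 then u else 1) * w e x"
  let ?G1 = "\<lambda>x. lpp (\<lambda>e. ?W u e x) m n" and ?G2 = "\<lambda>x. lpp (\<lambda>e. ?W 1 e x) m n"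
  have st1: "stationary M S (?W u) (\<lambda>e. r e / (if snd e = 0 then s else if fst e = 0 then u else 1)) p (1 - q) m n"
    using stationary_scale[OF st su(1,2)] pq z by (simp add: s_def u_def)
  have st2: "stationary M S (?W 1) (\<lambda>e. r e / (if snd e = 0 then s else if fst e = 0 then 1 else 1)) p (1 - z) m n"
    using stationary_scale[OF st su(1), of 1] pq z by (simp add: s_def)
  define A where "A = (p / q) ^ m * ((1 - q) / (1 - p)) ^ n"
  define B where "B = (p / z) ^ m * ((1 - z) / (1 - p)) ^ n"
  have AB: "0 < A" "0 < B" using pq z by (auto simp: A_def B_def)
  have mA: "(\<integral>\<^sup>+x. ennreal (exp (h * ?G1 x)) \<partial>M) = ennreal A"
    using lpp_mgf[OF st1 pq(1,2,3,4)] by (simp add: A_def p_def q_def)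
  have mB: "(\<integral>\<^sup>+x. ennreal (exp (- h * ?G2 x)) \<partial>M) = ennreal B"
    using lpp_mgf[OF st2 pq(1,2) z] by (simp add: B_def p_def)
  have m1[measurable]: "?G1 \<in> borel_measurable M" by (rule stationary_lpp_measurable(1)[OF st1]) auto
  have m2[measurable]: "?G2 \<in> borel_measurable M" by (rule stationary_lpp_measurable(1)[OF st2]) auto
  let ?E = "{x \<in> space M. lpp (ver (\<lambda>e. w e x)) m n \<le> lpp (hor (\<lambda>e. w e x)) m n}"
  have E[measurable]: "?E \<in> sets M"
    using stationary_lpp_measurable(2,3)[OF st, of m n] by measurable
  \<comment> \<open>The weight in the inequality \<open>2 \<le> \<alpha> X + 1 / (\<alpha> X)\<close> that balances its two expectations.\<close>
  define \<alpha> where "\<alpha> = sqrt (B / A)"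
  have \<alpha>: "0 < \<alpha>" using AB by (simp add: \<alpha>_def)
  have pointwise: "indicator ?E x \<le> ennreal (\<alpha> / 2) * ennreal (exp (h * ?G1 x)) + ennreal (1 / (2 * \<alpha>)) * ennreal (exp (- h * ?G2 x))"
    if nn: "\<forall>e. 0 \<le> w e x" for x
  proof (cases "x \<in> ?E")
    case True
    let ?w = "\<lambda>e. w e x" and ?w1 = "\<lambda>e. ?W u e x" and ?w2 = "\<lambda>e. ?W 1 e x"
    have nn1: "0 \<le> ?w1 e" and nn2: "0 \<le> ?w2 e" for e
    proof -
      have "0 \<le> w e x" using nn by blast
      then show "0 \<le> ?w1 e" "0 \<le> ?w2 e" using su by simp_all
    qed
    have "lpp (ver ?w2) m n = lpp (ver ?w) m n"
      by (rule lpp_cong) (auto simp: ver_def)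
    also have "\<dots> \<le> lpp (hor ?w) m n" using True by simp
    also have "\<dots> \<le> lpp (hor ?w2) m n"
    proof (rule lpp_mono)
      fix e :: "nat \<times> nat"
      have "0 \<le> w e x" using nn by blast
      then have "w e x \<le> s * w e x" using su(3) mult_right_mono[of 1 s "w e x"] by simp
      then show "hor ?w e \<le> hor ?w2 e" by (cases e) (auto simp: hor_def)
    qed
    finally have "?G2 x = lpp (hor ?w2) m n"
      using lpp_max[of ?w2 m n, OF nn2] by simp
    also have "\<dots> = lpp (hor ?w1) m n"
      by (rule lpp_cong) (auto simp: hor_def)
    also have "\<dots> \<le> ?G1 x"
      using lpp_max[of ?w1 m n, OF nn1] by simp
    finally have le: "?G2 x \<le> ?G1 x" .
    define X where "X = exp (h * ?G2 x)"
    have X: "0 < X" by (simp add: X_def)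
    have "2 \<le> \<alpha> * X + 1 / (\<alpha> * X)"
    proof -
      have "0 \<le> (\<alpha> * X - 1)\<^sup>2" by simp
      then have "2 * (\<alpha> * X) \<le> (\<alpha> * X)\<^sup>2 + 1" by (simp add: power2_eq_square algebra_simps)
      then show ?thesis using \<alpha> X by (simp add: field_simps power2_eq_square)
    qed
    then have "1 \<le> \<alpha> / 2 * X + 1 / (2 * \<alpha>) * (1 / X)" by (simp add: field_simps)
    also have "1 / X = exp (- h * ?G2 x)" by (simp add: X_def exp_minus field_simps)
    also have "\<alpha> / 2 * X \<le> \<alpha> / 2 * exp (h * ?G1 x)"
      using le h \<alpha> unfolding X_def by (intro mult_left_mono) auto
    finally have 1: "1 \<le> \<alpha> / 2 * exp (h * ?G1 x) + 1 / (2 * \<alpha>) * exp (- h * ?G2 x)" by simp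
    have "ennreal 1 \<le> ennreal (\<alpha> / 2 * exp (h * ?G1 x) + 1 / (2 * \<alpha>) * exp (- h * ?G2 x))"
      by (rule ennreal_leI[OF 1])
    also have "\<dots> = ennreal (\<alpha> / 2) * ennreal (exp (h * ?G1 x)) + ennreal (1 / (2 * \<alpha>)) * ennreal (exp (- h * ?G2 x))"
      using \<alpha> by (subst ennreal_plus) (auto simp: ennreal_mult'[symmetric])
    finally show ?thesis using True by simp
  qed simp
  have "emeasure M ?E = (\<integral>\<^sup>+x. indicator ?E x \<partial>M)" by simp
  also have "\<dots> \<le> (\<integral>\<^sup>+x. ennreal (\<alpha> / 2) * ennreal (exp (h * ?G1 x)) + ennreal (1 / (2 * \<alpha>)) * ennreal (exp (- h * ?G2 x)) \<partial>M)"
    by (rule nn_integral_mono_AE) (use nn pointwise in auto)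
  also have "\<dots> = ennreal (\<alpha> / 2) * ennreal A + ennreal (1 / (2 * \<alpha>)) * ennreal B"
    by (subst nn_integral_add) (auto simp: nn_integral_cmult mA mB[simplified])
  also have "\<dots> = ennreal (\<alpha> / 2 * A + 1 / (2 * \<alpha>) * B)"
    using \<alpha> AB by (subst ennreal_plus) (auto simp: ennreal_mult'[symmetric])
  also have "\<alpha> / 2 * A + 1 / (2 * \<alpha>) * B = sqrt (A * B)"
  proof -
    have a: "\<alpha> * A = sqrt (A * B)"
    proof -
      have "\<alpha> * A = sqrt (B / A) * sqrt (A * A)" using AB by (simp add: \<alpha>_def)
      also have "\<dots> = sqrt (A * B)" using AB by (subst real_sqrt_mult[symmetric]) (simp add: field_simps)
      finally show ?thesis .
    qed
    have b: "B / \<alpha> = sqrt (A * B)"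
    proof -
      have "sqrt (A * B) * \<alpha> = sqrt (B * B)" using AB unfolding \<alpha>_def
        by (subst real_sqrt_mult[symmetric]) (simp add: field_simps)
      then show ?thesis using \<alpha> AB by (simp add: field_simps)
    qed
    have "\<alpha> / 2 * A + 1 / (2 * \<alpha>) * B = (\<alpha> * A + B / \<alpha>) / 2" by (simp add: field_simps)
    then show ?thesis using a b by simp
  qed
  finally have "measure M ?E \<le> sqrt (A * B)"
    using AB by (simp add: emeasure_eq_measure)
  also have "A * B \<le> (exp (h\<^sup>2 / 2 * (real m / (z * (z - 2 * h)) - real n / (1 - z + h)\<^sup>2)))\<^sup>2"
  proof -
    have c1: "p * p / (q * z) = 1 + h\<^sup>2 / (q * z)"
    proof -
      have "p * p = q * z + h\<^sup>2" by (simp add: p_def q_def power2_eq_square algebra_simps)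
      then show ?thesis using pq z by (simp add: add_divide_distrib)
    qed
    have c2: "(1 - q) * (1 - z) / ((1 - p) * (1 - p)) = 1 - h\<^sup>2 / (1 - p)\<^sup>2"
    proof -
      have "(1 - q) * (1 - z) = (1 - p)\<^sup>2 - h\<^sup>2" by (simp add: p_def q_def power2_eq_square algebra_simps)
      then show ?thesis using pq z by (simp add: diff_divide_distrib power2_eq_square)
    qed
    have pos2: "0 \<le> 1 - h\<^sup>2 / (1 - p)\<^sup>2"
      unfolding c2[symmetric] using pq z by simp
    have "A * B = (p * p / (q * z)) ^ m * ((1 - q) * (1 - z) / ((1 - p) * (1 - p))) ^ n"
      by (simp add: A_def B_def power_mult_distrib power_divide mult_ac)
    also have "\<dots> = (1 + h\<^sup>2 / (q * z)) ^ m * (1 - h\<^sup>2 / (1 - p)\<^sup>2) ^ n"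
      by (simp only: c1 c2)
    also have "\<dots> \<le> exp (h\<^sup>2 / (q * z)) ^ m * exp (- (h\<^sup>2 / (1 - p)\<^sup>2)) ^ n"
    proof (intro mult_mono power_mono)
      show "1 + h\<^sup>2 / (q * z) \<le> exp (h\<^sup>2 / (q * z))" by (rule exp_ge_add_one_self)
      show "1 - h\<^sup>2 / (1 - p)\<^sup>2 \<le> exp (- (h\<^sup>2 / (1 - p)\<^sup>2))" using exp_ge_add_one_self[of "- (h\<^sup>2 / (1 - p)\<^sup>2)"] by simp
    qed (use pos2 pq z in auto)
    also have "\<dots> = (exp (h\<^sup>2 / 2 * (real m / (z * (z - 2 * h)) - real n / (1 - z + h)\<^sup>2)))\<^sup>2"
    proof -
      have "exp (h\<^sup>2 / (q * z)) ^ m * exp (- (h\<^sup>2 / (1 - p)\<^sup>2)) ^ n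
          = exp (real m * (h\<^sup>2 / (q * z)) + real n * (- (h\<^sup>2 / (1 - p)\<^sup>2)))"
        by (simp only: exp_of_nat_mult[symmetric] exp_add[symmetric])
      also have "real m * (h\<^sup>2 / (q * z)) + real n * (- (h\<^sup>2 / (1 - p)\<^sup>2))
          = 2 * (h\<^sup>2 / 2 * (real m / (z * q) - real n / (1 - p)\<^sup>2))"
        by (simp add: right_diff_distrib mult_ac)
      also have "exp \<dots> = (exp (h\<^sup>2 / 2 * (real m / (z * q) - real n / (1 - p)\<^sup>2)))\<^sup>2"
        by (rule exp_double)
      finally show ?thesis by (simp add: p_def q_def algebra_simps)
    qed
    finally show ?thesis .
  qed
  finally show ?thesis by simp
qed

lemma transpose_hor: "lpp (hor (\<lambda>(i, j). w (j, i))) i j = lpp (ver w) j i"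
proof -
  have "hor (\<lambda>(i, j). w (j, i)) = (\<lambda>(i, j). ver w (j, i))" by (auto simp: hor_def ver_def fun_eq_iff)
  then show ?thesis using lpp_transpose[of "ver w" i j] by simp
qed

lemma transpose_ver: "lpp (ver (\<lambda>(i, j). w (j, i))) i j = lpp (hor w) j i"
proof -
  have "ver (\<lambda>(i, j). w (j, i)) = (\<lambda>(i, j). hor w (j, i))" by (auto simp: hor_def ver_def fun_eq_iff)
  then show ?thesis using lpp_transpose[of "hor w" i j] by simp
qed

text \<open>
  Reflection in the diagonal exchanges the axes, so \<open>z\<close> becomes \<open>1 - z\<close> and \<open>m\<close> and \<open>n\<close> trade places.
\<close>

lemma exit_bound_transposed:
  assumes st: "stationary M S w r z (1 - z) m n" and z: "0 < z" "z < 1" and h: "0 < h" "2 * h < 1 - z"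
    and nn: "AE x in M. \<forall>e. 0 \<le> w e x"
  shows "measure M {x \<in> space M. lpp (hor (\<lambda>e. w e x)) m n \<le> lpp (ver (\<lambda>e. w e x)) m n}
    \<le> exp (h\<^sup>2 / 2 * (real n / ((1 - z) * (1 - z - 2 * h)) - real m / (z + h)\<^sup>2))"
proof -
  have F: "exp_family M S w r" using st by (simp add: stationary_def)
  have "exp_family M (prod.swap ` S) (\<lambda>e. w (prod.swap e)) (\<lambda>e. r (prod.swap e))"
    by (rule exp_family_reindex[OF F]) (auto simp: inj_on_def image_image)
  then have st': "stationary M (prod.swap ` S) (\<lambda>e. w (prod.swap e)) (\<lambda>e. r (prod.swap e)) (1 - z) (1 - (1 - z)) n m"
    using st by (auto simp: stationary_def image_iff intro!: bexI[of _ "(_, _)"])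
  have nn': "AE x in M. \<forall>e. 0 \<le> w (prod.swap e) x" using nn by eventually_elim auto
  have swap: "(\<lambda>e. w (prod.swap e) x) = (\<lambda>(i, j). (\<lambda>e. w e x) (j, i))" for x by auto
  have eq: "lpp (hor (\<lambda>e. w (prod.swap e) x)) n m = lpp (ver (\<lambda>e. w e x)) m n"
    "lpp (ver (\<lambda>e. w (prod.swap e) x)) n m = lpp (hor (\<lambda>e. w e x)) m n" for x
    unfolding swap by (rule transpose_hor, rule transpose_ver)
  show ?thesis
    using exit_bound[OF st' _ _ h nn'] z unfolding eq by simp
qed

section \<open>Up-right paths and uniqueness of the maximal path\<close>

text \<open>
  The order in which a path visits its points: a path is a strictly increasing list, so it is
  determined by the set of its points.
\<close>

definition below :: "nat \<times> nat \<Rightarrow> nat \<times> nat \<Rightarrow> bool" where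
  "below p q \<longleftrightarrow> fst p \<le> fst q \<and> snd p \<le> snd q \<and> fst p + snd p < fst q + snd q"

lemma path_sorted:
  assumes "successively up_right_step \<pi>"
  shows "sorted_wrt below \<pi>"
proof -
  have "successively below \<pi>"
    using assms by (rule successively_mono) (auto simp: up_right_step_def below_def)
  moreover have "transp below" by (auto simp: transp_def below_def)
  ultimately show ?thesis by (simp add: successively_conv_sorted_wrt)
qed

lemma sorted_wrt_below_unique:
  assumes "sorted_wrt below xs" "sorted_wrt below ys" "set xs = set ys"
  shows "xs = ys"
  using assms
proof (induction xs arbitrary: ys)
  case (Cons x xs)
  then obtain y ys' where ys: "ys = y # ys'" by (cases ys) auto
  have irr: "\<not> below p p" for p by (simp add: below_def)
  have asym: "\<not> (below p q \<and> below q p)" for p q by (auto simp: below_def)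
  have "x = y \<or> below y x" using Cons.prems ys by auto
  moreover have "y = x \<or> below x y" using Cons.prems ys by auto
  ultimately have xy: "x = y" using asym by blast
  have "x \<notin> set xs" "y \<notin> set ys'" using Cons.prems(1,2) ys irr[of x] irr[of y] by auto
  then have "set xs = set ys'" using Cons.prems(3) ys xy by auto
  then show ?case using Cons ys xy by auto
qed simp

text \<open>
  A potential that grows by at least the weight of the entered point along each step bounds the
  weight of a path by the difference of its end values. It is applied to passage times from the
  origin and, with reversed sign, to passage times to the endpoint.
\<close>

lemma path_sum_le:
  assumes F: "\<And>p q. p \<in> set \<pi> \<Longrightarrow> q \<in> set \<pi> \<Longrightarrow> up_right_step p q \<Longrightarrow> F p + w q \<le> F q"
    and "successively up_right_step \<pi>" "\<pi> \<noteq> []"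
  shows "F (hd \<pi>) + (\<Sum>p\<in>set \<pi>. w p) \<le> F (last \<pi>) + (w (hd \<pi>) :: real)"
  using assms
proof (induction \<pi>)
  case (Cons p \<pi>)
  show ?case
  proof (cases "\<pi> = []")
    case False
    have step: "up_right_step p (hd \<pi>)" and succ: "successively up_right_step \<pi>"
      using Cons.prems(2) False by (auto simp: successively_Cons)
    have IH: "F (hd \<pi>) + (\<Sum>p\<in>set \<pi>. w p) \<le> F (last \<pi>) + w (hd \<pi>)"
      by (rule Cons.IH[OF Cons.prems(1) succ False]) auto
    have Fp: "F p + w (hd \<pi>) \<le> F (hd \<pi>)"
      by (rule Cons.prems(1)[OF _ _ step]) (use False in auto)
    have "p \<notin> set \<pi>" using path_sorted[OF Cons.prems(2)] by (auto simp: below_def)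
    then have "(\<Sum>p\<in>set (p # \<pi>). w p) = w p + (\<Sum>p\<in>set \<pi>. w p)" by simp
    then show ?thesis using IH Fp False by simp
  qed simp
qed simp

lemma path_weight_le_lpp:
  assumes "up_right_path m n \<pi>" "w (0, 0) = 0"
  shows "path_weight w \<pi> \<le> lpp w m n"
proof -
  have "(\<lambda>(i, j). lpp w i j) p + w q \<le> (\<lambda>(i, j). lpp w i j) q" if "up_right_step p q" for p q
    using that lpp_step_right lpp_step_up by (cases p) (auto simp: up_right_step_def)
  then have "(\<lambda>(i, j). lpp w i j) (hd \<pi>) + (\<Sum>p\<in>set \<pi>. w p) \<le> (\<lambda>(i, j). lpp w i j) (last \<pi>) + w (hd \<pi>)"
    by (rule path_sum_le) (use assms in \<open>auto simp: up_right_path_def\<close>)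
  then show ?thesis using assms by (simp add: up_right_path_def path_weight_def)
qed

lemma path_extend:
  assumes p: "up_right_path i j \<pi>" and step: "up_right_step (i, j) (i', j')"
  shows "up_right_path i' j' (\<pi> @ [(i', j')])" "path_weight w (\<pi> @ [(i', j')]) = path_weight w \<pi> + w (i', j')"
proof -
  show 1: "up_right_path i' j' (\<pi> @ [(i', j')])"
    using p step by (auto simp: up_right_path_def successively_append_iff)
  then have "sorted_wrt below (\<pi> @ [(i', j')])" using path_sorted by (auto simp: up_right_path_def)
  then have "(i', j') \<notin> set \<pi>" by (auto simp: sorted_wrt_append below_def)
  then show "path_weight w (\<pi> @ [(i', j')]) = path_weight w \<pi> + w (i', j')"
    by (simp add: path_weight_def)
qed

lemma lpp_attained:
  assumes "w (0, 0) = 0"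
  shows "\<exists>\<pi>. up_right_path i j \<pi> \<and> path_weight w \<pi> = lpp w i j"
proof (induction "i + j" arbitrary: i j rule: less_induct)
  case less
  consider "i = 0" "j = 0" | a where "i = Suc a" "j = 0" | b where "i = 0" "j = Suc b" | a b where "i = Suc a" "j = Suc b"
    by (cases i; cases j) auto
  then show ?case
  proof cases
    case 1
    then have "up_right_path i j [(0, 0)]" "path_weight w [(0, 0)] = lpp w i j"
      using assms by (auto simp: up_right_path_def path_weight_def)
    then show ?thesis by blast
  next
    case (2 a)
    then obtain \<pi> where "up_right_path a 0 \<pi>" "path_weight w \<pi> = lpp w a 0" using less[of a 0] by auto
    then show ?thesis using path_extend(1)[of a 0 \<pi> "Suc a" 0] path_extend(2)[of a 0 \<pi> "Suc a" 0 w] 2 by (auto simp: up_right_step_def)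
  next
    case (3 b)
    then obtain \<pi> where "up_right_path 0 b \<pi>" "path_weight w \<pi> = lpp w 0 b" using less[of 0 b] by auto
    then show ?thesis using path_extend(1)[of 0 b \<pi> 0 "Suc b"] path_extend(2)[of 0 b \<pi> 0 "Suc b" w] 3 by (auto simp: up_right_step_def)
  next
    case (4 a b)
    show ?thesis
    proof (cases "lpp w (Suc a) b \<le> lpp w a (Suc b)")
      case True
      obtain \<pi> where "up_right_path a (Suc b) \<pi>" "path_weight w \<pi> = lpp w a (Suc b)"
        using less[of a "Suc b"] 4 by auto
      then show ?thesis using path_extend(1)[of a "Suc b" \<pi> "Suc a" "Suc b"] path_extend(2)[of a "Suc b" \<pi> "Suc a" "Suc b" w] 4 True
        by (auto simp: up_right_step_def max_def intro!: exI[of _ "\<pi> @ [(Suc a, Suc b)]"])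
    next
      case False
      obtain \<pi> where "up_right_path (Suc a) b \<pi>" "path_weight w \<pi> = lpp w (Suc a) b"
        using less[of "Suc a" b] 4 by auto
      then show ?thesis using path_extend(1)[of "Suc a" b \<pi> "Suc a" "Suc b"] path_extend(2)[of "Suc a" b \<pi> "Suc a" "Suc b" w] 4 False
        by (auto simp: up_right_step_def max_def intro!: exI[of _ "\<pi> @ [(Suc a, Suc b)]"])
    qed
  qed
qed

text \<open>
  No two different finite sets of points other than the origin have the same weight, so in particular no two paths tie.
\<close>

definition generic :: "(nat \<times> nat \<Rightarrow> real) \<Rightarrow> bool" where
  "generic w \<longleftrightarrow> (\<forall>A B. finite A \<longrightarrow> finite B \<longrightarrow> (0, 0) \<notin> A \<longrightarrow> (0, 0) \<notin> B \<longrightarrow> A \<noteq> B \<longrightarrow> sum w A \<noteq> sum w B)"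

text \<open>
  Without ties the definite description in \<open>maximal_path\<close> denotes the maximiser.
\<close>

lemma maximal_path_correct:
  assumes g: "generic w" and w0: "w (0, 0) = 0"
  shows "is_maximal_path w m n (maximal_path w m n)"
    and "path_weight w (maximal_path w m n) = lpp w m n"
proof -
  obtain \<pi> where \<pi>: "up_right_path m n \<pi>" "path_weight w \<pi> = lpp w m n" using lpp_attained[of w m n, OF w0] by blast
  have max: "is_maximal_path w m n \<pi>"
    unfolding is_maximal_path_def using \<pi> path_weight_le_lpp[of m n _ w] w0 by auto
  have uniq: "\<pi>' = \<pi>" if "is_maximal_path w m n \<pi>'" for \<pi>'
  proof -
    have p': "up_right_path m n \<pi>'" using that by (simp add: is_maximal_path_def)
    have eq: "path_weight w \<pi>' = path_weight w \<pi>"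
      using that max p' \<pi>(1) unfolding is_maximal_path_def by (meson order_antisym)
    have 0: "(0, 0) \<in> set \<pi>" "(0, 0) \<in> set \<pi>'"
      using \<pi>(1) p' by (metis hd_in_set up_right_path_def)+
    have "sum w (set \<pi>' - {(0, 0)}) = sum w (set \<pi> - {(0, 0)})"
      using eq w0 0 by (simp add: path_weight_def sum_diff1)
    then have "set \<pi>' - {(0, 0)} = set \<pi> - {(0, 0)}"
      using g unfolding generic_def by (metis Diff_iff finite_Diff List.finite_set insertI1)
    then have "set \<pi>' = set \<pi>" using 0 by blast
    then show ?thesis
      using sorted_wrt_below_unique path_sorted \<pi>(1) p' by (auto simp: up_right_path_def)
  qed
  have eq: "maximal_path w m n = \<pi>"
    unfolding maximal_path_def by (rule the_equality, rule max, rule uniq)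
  show "is_maximal_path w m n (maximal_path w m n)" "path_weight w (maximal_path w m n) = lpp w m n"
    using eq max \<pi> by auto
qed

lemma path_comparable:
  assumes "successively up_right_step \<pi>" "p \<in> set \<pi>" "q \<in> set \<pi>"
  shows "p = q \<or> below p q \<or> below q p"
proof -
  obtain i j where "i < length \<pi>" "p = \<pi> ! i" "j < length \<pi>" "q = \<pi> ! j"
    using assms(2,3) unfolding in_set_conv_nth by blast
  then show ?thesis
    using sorted_wrt_nth_less[OF path_sorted[OF assms(1)]] by (metis linorder_neqE_nat)
qed

lemma exit_point_in_path:
  assumes "up_right_path m n \<pi>"
  shows "exit_point \<pi> \<in> set \<pi>" "fst (exit_point \<pi>) = 0 \<or> snd (exit_point \<pi>) = 0"
proof -
  have "(0, 0) \<in> set \<pi>" using assms by (metis hd_in_set up_right_path_def)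
  then have "filter (\<lambda>(i, j). i = 0 \<or> j = 0) \<pi> \<noteq> []" by (auto simp: filter_empty_conv)
  then have "exit_point \<pi> \<in> set (filter (\<lambda>(i, j). i = 0 \<or> j = 0) \<pi>)"
    unfolding exit_point_def by (rule last_in_set)
  then show "exit_point \<pi> \<in> set \<pi>" "fst (exit_point \<pi>) = 0 \<or> snd (exit_point \<pi>) = 0" by auto
qed

lemma path_le_last:
  assumes "up_right_path m n \<pi>" "p \<in> set \<pi>"
  shows "fst p \<le> m" "snd p \<le> n"
proof -
  have s: "sorted_wrt below \<pi>" and l: "last \<pi> = (m, n)" and ne: "\<pi> \<noteq> []"
    using assms path_sorted by (auto simp: up_right_path_def)
  have "sorted_wrt below (butlast \<pi> @ [last \<pi>])" using s ne by simp
  moreover have "p \<in> set (butlast \<pi>) \<or> p = last \<pi>"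
    using assms(2) ne by (metis append_butlast_last_id Un_iff set_append set_ConsD list.set(1) empty_iff)
  ultimately have "p = (m, n) \<or> below p (m, n)" by (auto simp: sorted_wrt_append l)
  then show "fst p \<le> m" "snd p \<le> n" by (auto simp: below_def)
qed

text \<open>
  A path that stays on the axis up to the point \<open>(k, 0)\<close> and beyond avoids every bulk point of the
  first \<open>k\<close> columns. Its weight is unchanged when these points are given weight zero, which amounts to
  closing the vertical boundary of the environment shifted to \<open>(k, 0)\<close>. Thus an exit beyond \<open>k\<close> is a
  horizontal exit of the shifted model.
\<close>

lemma exit_beyond_imp:
  assumes nn: "\<And>p. 0 \<le> w p" and w0: "w (0, 0) = 0" and \<pi>: "up_right_path m n \<pi>"
    and max: "path_weight w \<pi> = lpp w m n" and k: "int k < signed_exit (exit_point \<pi>)"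
  shows "k < m" "lpp (ver (shift k w)) (m - k) n \<le> lpp (hor (shift k w)) (m - k) n"
proof -
  have ep: "exit_point \<pi> \<in> set \<pi>" by (rule exit_point_in_path[OF \<pi>])
  have sn: "snd (exit_point \<pi>) = 0" and fs: "k < fst (exit_point \<pi>)"
    using k by (auto simp: signed_exit_def split: if_splits)
  show km: "k < m" using path_le_last[OF \<pi> ep] fs by simp
  define v where "v = (\<lambda>(i, j). if i \<le> k \<and> 0 < j then 0 else w (i, j))"
  have vv: "lpp v i j = lpp w i 0" if "i \<le> k" for i j
    using that
  proof (induction "i + j" arbitrary: i j rule: less_induct)
    case less
    consider "i = 0" "j = 0" | a where "i = Suc a" "j = 0" | b where "i = 0" "j = Suc b" | a b where "i = Suc a" "j = Suc b"
      by (cases i; cases j) auto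
    then show ?case
    proof cases
      case (2 a) then show ?thesis using less(1)[of a 0] less(2) by (simp add: v_def)
    next
      case (3 b) then show ?thesis using less(1)[of 0 b] by (simp add: v_def)
    next
      case (4 a b)
      then have "lpp v a (Suc b) = lpp w a 0" "lpp v (Suc a) b = lpp w (Suc a) 0"
        using less(1)[of a "Suc b"] less(1)[of "Suc a" b] less(2) by auto
      then show ?thesis using 4 less(2) nn[of "(Suc a, 0)"] by (simp add: v_def)
    qed simp
  qed
  have "path_weight w \<pi> = path_weight v \<pi>"
    unfolding path_weight_def
  proof (rule sum.cong[OF refl])
    fix p assume p: "p \<in> set \<pi>"
    have "\<not> (fst p \<le> k \<and> 0 < snd p)"
      using path_comparable[of \<pi> p "exit_point \<pi>"] \<pi> p ep sn fs by (auto simp: up_right_path_def below_def)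
    then show "w p = v p" by (cases p) (auto simp: v_def)
  qed
  also have "\<dots> \<le> lpp v m n" by (rule path_weight_le_lpp[OF \<pi>]) (simp add: v_def w0)
  also have "\<dots> = lpp w k 0 + lpp (shift k v) (m - k) n"
    using lpp_shift[of v k "m - k" n] km vv[of k 0] by simp
  also have "lpp (shift k v) (m - k) n = lpp (hor (shift k w)) (m - k) n"
  proof (rule lpp_cong)
    fix a b assume "(a, b) \<noteq> (0::nat, 0::nat)"
    then show "shift k v (a, b) = hor (shift k w) (a, b)"
    proof (cases a)
      case 0
      then show ?thesis by (simp add: vinc_def vv)
    next
      case (Suc a')
      then show ?thesis by (simp add: v_def)
    qed
  qed
  finally have "lpp w m n \<le> lpp w k 0 + lpp (hor (shift k w)) (m - k) n" using max by simp
  moreover have "lpp w m n = lpp w k 0 + lpp (shift k w) (m - k) n"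
    using lpp_shift[of w k "m - k" n] km by simp
  moreover have "0 \<le> shift k w p" for p
    using nn vinc_nonneg[of w, OF nn] by (cases p) (auto simp: shift_def)
  ultimately show "lpp (ver (shift k w)) (m - k) n \<le> lpp (hor (shift k w)) (m - k) n"
    using lpp_max[of "shift k w" "m - k" n] by auto
qed

lemma AE_exp_measure_neq: "AE y in exp_measure a. y \<noteq> c"
proof -
  have "AE y in lborel. y \<noteq> c" by (rule AE_lborel_singleton)
  then show ?thesis unfolding exp_measure_def by (subst AE_density) auto
qed

text \<open>
  Conditionally on the other coordinates, equality of the sums fixes the value of the coordinate
  \<open>p\<close>, which has a density.
\<close>

lemma exp_family_sum_neq:
  fixes X :: "'i \<Rightarrow> 'a \<Rightarrow> real"
  assumes F: "exp_family M S X r" and A: "finite A" "A \<subseteq> S" "finite B" "B \<subseteq> S" and p: "p \<in> A" "p \<notin> B"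
  shows "AE x in M. (\<Sum>e\<in>A. X e x) \<noteq> (\<Sum>e\<in>B. X e x)"
proof -
  interpret prob_space M by (rule exp_familyD(1)[OF F])
  let ?J = "(A \<union> B) - {p}"
  have Xm: "X e \<in> borel_measurable M" if "e \<in> S" for e using exp_familyD(3)[OF F that] .
  have [measurable]: "(\<lambda>x. \<Sum>e\<in>A. X e x) \<in> borel_measurable M" "(\<lambda>x. \<Sum>e\<in>B. X e x) \<in> borel_measurable M"
    "(\<lambda>x. \<Sum>e\<in>A - {p}. X e x) \<in> borel_measurable M"
    using A by (auto intro!: borel_measurable_sum Xm)
  have Gm: "(\<lambda>g. \<Sum>e\<in>C. g e) \<in> borel_measurable (Pi\<^sub>M ?J (\<lambda>_. borel :: real measure))" if "C \<subseteq> ?J" for C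
    using that by (intro borel_measurable_sum measurable_component_singleton) auto
  have [measurable]: "(\<lambda>g. \<Sum>e\<in>A - {p}. g e) \<in> borel_measurable (Pi\<^sub>M ?J (\<lambda>_. borel :: real measure))"
    "(\<lambda>g. \<Sum>e\<in>B. g e) \<in> borel_measurable (Pi\<^sub>M ?J (\<lambda>_. borel :: real measure))"
    using p by (auto intro!: Gm)
  let ?H = "\<lambda>y (g :: 'i \<Rightarrow> real). indicator {y. y = (\<Sum>e\<in>B. g e) - (\<Sum>e\<in>A - {p}. g e)} y :: ennreal"
  let ?R = "\<lambda>x. \<lambda>e\<in>?J. X e x"
  have R: "(\<Sum>e\<in>B. ?R x e) = (\<Sum>e\<in>B. X e x)" "(\<Sum>e\<in>A - {p}. ?R x e) = (\<Sum>e\<in>A - {p}. X e x)" for x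
    using p by (auto intro!: sum.cong)
  have "(\<integral>\<^sup>+x. indicator {x\<in>space M. (\<Sum>e\<in>A. X e x) = (\<Sum>e\<in>B. X e x)} x \<partial>M) = (\<integral>\<^sup>+x. ?H (X p x) (?R x) \<partial>M)"
    unfolding R using A p by (intro nn_integral_cong) (auto simp: indicator_def sum.remove[of A p])
  also have "\<dots> = (\<integral>\<^sup>+y. \<integral>\<^sup>+x. ?H y (?R x) \<partial>M \<partial>exp_measure (r p))"
  proof (rule exp_family_peel[OF F])
    show "(\<lambda>(y, g). ?H y g) \<in> borel_measurable (borel \<Otimes>\<^sub>M Pi\<^sub>M ?J (\<lambda>_. borel))"
      unfolding indicator_def by measurable
  qed (use A p in auto)
  also have "\<dots> = (\<integral>\<^sup>+x. \<integral>\<^sup>+y. ?H y (?R x) \<partial>exp_measure (r p) \<partial>M)"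
  proof -
    interpret E: pair_sigma_finite M "exp_measure (r p)"
      by (simp add: pair_sigma_finite_def sigma_finite_exp_measure sigma_finite_measure_axioms)
    show ?thesis unfolding R indicator_def by (rule E.Fubini') measurable
  qed
  also have "\<dots> = (\<integral>\<^sup>+x. 0 \<partial>M)"
  proof (rule nn_integral_cong)
    fix x
    have "(\<integral>\<^sup>+y. ?H y (?R x) \<partial>exp_measure (r p)) = (\<integral>\<^sup>+y. 0 \<partial>exp_measure (r p))"
      by (rule nn_integral_cong_AE) (use AE_exp_measure_neq in \<open>auto simp: indicator_def\<close>)
    then show "(\<integral>\<^sup>+y. ?H y (?R x) \<partial>exp_measure (r p)) = 0" by simp
  qed
  finally have "(\<integral>\<^sup>+x. indicator {x\<in>space M. (\<Sum>e\<in>A. X e x) = (\<Sum>e\<in>B. X e x)} x \<partial>M) = 0" by simp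
  then have "AE x in M. indicator {x\<in>space M. (\<Sum>e\<in>A. X e x) = (\<Sum>e\<in>B. X e x)} x = (0::ennreal)"
    by (subst (asm) nn_integral_0_iff_AE) auto
  then show ?thesis
    by (rule AE_mp) (auto intro!: AE_I2 simp: indicator_def split: if_splits)
qed

lemma exp_family_generic:
  assumes F: "exp_family M (UNIV - {(0, 0)}) w r"
  shows "AE x in M. generic (\<lambda>p. w p x)"
proof -
  have 1: "AE x in M. \<forall>xs ys. (0, 0) \<notin> set xs \<longrightarrow> (0, 0) \<notin> set ys \<longrightarrow> set xs \<noteq> set ys \<longrightarrow>
      (\<Sum>e\<in>set xs. w e x) \<noteq> (\<Sum>e\<in>set ys. w e x)"
  proof (subst AE_all_countable, intro allI, subst AE_all_countable, intro allI)
    fix xs ys :: "(nat \<times> nat) list"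
    show "AE x in M. (0, 0) \<notin> set xs \<longrightarrow> (0, 0) \<notin> set ys \<longrightarrow> set xs \<noteq> set ys \<longrightarrow>
      (\<Sum>e\<in>set xs. w e x) \<noteq> (\<Sum>e\<in>set ys. w e x)"
    proof (cases "(0, 0) \<notin> set xs \<and> (0, 0) \<notin> set ys \<and> set xs \<noteq> set ys")
      case True
      then have sub: "set xs \<subseteq> UNIV - {(0, 0)}" "set ys \<subseteq> UNIV - {(0, 0)}" by auto
      from True consider p where "p \<in> set xs" "p \<notin> set ys" | p where "p \<in> set ys" "p \<notin> set xs" by blast
      then show ?thesis
      proof cases
        case (1 p)
        show ?thesis
          using exp_family_sum_neq[OF F List.finite_set sub(1) List.finite_set sub(2) 1] by eventually_elim auto
      next
        case (2 p)
        show ?thesis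
          using exp_family_sum_neq[OF F List.finite_set sub(2) List.finite_set sub(1) 2] by eventually_elim auto
      qed
    qed auto
  qed
  then show ?thesis
  proof eventually_elim
    case (elim x)
    show ?case unfolding generic_def
    proof (intro allI impI)
      fix A B :: "(nat \<times> nat) set"
      assume *: "finite A" "finite B" "(0, 0) \<notin> A" "(0, 0) \<notin> B" "A \<noteq> B"
      obtain xs ys where "set xs = A" "set ys = B" using *(1,2) finite_list by metis
      then show "(\<Sum>p\<in>A. w p x) \<noteq> (\<Sum>p\<in>B. w p x)" using elim * by auto
    qed
  qed
qed

section \<open>Upper tail of the exit point\<close>

definition lpp_rate :: "real \<Rightarrow> nat \<times> nat \<Rightarrow> real" where
  "lpp_rate z = (\<lambda>(i, j). if j = 0 then z else if i = 0 then 1 - z else 1)"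

lemma stationary_lpp_exp_family:
  assumes st: "stationary_lpp M \<omega> \<rho>" and \<rho>: "0 < \<rho>" "\<rho> < 1"
  shows "exp_family M (UNIV - {(0, 0)}) \<omega> (lpp_rate (1 - \<rho>))"
proof -
  interpret stationary_lpp M \<omega> \<rho> by fact
  let ?S = "UNIV - {(0 :: nat, 0 :: nat)}"
  have dist: "distributed M lborel (\<omega> e) (exponential_density (lpp_rate (1 - \<rho>) e))" if "e \<in> ?S" for e
    using that horizontal vertical bulk by (cases e; cases "fst e"; cases "snd e") (auto simp: lpp_rate_def)
  have "(\<integral>\<^sup>+x. (\<Prod>e\<in>J. f e (\<omega> e x)) \<partial>M) = (\<Prod>e\<in>J. \<integral>\<^sup>+y. f e y \<partial>exp_measure (lpp_rate (1 - \<rho>) e))"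
    if J: "finite J" "J \<subseteq> ?S" "\<forall>e\<in>J. f e \<in> borel_measurable borel" for J and f :: "nat \<times> nat \<Rightarrow> real \<Rightarrow> ennreal"
  proof -
    have "indep_vars (\<lambda>_. borel) \<omega> J" by (rule indep_vars_subset[OF indep]) simp
    then have "indep_vars (\<lambda>_. borel) (\<lambda>e x. f e (\<omega> e x)) J"
      by (rule indep_vars_compose2) (use J in auto)
    then have "(\<integral>\<^sup>+x. (\<Prod>e\<in>J. f e (\<omega> e x)) \<partial>M) = (\<Prod>e\<in>J. \<integral>\<^sup>+x. f e (\<omega> e x) \<partial>M)"
      using J(1) by (intro indep_vars_nn_integral) auto
    also have "\<dots> = (\<Prod>e\<in>J. \<integral>\<^sup>+y. f e y \<partial>exp_measure (lpp_rate (1 - \<rho>) e))"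
    proof (rule prod.cong[OF refl])
      fix e assume e: "e \<in> J"
      have fm: "f e \<in> borel_measurable borel" using J e by auto
      have "(\<integral>\<^sup>+x. f e (\<omega> e x) \<partial>M) = (\<integral>\<^sup>+y. ennreal (exponential_density (lpp_rate (1 - \<rho>) e) y) * f e y \<partial>lborel)"
        by (rule distributed_nn_integral[symmetric, OF dist]) (use e J fm in auto)
      also have "\<dots> = (\<integral>\<^sup>+y. f e y \<partial>exp_measure (lpp_rate (1 - \<rho>) e))"
        by (rule exp_measure_nn_integral[symmetric, OF fm])
      finally show "(\<integral>\<^sup>+x. f e (\<omega> e x) \<partial>M) = (\<integral>\<^sup>+y. f e y \<partial>exp_measure (lpp_rate (1 - \<rho>) e))" .
    qed
    finally show ?thesis .
  qed
  moreover have "0 < lpp_rate (1 - \<rho>) e" for e using \<rho> by (cases e) (auto simp: lpp_rate_def)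
  moreover have "\<omega> e \<in> borel_measurable M" if "e \<in> ?S" for e
    using distributed_measurable[OF dist[OF that]] by simp
  ultimately show ?thesis using prob_space_axioms unfolding exp_family_def by auto
qed

lemma stationary_lpp_regular:
  assumes st: "stationary_lpp M \<omega> \<rho>" and \<rho>: "0 < \<rho>" "\<rho> < 1"
  shows "AE x in M. (\<forall>e. 0 \<le> \<omega> e x) \<and> \<omega> (0, 0) x = 0 \<and> generic (\<lambda>e. \<omega> e x)"
proof -
  interpret stationary_lpp M \<omega> \<rho> by fact
  note F = stationary_lpp_exp_family[OF st \<rho>]
  have "AE x in M. \<forall>e. 0 \<le> \<omega> e x"
  proof (subst AE_all_countable, rule allI)
    fix e
    show "AE x in M. 0 \<le> \<omega> e x"
    proof (cases "e = (0, 0)")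
      case True
      then show ?thesis using origin by (intro AE_I2) auto
    next
      case False
      then show ?thesis by (intro exp_family_AE_nonneg[OF F]) auto
    qed
  qed
  moreover have "AE x in M. \<omega> (0, 0) x = 0" using origin by (intro AE_I2) auto
  ultimately show ?thesis using exp_family_generic[OF F] by eventually_elim auto
qed

text \<open>
  By Burke's theorem the vertical increments on the line \<open>i = k\<close> have the law of the vertical boundary
  and are independent of the columns to the right, so the shifted environment is again stationary.
\<close>

lemma shift_stationary:
  assumes F: "exp_family M (UNIV - {(0, 0)}) \<omega> (lpp_rate z)"
  shows "stationary M {(i, j). j \<le> n \<and> (i, j) \<noteq> (0, 0)} (\<lambda>e x. shift k (\<lambda>p. \<omega> p x) e) (lpp_rate z) z (1 - z) m n"
proof -
  let ?S = "UNIV - {(0 :: nat, 0 :: nat)}" and ?T = "{(i :: nat, j). j \<le> n \<and> (i, j) \<noteq> (0, 0)}"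
  have "stationary M ?S \<omega> (lpp_rate z) z (1 - z) k n"
    using F by (auto simp: stationary_def lpp_rate_def)
  note B = burke_rectangle[OF this]
  let ?Y = "\<lambda>p x. edge (\<lambda>p. \<omega> p x) (\<lambda>i. if 1 \<le> i \<and> i \<le> k then n else 0) (\<lambda>j. if 1 \<le> j \<and> j \<le> n then k else 0) p"
  let ?\<sigma> = "\<lambda>(i, j). if i = 0 then (0, j) else (k + i, j)"
  have "exp_family M ?T (\<lambda>e. ?Y (?\<sigma> e)) (\<lambda>e. lpp_rate z (?\<sigma> e))"
    by (rule exp_family_reindex[OF B]) (auto simp: inj_on_def split: if_splits)
  then have "exp_family M ?T (\<lambda>e x. shift k (\<lambda>p. \<omega> p x) e) (lpp_rate z)"
  proof (rule exp_family_cong)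
    fix e assume e: "e \<in> ?T"
    obtain i j where ij: "e = (i, j)" by (cases e)
    show "(\<lambda>x. shift k (\<lambda>p. \<omega> p x) e) = ?Y (?\<sigma> e)"
    proof (cases i)
      case 0
      then show ?thesis using e ij by (auto simp: edge_def)
    next
      case (Suc i')
      then show ?thesis using e ij by (cases j) (auto simp: edge_def)
    qed
    show "lpp_rate z e = lpp_rate z (?\<sigma> e)" using ij by (auto simp: lpp_rate_def)
  qed
  then show ?thesis by (auto simp: stationary_def lpp_rate_def)
qed

lemma Z_tail:
  assumes st: "stationary_lpp M \<omega> \<rho>" and \<rho>: "0 < \<rho>" "\<rho> < 1" and h: "0 < h" "2 * h < 1 - \<rho>"
    and mn: "m = nat \<lfloor>(1 - \<rho>)\<^sup>2 * t\<rfloor>" "n = nat \<lfloor>\<rho>\<^sup>2 * t\<rfloor>"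
  shows "measure M {x \<in> space M. int k < Z_exit (\<lambda>p. \<omega> p x) \<rho> t}
     \<le> (if k < m then exp (h\<^sup>2 / 2 * (real (m - k) / ((1 - \<rho>) * (1 - \<rho> - 2 * h)) - real n / (\<rho> + h)\<^sup>2)) else 0)"
proof -
  interpret stationary_lpp M \<omega> \<rho> by fact
  note F = stationary_lpp_exp_family[OF st \<rho>]
  note st' = shift_stationary[OF F, of n k "m - k"]
  note reg = stationary_lpp_regular[OF st \<rho>]
  have imp: "AE x in M. int k < Z_exit (\<lambda>p. \<omega> p x) \<rho> t \<longrightarrow>
     k < m \<and> lpp (ver (shift k (\<lambda>p. \<omega> p x))) (m - k) n \<le> lpp (hor (shift k (\<lambda>p. \<omega> p x))) (m - k) n"
    using reg
  proof eventually_elim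
    case (elim x)
    let ?w = "\<lambda>p. \<omega> p x"
    have M: "up_right_path m n (maximal_path ?w m n)" "path_weight ?w (maximal_path ?w m n) = lpp ?w m n"
      using maximal_path_correct[of ?w m n] elim by (auto simp: is_maximal_path_def)
    show ?case
      using exit_beyond_imp[of ?w, OF _ _ M] elim by (auto simp: Z_exit_def mn)
  qed
  show ?thesis
  proof (cases "k < m")
    case True
    let ?B = "{x \<in> space M. lpp (ver (shift k (\<lambda>p. \<omega> p x))) (m - k) n \<le> lpp (hor (shift k (\<lambda>p. \<omega> p x))) (m - k) n}"
    have nn: "AE x in M. \<forall>e. 0 \<le> shift k (\<lambda>p. \<omega> p x) e"
      using reg
    proof eventually_elim
      case (elim x)
      then have "0 \<le> vinc (\<lambda>p. \<omega> p x) k j" for j by (intro vinc_nonneg) auto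
      then show ?case using elim by (auto simp: shift_def)
    qed
    have "?B \<in> sets M"
      using stationary_lpp_measurable(2,3)[OF st', of "m - k" n] by measurable
    moreover have "AE x in M. x \<in> {x \<in> space M. int k < Z_exit (\<lambda>p. \<omega> p x) \<rho> t} \<longrightarrow> x \<in> ?B"
      using imp by (rule AE_mp) (auto intro!: AE_I2)
    ultimately have "measure M {x \<in> space M. int k < Z_exit (\<lambda>p. \<omega> p x) \<rho> t} \<le> measure M ?B"
      by (rule finite_measure_mono_AE[rotated])
    also have "\<dots> \<le> exp (h\<^sup>2 / 2 * (real (m - k) / ((1 - \<rho>) * (1 - \<rho> - 2 * h)) - real n / (1 - (1 - \<rho>) + h)\<^sup>2))"
      by (rule exit_bound[OF st' _ _ h nn]) (use \<rho> in auto)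
    finally show ?thesis using True by simp
  next
    case False
    have "measure M {x \<in> space M. int k < Z_exit (\<lambda>p. \<omega> p x) \<rho> t} \<le> measure M {}"
      by (rule finite_measure_mono_AE) (use imp False in auto)
    then show ?thesis using False by simp
  qed
qed

text \<open>
  On the scale of the characteristic direction the endpoint of the model shifted by \<open>k\<close> is off by \<open>k\<close>, so
  the bracket in the exit bound is \<open>O(t h) - k / z\<^sup>2 + O(1)\<close>. The step \<open>h\<close> is chosen proportional to
  \<open>k / t\<close>, with a constant that makes the first term half of the second.
\<close>

lemma tail_exponent:
  fixes z t k m n :: real
  assumes z: "0 < z" "z < 1" and t: "0 < t" and k: "0 < k" "k \<le> z\<^sup>2 * t"
    and m: "m \<le> z\<^sup>2 * t - k" and n: "(1 - z)\<^sup>2 * t - 1 \<le> n"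
    and q: "q = 2 / (1 - z) + 4 / z" and h: "h = k / (2 * z\<^sup>2 * q * t)"
  shows "0 < h" "2 * h < z"
    "h\<^sup>2 / 2 * (m / (z * (z - 2 * h)) - n / (1 - z + h)\<^sup>2) \<le> 1 - k ^ 3 / (16 * z ^ 6 * q\<^sup>2 * t\<^sup>2)"
proof -
  have qpos: "0 < q" using z by (simp add: q add_pos_pos)
  show hpos: "0 < h" using k z t qpos by (simp add: h)
  have hq: "2 * h * q \<le> 1"
  proof -
    have "2 * h * q = k / (z\<^sup>2 * t)" using qpos z t by (simp add: h field_simps)
    then show ?thesis using k z t by (simp add: divide_le_eq)
  qed
  have qz: "4 / z \<le> q" "2 / (1 - z) \<le> q" using z by (auto simp: q)
  have hz: "8 * h \<le> z"
  proof -
    have "2 * h * (4 / z) \<le> 2 * h * q" using qz hpos by (intro mult_left_mono) auto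
    then have "2 * h * (4 / z) \<le> 1" using hq by linarith
    then show ?thesis using z by (simp add: field_simps)
  qed
  then show h2: "2 * h < z" using hpos by linarith
  have N: "t * (1 - 2 * h / (1 - z)) - 1 / (1 - z)\<^sup>2 \<le> n / (1 - z + h)\<^sup>2"
  proof -
    have y: "0 < 1 - z" "0 < 1 - z + h" using z hpos by auto
    have a: "1 - 2 * h / (1 - z) \<le> (1 - z)\<^sup>2 / (1 - z + h)\<^sup>2"
    proof -
      have "(1 - z)\<^sup>2 / (1 - z + h)\<^sup>2 = (1 - h / (1 - z + h))\<^sup>2"
        using y by (simp add: power2_eq_square field_simps)
      moreover have "1 - 2 * x \<le> (1 - x)\<^sup>2" for x :: real
        by (simp add: power2_eq_square algebra_simps)
      moreover have "h / (1 - z + h) \<le> h / (1 - z)" using y hpos by (intro divide_left_mono) auto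
      ultimately have "1 - 2 * (h / (1 - z)) \<le> (1 - z)\<^sup>2 / (1 - z + h)\<^sup>2"
        by (smt (verit))
      then show ?thesis by simp
    qed
    have b: "1 / (1 - z + h)\<^sup>2 \<le> 1 / (1 - z)\<^sup>2"
      using y hpos by (intro divide_left_mono power_mono) auto
    have "t * (1 - 2 * h / (1 - z)) \<le> t * ((1 - z)\<^sup>2 / (1 - z + h)\<^sup>2)" using a t by (intro mult_left_mono) auto
    then have "t * (1 - 2 * h / (1 - z)) - 1 / (1 - z)\<^sup>2 \<le> t * ((1 - z)\<^sup>2 / (1 - z + h)\<^sup>2) - 1 / (1 - z + h)\<^sup>2"
      using b by linarith
    also have "\<dots> = ((1 - z)\<^sup>2 * t - 1) / (1 - z + h)\<^sup>2" by (simp add: diff_divide_distrib)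
    also have "\<dots> \<le> n / (1 - z + h)\<^sup>2" using n by (intro divide_right_mono) auto
    finally show ?thesis .
  qed
  have Mb: "m / (z * (z - 2 * h)) \<le> t * (1 + 4 * h / z) - k / z\<^sup>2"
  proof -
    have d: "0 < z * (z - 2 * h)" using z h2 by simp
    have "m / (z * (z - 2 * h)) \<le> (z\<^sup>2 * t - k) / (z * (z - 2 * h))"
      using m d by (intro divide_right_mono) auto
    also have "\<dots> = t * (z / (z - 2 * h)) - k / (z * (z - 2 * h))"
      using z h2 by (simp add: diff_divide_distrib power2_eq_square)
    also have "\<dots> \<le> t * (1 + 4 * h / z) - k / z\<^sup>2"
    proof (rule diff_mono)
      have "z \<le> (1 + 4 * h / z) * (z - 2 * h)"
      proof -
        have "(1 + 4 * h / z) * (z - 2 * h) = z + 2 * h * (1 - 4 * h / z)" using z by (simp add: field_simps)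
        moreover have "4 * h / z \<le> 1" using hz z hpos by (simp add: divide_le_eq)
        ultimately show ?thesis using hpos by simp
      qed
      then have "z / (z - 2 * h) \<le> 1 + 4 * h / z" using h2 by (simp add: divide_le_eq)
      then show "t * (z / (z - 2 * h)) \<le> t * (1 + 4 * h / z)" using t by (intro mult_left_mono) auto
      show "k / z\<^sup>2 \<le> k / (z * (z - 2 * h))"
        unfolding power2_eq_square using z hpos h2 k by (intro divide_left_mono mult_left_mono) auto
    qed
    finally show ?thesis .
  qed
  have "m / (z * (z - 2 * h)) - n / (1 - z + h)\<^sup>2 \<le> t * h * q - k / z\<^sup>2 + 1 / (1 - z)\<^sup>2"
    using N Mb by (simp add: q algebra_simps)
  also have "t * h * q = k / (2 * z\<^sup>2)" using qpos z t by (simp add: h field_simps)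
  also have "k / (2 * z\<^sup>2) - k / z\<^sup>2 + 1 / (1 - z)\<^sup>2 = 1 / (1 - z)\<^sup>2 - k / (2 * z\<^sup>2)" using z by (simp add: field_simps)
  finally have "h\<^sup>2 / 2 * (m / (z * (z - 2 * h)) - n / (1 - z + h)\<^sup>2) \<le> h\<^sup>2 / 2 * (1 / (1 - z)\<^sup>2 - k / (2 * z\<^sup>2))"
    by (intro mult_left_mono) auto
  also have "\<dots> = (h / (1 - z))\<^sup>2 / 2 - h\<^sup>2 * k / (4 * z\<^sup>2)" by (simp add: right_diff_distrib power_divide)
  also have "(h / (1 - z))\<^sup>2 / 2 \<le> 1"
  proof -
    have "h * (2 / (1 - z)) \<le> h * q" using qz hpos by (intro mult_left_mono) auto
    then have "h / (1 - z) \<le> 1" using hq by simp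
    then have "(h / (1 - z))\<^sup>2 \<le> 1" using hpos z by (intro power_le_one) auto
    then show ?thesis by simp
  qed
  also have "h\<^sup>2 * k / (4 * z\<^sup>2) = k ^ 3 / (16 * z ^ 6 * q\<^sup>2 * t\<^sup>2)"
    using z t qpos by (simp add: h field_simps power2_eq_square power3_eq_cube eval_nat_numeral)
  finally show "h\<^sup>2 / 2 * (m / (z * (z - 2 * h)) - n / (1 - z + h)\<^sup>2) \<le> 1 - k ^ 3 / (16 * z ^ 6 * q\<^sup>2 * t\<^sup>2)" by simp
qed

text \<open>
  The bound is in fact \<open>exp (1 - c a\<^sup>3 / 8)\<close> as soon as \<open>a t\<^bsup>2/3\<^esup> \<ge> 2\<close>. If \<open>a t\<^bsup>2/3\<^esup> < 2\<close>, then \<open>a\<^sup>-\<^sup>3\<close> exceeds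
  \<open>t\<^sub>0\<^sup>2 / 8\<close> and the trivial bound \<open>1\<close> is enough; this is where the constant depends on \<open>t\<^sub>0\<close>.
\<close>

theorem exit_upper_tail:
  assumes \<rho>: "0 < \<rho>" "\<rho> < 1" and t0: "0 < t0"
  shows "\<exists>C::real. \<forall>(M :: 'a measure) \<omega>. stationary_lpp M \<omega> \<rho> \<longrightarrow>
            (\<forall>a>0. \<forall>t\<ge>t0.
               measure M {x \<in> space M. real_of_int (Z_exit (\<lambda>p. \<omega> p x) \<rho> t) \<ge> a * t powr (2/3)}
                 \<le> C * a powi (-3))"
proof -
  define z where "z = 1 - \<rho>"
  have z: "0 < z" "z < 1" using \<rho> by (auto simp: z_def)
  define q where "q = 2 / (1 - z) + 4 / z"
  have qpos: "0 < q" using z by (simp add: q_def add_pos_pos)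
  define c where "c = 1 / (16 * z ^ 6 * q\<^sup>2)"
  have c: "0 < c" using z qpos by (simp add: c_def)
  define C where "C = 8 / t0\<^sup>2 + 8 * exp 1 / c"
  have "measure M {x \<in> space M. real_of_int (Z_exit (\<lambda>p. \<omega> p x) \<rho> t) \<ge> a * t powr (2/3)} \<le> C * a powi (-3)"
    if st: "stationary_lpp M \<omega> \<rho>" and a: "0 < a" and t: "t0 \<le> t" for M :: "'a measure" and \<omega> a t
  proof -
    interpret stationary_lpp M \<omega> \<rho> by fact
    have tpos: "0 < t" using t t0 by linarith
    define A where "A = a * t powr (2/3)"
    have A: "0 < A" using a tpos by (simp add: A_def)
    have A3: "A ^ 3 = a ^ 3 * t\<^sup>2"
    proof -
      have "(t powr (2/3)) ^ 3 = t powr 2" using tpos by (simp add: powr_power)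
      then show ?thesis using tpos by (simp add: A_def power_mult_distrib)
    qed
    have inv: "a powi (-3) = 1 / a ^ 3" by (simp add: power_int_minus field_simps)
    let ?E = "{x \<in> space M. real_of_int (Z_exit (\<lambda>p. \<omega> p x) \<rho> t) \<ge> A}"
    have "measure M ?E \<le> C / a ^ 3"
    proof (cases "A < 2")
      case True
      have "a ^ 3 * t\<^sup>2 \<le> 2 ^ 3" unfolding A3[symmetric] using True A by (intro power_mono) auto
      moreover have "a ^ 3 * t0\<^sup>2 \<le> a ^ 3 * t\<^sup>2" using a t t0 by (intro mult_left_mono power_mono) auto
      ultimately have "a ^ 3 * t0\<^sup>2 \<le> 8" by (rule order_trans[rotated, THEN order_trans]) simp
      then have "1 \<le> 8 / t0\<^sup>2 / a ^ 3" using a t0 by (simp add: field_simps)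
      also have "\<dots> \<le> C / a ^ 3" using a c by (intro divide_right_mono) (auto simp: C_def)
      finally show ?thesis using prob_le_1[of ?E] by linarith
    next
      case False
      \<comment> \<open>Chosen so that \<open>A \<le> Z\<close> is the same as \<open>k < Z\<close> for an integer \<open>Z\<close>.\<close>
      define k where "k = nat \<lceil>A\<rceil> - 1"
      have k: "A / 2 \<le> real k" "int k < \<lceil>A\<rceil>" "0 < k" using False by (auto simp: k_def) linarith+
      have E_eq: "?E = {x \<in> space M. int k < Z_exit (\<lambda>p. \<omega> p x) \<rho> t}"
      proof -
        have "\<lceil>A\<rceil> = int k + 1" using False by (auto simp: k_def) linarith
        then show ?thesis by (auto simp: ceiling_le_iff[symmetric])
      qed
      define m n where "m = nat \<lfloor>(1 - \<rho>)\<^sup>2 * t\<rfloor>" and "n = nat \<lfloor>\<rho>\<^sup>2 * t\<rfloor>"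
      have m: "real m \<le> z\<^sup>2 * t" using tpos by (simp add: m_def z_def)
      have n: "(1 - z)\<^sup>2 * t - 1 \<le> real n" using tpos by (simp add: n_def z_def)
      show ?thesis
      proof (cases "k < m")
        case True
        define h where "h = real k / (2 * z\<^sup>2 * q * t)"
        note T = tail_exponent[OF z tpos _ _ _ n q_def h_def, of "real (m - k)"]
        have hh: "0 < h" "2 * h < z" "h\<^sup>2 / 2 * (real (m - k) / (z * (z - 2 * h)) - real n / (1 - z + h)\<^sup>2)
           \<le> 1 - real k ^ 3 / (16 * z ^ 6 * q\<^sup>2 * t\<^sup>2)"
          using T True m k by (auto simp: of_nat_diff)
        have "measure M ?E \<le> exp (h\<^sup>2 / 2 * (real (m - k) / (z * (z - 2 * h)) - real n / (1 - z + h)\<^sup>2))"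
          using Z_tail[OF st \<rho> _ _ m_def n_def, of h k] hh True unfolding E_eq by (simp add: z_def)
        also have "\<dots> \<le> exp (1 - c * (real k ^ 3 / t\<^sup>2))" using hh(3) by (simp add: c_def)
        also have "\<dots> \<le> exp (1 - c * a ^ 3 / 8)"
        proof -
          have "(A / 2) ^ 3 \<le> real k ^ 3" using k A by (intro power_mono) auto
          then have "a ^ 3 / 8 \<le> real k ^ 3 / t\<^sup>2" using A3 tpos by (simp add: power_divide field_simps)
          then have "c * (a ^ 3 / 8) \<le> c * (real k ^ 3 / t\<^sup>2)" using c by (intro mult_left_mono) auto
          then show ?thesis by simp
        qed
        also have "\<dots> = exp 1 * exp (- (c * a ^ 3 / 8))"
          using exp_add[of 1 "- (c * a ^ 3 / 8)"] by simp
        also have "\<dots> \<le> exp 1 * (8 / (c * a ^ 3))"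
        proof (rule mult_left_mono)
          define y where "y = c * a ^ 3 / 8"
          have y: "0 < y" using a c by (simp add: y_def)
          have "y \<le> exp y" using exp_ge_add_one_self[of y] by linarith
          then have "exp (- y) \<le> 1 / y" using y by (simp add: exp_minus field_simps)
          then show "exp (- (c * a ^ 3 / 8)) \<le> 8 / (c * a ^ 3)" by (simp add: y_def)
        qed simp
        also have "\<dots> \<le> C / a ^ 3"
          using a c t0 by (simp add: C_def add_divide_distrib mult_ac)
        finally show ?thesis .
      next
        case False
        have "measure M ?E \<le> 0"
          using Z_tail[OF st \<rho> _ _ m_def n_def, of "z / 4" k] False z unfolding E_eq by (simp add: z_def)
        also have "0 \<le> C / a ^ 3" using a c t0 by (simp add: C_def)
        finally show ?thesis .
      qed
    qed
    then show ?thesis by (simp add: inv A_def)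
  qed
  then show ?thesis by blast
qed

section \<open>Random walks with exponential steps\<close>

definition stays_below :: "nat \<Rightarrow> real \<Rightarrow> (nat \<Rightarrow> real) \<Rightarrow> bool" where
  "stays_below K g s \<longleftrightarrow> (\<forall>y\<in>{1..K}. (\<Sum>i<y. s i) \<le> g)"

lemma stays_below_0 [simp]: "stays_below 0 g s"
  by (simp add: stays_below_def)

lemma stays_below_Suc:
  "stays_below (Suc K) g s \<longleftrightarrow> s 0 \<le> g \<and> stays_below K (g - s 0) (\<lambda>i. s (Suc i))"
proof -
  have "stays_below (Suc K) g s \<longleftrightarrow> (\<forall>y<Suc K. (\<Sum>i<Suc y. s i) \<le> g)"
  proof -
    have "{1..Suc K} = Suc ` {..<Suc K}" by (simp add: image_Suc_lessThan)
    moreover have "(\<forall>y\<in>Suc ` {..<n}. P y) = (\<forall>y<n. P (Suc y))" for P n by auto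
    ultimately show ?thesis unfolding stays_below_def by (simp only:)
  qed
  also have "\<dots> \<longleftrightarrow> s 0 \<le> g \<and> (\<forall>y\<in>{1..K}. s 0 + (\<Sum>i<y. s (Suc i)) \<le> g)"
  proof safe
    fix y assume *: "\<forall>y<Suc K. (\<Sum>i<Suc y. s i) \<le> g"
    from *[rule_format, of 0] show "s 0 \<le> g" by simp
    assume "y \<in> {1..K}"
    with *[rule_format, of y] show "s 0 + (\<Sum>i<y. s (Suc i)) \<le> g"
      by (simp only: sum.lessThan_Suc_shift) simp
  next
    fix y assume *: "s 0 \<le> g" "\<forall>y\<in>{1..K}. s 0 + (\<Sum>i<y. s (Suc i)) \<le> g" "y < Suc K"
    show "(\<Sum>i<Suc y. s i) \<le> g"
      unfolding sum.lessThan_Suc_shift using * by (cases "y = 0") auto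
  qed
  finally show ?thesis by (auto simp: stays_below_def algebra_simps)
qed

lemma stays_below_cong: "(\<And>i. i < K \<Longrightarrow> s i = s' i) \<Longrightarrow> stays_below K g s = stays_below K g s'"
  unfolding stays_below_def by (intro ball_cong refl arg_cong2[where f="(\<le>)"] sum.cong) auto

lemma stays_below_measurable:
  assumes "\<And>i. i < K \<Longrightarrow> (\<lambda>x. s x i) \<in> borel_measurable N" "g \<in> borel_measurable N"
  shows "Measurable.pred N (\<lambda>x. stays_below K (g x) (s x))"
  unfolding stays_below_def
proof (rule pred_intros_finite)
  fix y assume y: "y \<in> {1..K}"
  have [measurable]: "(\<lambda>x. \<Sum>i<y. s x i) \<in> borel_measurable N"
    by (rule borel_measurable_sum) (rule assms, use y in auto)
  note assms(2)[measurable]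
  show "Measurable.pred N (\<lambda>x. (\<Sum>i<y. s x i) \<le> g x)" by measurable
qed simp

definition walk_rate :: "real \<Rightarrow> real \<Rightarrow> nat \<times> bool \<Rightarrow> real" where
  "walk_rate a b = (\<lambda>(i, up). if up then a else b)"

abbreviation walk_step :: "(nat \<times> bool \<Rightarrow> 'a \<Rightarrow> real) \<Rightarrow> 'a \<Rightarrow> nat \<Rightarrow> real" where
  "walk_step X x i \<equiv> X (i, True) x - X (i, False) x"

lemma walk_family_tail:
  assumes "exp_family M ({..<Suc K} \<times> UNIV) X (walk_rate a b)"
  shows "exp_family M ({..<K} \<times> UNIV) (\<lambda>(i, up). X (Suc i, up)) (walk_rate a b)"
proof -
  have "exp_family M ({..<K} \<times> UNIV) (\<lambda>e. X (case e of (i, up) \<Rightarrow> (Suc i, up))) (\<lambda>e. walk_rate a b (case e of (i, up) \<Rightarrow> (Suc i, up)))"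
    by (rule exp_family_reindex[OF assms]) (auto simp: inj_on_def)
  then show ?thesis by (rule exp_family_cong) (auto simp: walk_rate_def)
qed

text \<open>
  First-step decomposition of a walk whose steps are differences of independent \<open>Exp(a)\<close> and
  \<open>Exp(b)\<close> variables. The function \<open>\<phi>\<close> lets it serve for the event and for its complement.
\<close>

lemma walk_peel:
  fixes \<phi> :: "bool \<Rightarrow> ennreal"
  assumes F: "exp_family M ({..<Suc K} \<times> UNIV) X (walk_rate a b)"
  shows "(\<integral>\<^sup>+x. \<phi> (stays_below (Suc K) g (walk_step X x)) \<partial>M) =
    (\<integral>\<^sup>+v. \<integral>\<^sup>+u. \<integral>\<^sup>+x. \<phi> (u - v \<le> g \<and> stays_below K (g - (u - v)) (walk_step (\<lambda>(i, up). X (Suc i, up)) x)) \<partial>M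
       \<partial>exp_measure a \<partial>exp_measure b)"
proof -
  let ?S = "{..<Suc K} \<times> (UNIV :: bool set)"
  let ?J0 = "{1..<Suc K} \<times> (UNIV :: bool set)"
  let ?J1 = "insert (0, True) ?J0"
  let ?R = "\<lambda>J x. \<lambda>e\<in>J. X e x"
  let ?W = "\<lambda>u v G. \<phi> (u - v \<le> g \<and> stays_below K (g - (u - v)) (\<lambda>i. G (Suc i, True) - G (Suc i, False)))"
  have fin: "finite ?J0" "finite ?J1" and sub: "?J0 \<subseteq> ?S" "?J1 \<subseteq> ?S" by auto
  have \<phi>m[measurable]: "\<phi> \<in> measurable (count_space UNIV) borel" by simp
  have meas: "(\<lambda>q. ?W (u q) (v q) (G q)) \<in> borel_measurable N"
    if [measurable]: "u \<in> borel_measurable N" "v \<in> borel_measurable N"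
      and "\<And>e. e \<in> ?J0 \<Longrightarrow> (\<lambda>q. G q e) \<in> borel_measurable N" for u v G and N :: "'c measure"
  proof -
    have [measurable]: "Measurable.pred N (\<lambda>q. stays_below K (g - (u q - v q)) (\<lambda>i. G q (Suc i, True) - G q (Suc i, False)))"
      by (rule stays_below_measurable) (auto intro!: borel_measurable_diff that)
    show ?thesis by measurable
  qed
  have cg: "stays_below K h (\<lambda>i. ?R J x (Suc i, True) - ?R J x (Suc i, False)) = stays_below K h (\<lambda>i. X (Suc i, True) x - X (Suc i, False) x)"
    if "?J0 \<subseteq> J" for J h x
  proof (rule stays_below_cong)
    fix i assume "i < K"
    then have "(Suc i, up) \<in> J" for up by (intro subsetD[OF that]) auto
    then show "?R J x (Suc i, True) - ?R J x (Suc i, False) = X (Suc i, True) x - X (Suc i, False) x" by simp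
  qed
  have cg0: "stays_below K h (\<lambda>i. ?R ?J0 x (Suc i, True) - ?R ?J0 x (Suc i, False)) = stays_below K h (\<lambda>i. X (Suc i, True) x - X (Suc i, False) x)"
    and cg1: "stays_below K h (\<lambda>i. ?R ?J1 x (Suc i, True) - ?R ?J1 x (Suc i, False)) = stays_below K h (\<lambda>i. X (Suc i, True) x - X (Suc i, False) x)"
    and r1: "?R ?J1 x (0, True) = X (0, True) x" for h x
    by (rule cg, simp, rule cg, blast, simp)
  have rates: "walk_rate a b (0, False) = b" "walk_rate a b (0, True) = a" by (simp_all add: walk_rate_def)
  have comp: "(\<lambda>q. snd q e) \<in> borel_measurable (borel \<Otimes>\<^sub>M Pi\<^sub>M J (\<lambda>_. borel :: real measure))" if "e \<in> J" for e :: "nat \<times> bool" and J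
    using that by (intro measurable_compose[OF measurable_snd] measurable_component_singleton)
  have "(\<integral>\<^sup>+x. \<phi> (stays_below (Suc K) g (walk_step X x)) \<partial>M) = (\<integral>\<^sup>+x. (\<lambda>v G. ?W (G (0, True)) v G) (X (0, False) x) (?R ?J1 x) \<partial>M)"
    unfolding stays_below_Suc by (simp only: cg1 r1)
  also have "\<dots> = (\<integral>\<^sup>+v. \<integral>\<^sup>+x. (\<lambda>v G. ?W (G (0, True)) v G) v (?R ?J1 x) \<partial>M \<partial>exp_measure (walk_rate a b (0, False)))"
  proof (rule exp_family_peel[OF F fin(2) sub(2)])
    show "(\<lambda>(v, G). ?W (G (0, True)) v G) \<in> borel_measurable (borel \<Otimes>\<^sub>M Pi\<^sub>M ?J1 (\<lambda>_. borel))"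
      unfolding case_prod_beta by (rule meas) (auto intro!: comp)
  qed auto
  also have "\<dots> = (\<integral>\<^sup>+v. \<integral>\<^sup>+x. (\<lambda>u G. ?W u v G) (X (0, True) x) (?R ?J0 x) \<partial>M \<partial>exp_measure b)"
    by (simp only: cg0 cg1 r1 rates)
  also have "\<dots> = (\<integral>\<^sup>+v. \<integral>\<^sup>+u. \<integral>\<^sup>+x. (\<lambda>u G. ?W u v G) u (?R ?J0 x) \<partial>M \<partial>exp_measure (walk_rate a b (0, True)) \<partial>exp_measure b)"
  proof (rule nn_integral_cong, rule exp_family_peel[OF F fin(1) sub(1)])
    fix v
    show "(\<lambda>(u, G). ?W u v G) \<in> borel_measurable (borel \<Otimes>\<^sub>M Pi\<^sub>M ?J0 (\<lambda>_. borel))"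
      unfolding case_prod_beta by (rule meas) (auto intro!: comp)
  qed auto
  also have "\<dots> = (\<integral>\<^sup>+v. \<integral>\<^sup>+u. \<integral>\<^sup>+x. \<phi> (u - v \<le> g \<and> stays_below K (g - (u - v)) (walk_step (\<lambda>(i, up). X (Suc i, up)) x)) \<partial>M
       \<partial>exp_measure a \<partial>exp_measure b)"
    by (simp only: cg0 rates prod.case)
  finally show ?thesis .
qed

text \<open>
  A Chernoff bound for the running maximum: \<open>R\<close> is the exponential moment of a step, and when
  \<open>R \<ge> 1\<close> the bound survives the first-step decomposition, whether or not the walk exceeds the level
  at once.
\<close>

lemma walk_max_chernoff:
  assumes \<theta>: "0 \<le> \<theta>" "\<theta> < a" "0 < b" and R: "R = a / (a - \<theta>) * (b / (b + \<theta>))" "1 \<le> R"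
    and F: "exp_family M ({..<K} \<times> UNIV) X (walk_rate a b)"
  shows "(\<integral>\<^sup>+x. (if stays_below K g (walk_step X x) then 0 else 1) \<partial>M) \<le> ennreal (exp (- \<theta> * g) * R ^ K)"
  using F
proof (induction K arbitrary: X g)
  case (Suc K)
  let ?X = "\<lambda>(i, up). X (Suc i, up)"
  interpret prob_space M by (rule exp_familyD(1)[OF Suc.prems])
  have tail: "(\<integral>\<^sup>+x. (if u - v \<le> g \<and> stays_below K (g - (u - v)) (walk_step ?X x) then 0 else 1) \<partial>M)
     \<le> ennreal (exp (- \<theta> * (g - (u - v))) * R ^ K)" for u v
  proof (cases "u - v \<le> g")
    case True
    then have "(\<integral>\<^sup>+x. (if u - v \<le> g \<and> stays_below K (g - (u - v)) (walk_step ?X x) then 0 else 1) \<partial>M)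
        = (\<integral>\<^sup>+x. (if stays_below K (g - (u - v)) (walk_step ?X x) then 0 else 1) \<partial>M)"
      by (intro nn_integral_cong) simp
    then show ?thesis
      using Suc.IH[OF walk_family_tail[OF Suc.prems], of "g - (u - v)"] by (simp only:)
  next
    case False
    have "1 \<le> exp (- \<theta> * (g - (u - v))) * R ^ K"
      using \<theta> False R mult_nonneg_nonpos[of \<theta> "g - (u - v)"] mult_mono[of 1 "exp (- \<theta> * (g - (u - v)))" 1 "R ^ K"]
      by (simp add: one_le_power)
    then show ?thesis using False emeasure_space_1 by simp
  qed
  have "(\<integral>\<^sup>+x. (if stays_below (Suc K) g (walk_step X x) then 0 else 1) \<partial>M)
     = (\<integral>\<^sup>+v. \<integral>\<^sup>+u. \<integral>\<^sup>+x. (if u - v \<le> g \<and> stays_below K (g - (u - v)) (walk_step ?X x) then 0 else 1) \<partial>M \<partial>exp_measure a \<partial>exp_measure b)"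
    by (rule walk_peel[OF Suc.prems, where \<phi> = "\<lambda>b. if b then 0 else 1"])
  also have "\<dots> \<le> (\<integral>\<^sup>+v. \<integral>\<^sup>+u. ennreal (exp (- \<theta> * (g - (u - v))) * R ^ K) \<partial>exp_measure a \<partial>exp_measure b)"
    by (intro nn_integral_mono tail)
  also have "\<dots> = (\<integral>\<^sup>+v. \<integral>\<^sup>+u. ennreal (exp (- \<theta> * g) * R ^ K) * ennreal (exp (- \<theta> * v)) * ennreal (exp (\<theta> * u)) \<partial>exp_measure a \<partial>exp_measure b)"
  proof (intro nn_integral_cong)
    fix u v
    have "exp (- \<theta> * (g - (u - v))) = exp (- \<theta> * g) * exp (- \<theta> * v) * exp (\<theta> * u)"
      by (simp add: exp_add[symmetric] algebra_simps)
    then have "exp (- \<theta> * (g - (u - v))) * R ^ K = exp (- \<theta> * g) * R ^ K * exp (- \<theta> * v) * exp (\<theta> * u)"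
      by simp
    then show "ennreal (exp (- \<theta> * (g - (u - v))) * R ^ K) =
        ennreal (exp (- \<theta> * g) * R ^ K) * ennreal (exp (- \<theta> * v)) * ennreal (exp (\<theta> * u))"
      using R(2) by (simp add: ennreal_mult' mult_ac)
  qed
  also have "\<dots> = ennreal (exp (- \<theta> * g) * R ^ K) * ennreal (b / (b + \<theta>)) * ennreal (a / (a - \<theta>))"
    using exp_measure_mgf[of b "- \<theta>"] exp_measure_mgf[of a \<theta>] \<theta>
    by (simp add: nn_integral_cmult nn_integral_multc)
  also have "\<dots> = ennreal (exp (- \<theta> * g) * R ^ Suc K)"
    using \<theta> R by (simp add: ennreal_mult'[symmetric] mult_ac)
  finally show ?case .
qed simp

lemma nn_integral_exp_measure_Icc:
  assumes "0 \<le> G" "0 < a"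
    and F: "\<And>u. 0 \<le> u \<Longrightarrow> u \<le> G \<Longrightarrow> (F has_real_derivative a * exp (- a * u) * f u) (at u)"
    and f: "f \<in> borel_measurable borel" "\<And>u. 0 \<le> u \<Longrightarrow> u \<le> G \<Longrightarrow> 0 \<le> f u"
  shows "(\<integral>\<^sup>+u. (if u \<le> G then ennreal (f u) else 0) \<partial>exp_measure a) = ennreal (F G - F 0)"
proof -
  note f(1)[measurable]
  have "(\<integral>\<^sup>+u. (if u \<le> G then ennreal (f u) else 0) \<partial>exp_measure a)
     = (\<integral>\<^sup>+u. ennreal (exponential_density a u) * (if u \<le> G then ennreal (f u) else 0) \<partial>lborel)"
    by (rule exp_measure_nn_integral) measurable
  also have "\<dots> = (\<integral>\<^sup>+u. ennreal (a * exp (- a * u) * f u) * indicator {0..G} u \<partial>lborel)"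
    using assms(2) f(2) by (intro nn_integral_cong) (auto simp: exponential_density_def indicator_def ennreal_mult'[symmetric] mult_ac)
  also have "\<dots> = ennreal (F G - F 0)"
    using assms by (intro nn_integral_FTC_Icc) auto
  finally show ?thesis .
qed

text \<open>
  The walk is unlikely to stay below a level that is small compared with \<open>1 / \<theta>\<close> for a long time.
  The exponential of \<open>\<theta>\<close> times the walk, divided by \<open>R\<^sup>y\<close> at time \<open>y\<close>, is a martingale. By the
  memoryless property the overshoot above \<open>g\<close> is an \<open>Exp(a)\<close> variable whatever happened before, with
  exponential moment \<open>1 / c\<close>; optional stopping then bounds the probability of a passage from below.
  The induction carries this argument out by first steps: the integral over the upward part of the
  step can be evaluated exactly because of the memoryless property.
\<close>

lemma walk_stays_below:
  assumes \<theta>: "0 < \<theta>" "\<theta> < a" "0 < b" and c: "c = (a - \<theta>) / a" and R: "R = b / (c * (b + \<theta>))" "1 \<le> R"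
    and F: "exp_family M ({..<K} \<times> UNIV) X (walk_rate a b)" and g: "0 \<le> g"
  shows "(\<integral>\<^sup>+x. (if stays_below K g (walk_step X x) then 1 else 0) \<partial>M) \<le> ennreal (1 - c * (exp (- \<theta> * g) - inverse R ^ K))"
  using F g
proof (induction K arbitrary: X g)
  case 0
  interpret prob_space M by (rule exp_familyD(1)[OF 0(1)])
  have c0: "0 < c" using \<theta> by (simp add: c)
  have "exp (- \<theta> * g) \<le> 1" using \<theta> 0 by simp
  then have "1 \<le> 1 - c * (exp (- \<theta> * g) - 1)" using c0 by (simp add: mult_nonneg_nonpos)
  then show ?case using emeasure_space_1 by simp
next
  case (Suc K)
  let ?X = "\<lambda>(i, up). X (Suc i, up)"
  interpret prob_space M by (rule exp_familyD(1)[OF Suc.prems(1)])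
  have c0: "0 < c" "c < 1" using \<theta> by (auto simp: c field_simps)
  have R0: "0 < R" using R by simp
  define \<epsilon> where "\<epsilon> = inverse R ^ K"
  have \<epsilon>: "0 < \<epsilon>" using R0 by (simp add: \<epsilon>_def)
  \<comment> \<open>If \<open>exp (- \<theta> g)\<close> is smaller than \<open>R\<close> to the power \<open>- (K + 1)\<close>, the claimed bound is at least \<open>1\<close>.\<close>
  show ?case
  proof (cases "exp (- \<theta> * g) \<le> inverse R ^ Suc K")
    case True
    have "(\<integral>\<^sup>+x. (if stays_below (Suc K) g (walk_step X x) then 1 else 0) \<partial>M) \<le> (\<integral>\<^sup>+x. 1 \<partial>M)"
      by (intro nn_integral_mono) auto
    also have "\<dots> = ennreal 1" using emeasure_space_1 by simp
    also have "ennreal 1 \<le> ennreal (1 - c * (exp (- \<theta> * g) - inverse R ^ Suc K))"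
      using True c0 by (intro ennreal_leI) (simp add: mult_nonneg_nonpos)
    finally show ?thesis .
  next
    case False
    have inner: "(\<integral>\<^sup>+u. (if u \<le> G then ennreal (1 + c * \<epsilon> - c * exp (- \<theta> * (G - u))) else 0) \<partial>exp_measure a)
        \<le> ennreal (1 + c * \<epsilon> - exp (- \<theta> * G))" if G: "0 \<le> G" for G
    proof -
      let ?F = "\<lambda>u. exp (- \<theta> * G) * exp (- (a - \<theta>) * u) - (1 + c * \<epsilon>) * exp (- a * u)"
      have le1: "c * exp (- \<theta> * (G - u)) \<le> 1" if "u \<le> G" for u
        using mult_mono[of c 1 "exp (- \<theta> * (G - u))" 1] that \<theta> c0 by simp
      have "(\<integral>\<^sup>+u. (if u \<le> G then ennreal (1 + c * \<epsilon> - c * exp (- \<theta> * (G - u))) else 0) \<partial>exp_measure a) = ennreal (?F G - ?F 0)"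
      proof (rule nn_integral_exp_measure_Icc[OF G])
        fix u
        have "a * c = a - \<theta>" using \<theta> by (simp add: c)
        then have *: "a * (c * y) = (a - \<theta>) * y" for y by (simp add: mult.assoc[symmetric])
        have "exp (- a * u) * exp (- \<theta> * (G - u)) = exp (- \<theta> * G) * exp (- (a - \<theta>) * u)"
          by (simp add: exp_add[symmetric] algebra_simps)
        then have **: "a * exp (- a * u) * (1 + c * \<epsilon> - c * exp (- \<theta> * (G - u)))
           = (1 + c * \<epsilon>) * (a * exp (- a * u)) - (a - \<theta>) * (exp (- \<theta> * G) * exp (- (a - \<theta>) * u))"
          unfolding *[symmetric] by (simp add: algebra_simps)
        show "(?F has_real_derivative a * exp (- a * u) * (1 + c * \<epsilon> - c * exp (- \<theta> * (G - u)))) (at u)"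
          unfolding ** by (auto intro!: derivative_eq_intros simp: algebra_simps)
        show "0 \<le> 1 + c * \<epsilon> - c * exp (- \<theta> * (G - u))" if "u \<le> G"
          using le1[OF that] mult_pos_pos[OF c0(1) \<epsilon>] by linarith
      qed (use \<theta> in auto)
      also have "?F G - ?F 0 \<le> 1 + c * \<epsilon> - exp (- \<theta> * G)"
      proof -
        have "exp (- \<theta> * G) * exp (- (a - \<theta>) * G) = exp (- a * G)"
          by (simp add: exp_add[symmetric] algebra_simps)
        then have "?F G = - (c * \<epsilon>) * exp (- a * G)" by (simp add: algebra_simps)
        moreover have "?F 0 = exp (- \<theta> * G) - (1 + c * \<epsilon>)" by simp
        moreover have "0 \<le> (c * \<epsilon>) * exp (- a * G)" using c0 \<epsilon> by simp
        ultimately show ?thesis by simp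
      qed
      finally show ?thesis by (simp add: ennreal_leI)
    qed
    have tail: "(\<integral>\<^sup>+x. (if u - v \<le> g \<and> stays_below K (g - (u - v)) (walk_step ?X x) then 1 else 0) \<partial>M)
      \<le> (if u \<le> g + v then ennreal (1 + c * \<epsilon> - c * exp (- \<theta> * (g + v - u))) else 0)" for u v
    proof (cases "u \<le> g + v")
      case True
      have "(\<integral>\<^sup>+x. (if stays_below K (g - (u - v)) (walk_step ?X x) then 1 else 0) \<partial>M) \<le> ennreal (1 - c * (exp (- \<theta> * (g - (u - v))) - inverse R ^ K))"
        by (rule Suc.IH[OF walk_family_tail[OF Suc.prems(1)]]) (use True in simp)
      also have "1 - c * (exp (- \<theta> * (g - (u - v))) - inverse R ^ K) = 1 + c * \<epsilon> - c * exp (- \<theta> * (g + v - u))"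
        by (simp add: \<epsilon>_def algebra_simps)
      finally show ?thesis using True by (simp add: le_diff_eq algebra_simps)
    qed simp
    have "(\<integral>\<^sup>+x. (if stays_below (Suc K) g (walk_step X x) then 1 else 0) \<partial>M)
     = (\<integral>\<^sup>+v. \<integral>\<^sup>+u. \<integral>\<^sup>+x. (if u - v \<le> g \<and> stays_below K (g - (u - v)) (walk_step ?X x) then 1 else 0) \<partial>M \<partial>exp_measure a \<partial>exp_measure b)"
      by (rule walk_peel[OF Suc.prems(1), where \<phi> = "\<lambda>b. if b then 1 else 0"])
    also have "\<dots> \<le> (\<integral>\<^sup>+v. \<integral>\<^sup>+u. (if u \<le> g + v then ennreal (1 + c * \<epsilon> - c * exp (- \<theta> * (g + v - u))) else 0) \<partial>exp_measure a \<partial>exp_measure b)"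
      by (intro nn_integral_mono tail)
    also have "\<dots> \<le> (\<integral>\<^sup>+v. ennreal (1 + c * \<epsilon> - exp (- \<theta> * (g + v))) \<partial>exp_measure b)"
      by (rule nn_integral_mono_AE, rule AE_mp[OF AE_exp_measure_nonneg]) (use Suc.prems(2) inner in \<open>auto intro!: AE_I2\<close>)
    also have "\<dots> \<le> ennreal (1 + c * \<epsilon> - exp (- \<theta> * g) * (b / (b + \<theta>)))"
    proof -
      interpret E: prob_space "exp_measure b" by (rule prob_space_exp_measure[OF \<theta>(3)])
      let ?I = "\<integral>\<^sup>+v. ennreal (1 + c * \<epsilon> - exp (- \<theta> * (g + v))) \<partial>exp_measure b"
      have "?I + ennreal (exp (- \<theta> * g) * (b / (b + \<theta>))) = ?I + (\<integral>\<^sup>+v. ennreal (exp (- \<theta> * g)) * ennreal (exp (- \<theta> * v)) \<partial>exp_measure b)"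
      proof -
        have "ennreal (exp (- \<theta> * g) * (b / (b + \<theta>))) = ennreal (exp (- \<theta> * g)) * (\<integral>\<^sup>+v. ennreal (exp (- \<theta> * v)) \<partial>exp_measure b)"
          using exp_measure_mgf[of b "- \<theta>"] \<theta> by (simp only: ennreal_mult'[OF exp_ge_zero]) simp
        then show ?thesis by (simp add: nn_integral_cmult)
      qed
      also have "\<dots> = (\<integral>\<^sup>+v. ennreal (1 + c * \<epsilon> - exp (- \<theta> * (g + v))) + ennreal (exp (- \<theta> * g)) * ennreal (exp (- \<theta> * v)) \<partial>exp_measure b)"
        by (rule nn_integral_add[symmetric]) measurable
      also have "\<dots> = (\<integral>\<^sup>+v. ennreal (1 + c * \<epsilon>) \<partial>exp_measure b)"
      proof (rule nn_integral_cong_AE, rule AE_mp[OF AE_exp_measure_nonneg], rule AE_I2, rule impI)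
        fix v :: real assume v: "0 \<le> v"
        have e: "exp (- \<theta> * (g + v)) = exp (- \<theta> * g) * exp (- \<theta> * v)" by (simp add: exp_add[symmetric] algebra_simps)
        have "exp (- \<theta> * (g + v)) \<le> 1" using \<theta> v Suc.prems(2) by simp
        then have "exp (- \<theta> * (g + v)) \<le> 1 + c * \<epsilon>" using mult_pos_pos[OF c0(1) \<epsilon>] by linarith
        then show "ennreal (1 + c * \<epsilon> - exp (- \<theta> * (g + v))) + ennreal (exp (- \<theta> * g)) * ennreal (exp (- \<theta> * v)) = ennreal (1 + c * \<epsilon>)"
          unfolding ennreal_mult'[OF exp_ge_zero, symmetric] e[symmetric]
          by (subst ennreal_plus[symmetric]) auto
      qed
      also have "\<dots> = ennreal (1 + c * \<epsilon>)" using E.emeasure_space_1 by simp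
      finally have eq: "?I + ennreal (exp (- \<theta> * g) * (b / (b + \<theta>))) = ennreal (1 + c * \<epsilon>)" .
      have pos: "0 \<le> exp (- \<theta> * g) * (b / (b + \<theta>))" "0 \<le> 1 + c * \<epsilon>" using \<theta> c0 \<epsilon> by auto
      show ?thesis
      proof (cases ?I rule: ennreal_cases)
        case (real r)
        then have "ennreal (r + exp (- \<theta> * g) * (b / (b + \<theta>))) = ennreal (1 + c * \<epsilon>)"
          using eq pos by (simp add: ennreal_plus)
        then have "r + exp (- \<theta> * g) * (b / (b + \<theta>)) = 1 + c * \<epsilon>"
          using real pos by (subst (asm) ennreal_inj) auto
        then have "r = 1 + c * \<epsilon> - exp (- \<theta> * g) * (b / (b + \<theta>))" by linarith
        then show ?thesis using real by simp
      next
        case top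
        then show ?thesis using eq by simp
      qed
    qed
    also have "\<dots> \<le> ennreal (1 - c * (exp (- \<theta> * g) - inverse R ^ Suc K))"
    proof (rule ennreal_leI)
      have cR: "b / (b + \<theta>) = c * R" using c0 \<theta> by (simp add: R)
      have "\<epsilon> = R * inverse R ^ Suc K" using R0 by (simp add: \<epsilon>_def)
      moreover have "(R - 1) * inverse R ^ Suc K \<le> (R - 1) * exp (- \<theta> * g)"
        using False R by (intro mult_left_mono) auto
      ultimately have "\<epsilon> - inverse R ^ Suc K \<le> R * exp (- \<theta> * g) - exp (- \<theta> * g)"
        by (simp add: algebra_simps)
      then have "c * (\<epsilon> - inverse R ^ Suc K) \<le> c * (R * exp (- \<theta> * g) - exp (- \<theta> * g))"
        using c0 by (intro mult_left_mono) auto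
      then show "1 + c * \<epsilon> - exp (- \<theta> * g) * (b / (b + \<theta>)) \<le> 1 - c * (exp (- \<theta> * g) - inverse R ^ Suc K)"
        unfolding cR by (simp add: algebra_simps)
    qed
    finally show ?thesis .
  qed
qed

section \<open>Route weights and the reversed model\<close>

text \<open>
  The bulk of the box \<open>{1..m} \<times> {1..n}\<close> turned by half a turn, with closed boundaries: passage times of
  these weights are passage times of the original bulk to the corner \<open>(m, n)\<close>.
\<close>

definition rev_bulk :: "nat \<Rightarrow> nat \<Rightarrow> (nat \<times> nat \<Rightarrow> real) \<Rightarrow> nat \<times> nat \<Rightarrow> real" where
  "rev_bulk m n w = (\<lambda>(i, j). if i = 0 \<or> j = 0 then 0 else w (Suc m - i, Suc n - j))"

lemma rev_bulk_simps [simp]: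
  "rev_bulk m n w (0, j) = 0" "rev_bulk m n w (i, 0) = 0" "rev_bulk m n w (Suc i, Suc j) = w (m - i, n - j)"
  by (simp_all add: rev_bulk_def)

lemma lpp_rev_bulk_column [simp]: "lpp (rev_bulk m n w) 0 j = 0" by (induction j) simp_all
lemma lpp_rev_bulk_row [simp]: "lpp (rev_bulk m n w) i 0 = 0" by (induction i) simp_all

text \<open>
  The largest weight of a path that leaves the horizontal axis at the point \<open>(x, 0)\<close>.
\<close>

definition route :: "nat \<Rightarrow> nat \<Rightarrow> (nat \<times> nat \<Rightarrow> real) \<Rightarrow> nat \<Rightarrow> real" where
  "route m n w x = lpp w x 0 + lpp (rev_bulk m n w) (Suc m - x) n"

lemma lpp_mono_up:
  assumes "\<And>p. 0 \<le> w p" "j \<le> j'"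
  shows "lpp w i j \<le> lpp w i j'"
  using assms(2)
proof (induction rule: dec_induct)
  case (step k)
  then show ?case using lpp_step_up[of w i k] assms(1)[of "(i, Suc k)"] by linarith
qed simp

lemma lpp_mono_right:
  assumes "\<And>p. 0 \<le> w p" "i \<le> i'"
  shows "lpp w i j \<le> lpp w i' j"
  using assms(2)
proof (induction rule: dec_induct)
  case (step k)
  then show ?case using lpp_step_right[of w k j] assms(1)[of "(Suc k, j)"] by linarith
qed simp

text \<open>
  The best path through a given bulk point is a best path up to the point followed by a best path
  from it. The coordinates \<open>i\<close> and \<open>j\<close> count from the upper right corner.
\<close>

lemma lpp_through_point:
  assumes nn: "\<And>p. 0 \<le> w p"
  shows "i < m \<Longrightarrow> j < n \<Longrightarrow>
    lpp w (m - i) (n - j) - w (m - i, n - j) + lpp (rev_bulk m n w) (Suc i) (Suc j) \<le> lpp w m n"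
proof (induction "i + j" arbitrary: i j rule: less_induct)
  case less
  let ?r = "rev_bulk m n w"
  have right: "lpp w (m - i) (n - j) + lpp ?r i (Suc j) \<le> lpp w m n"
  proof (cases i)
    case 0
    then show ?thesis using lpp_mono_up[of w "n - j" n m] nn by simp
  next
    case (Suc i')
    have "lpp w (m - i') (n - j) - w (m - i', n - j) + lpp ?r (Suc i') (Suc j) \<le> lpp w m n"
      by (rule less.hyps) (use less.prems Suc in simp_all)
    moreover have "Suc (m - i) = m - i'" using less.prems Suc by simp
    ultimately show ?thesis using lpp_step_right[of w "m - i" "n - j"] Suc by simp
  qed
  have up: "lpp w (m - i) (n - j) + lpp ?r (Suc i) j \<le> lpp w m n"
  proof (cases j)
    case 0
    then show ?thesis using lpp_mono_right[of w "m - i" m n] nn by simp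
  next
    case (Suc j')
    have "lpp w (m - i) (n - j') - w (m - i, n - j') + lpp ?r (Suc i) (Suc j') \<le> lpp w m n"
      by (rule less.hyps) (use less.prems Suc in simp_all)
    moreover have "Suc (n - j) = n - j'" using less.prems Suc by simp
    ultimately show ?thesis using lpp_step_up[of w "m - i" "n - j"] Suc by simp
  qed
  show ?case using right up by simp
qed

lemma route_le_lpp:
  assumes nn: "\<And>p. 0 \<le> w p" and x: "1 \<le> x" "x \<le> m" and n: "1 \<le> n"
  shows "route m n w x \<le> lpp w m n"
proof -
  have "lpp w (m - (m - x)) (n - (n - 1)) - w (m - (m - x), n - (n - 1)) + lpp (rev_bulk m n w) (Suc (m - x)) (Suc (n - 1)) \<le> lpp w m n"
    by (rule lpp_through_point[of w, OF nn]) (use x n in simp_all)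
  moreover have "m - (m - x) = x" "n - (n - 1) = 1" "Suc (m - x) = Suc m - x" "Suc (n - 1) = n" using x n by simp_all
  ultimately have "lpp w x 1 - w (x, 1) + lpp (rev_bulk m n w) (Suc m - x) n \<le> lpp w m n" by simp
  then show ?thesis using lpp_step_up[of w x 0] by (simp add: route_def)
qed

text \<open>
  Split the path at its exit point. The first part lies on the axis. The second part lies in the bulk,
  and there the passage time to the endpoint, taken with a minus sign, is a potential as in
  \<open>path_sum_le\<close>.
\<close>

lemma path_weight_le_route:
  assumes nn: "\<And>p. 0 \<le> w p" and w0: "w (0, 0) = 0" and \<pi>: "up_right_path m n \<pi>"
    and n: "1 \<le> n" and x: "signed_exit (exit_point \<pi>) = int x" "1 \<le> x"
  shows "x \<le> m" "path_weight w \<pi> \<le> route m n w x"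
proof -
  let ?P = "\<lambda>(i, j). i = (0 :: nat) \<or> j = (0 :: nat)" and ?r = "rev_bulk m n w"
  have succ: "successively up_right_step \<pi>" and last: "last \<pi> = (m, n)" using \<pi> by (simp_all add: up_right_path_def)
  note sorted = path_sorted[OF succ]
  have ep: "exit_point \<pi> = (x, 0)"
    using x by (cases "exit_point \<pi>") (auto simp: signed_exit_def split: if_splits)
  then have mem: "(x, 0) \<in> set \<pi>" using exit_point_in_path(1)[OF \<pi>] by simp
  show "x \<le> m" using path_le_last[OF \<pi> mem] by simp
  obtain xs ys where split: "\<pi> = xs @ (x, 0) # ys" using split_list[OF mem] by blast
  have before: "below p (x, 0)" if "p \<in> set xs" for p using sorted that by (auto simp: split sorted_wrt_append)
  have after: "below (x, 0) p" if "p \<in> set ys" for p using sorted that by (auto simp: split sorted_wrt_append)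
  have disj: "set (xs @ [(x, 0)]) \<inter> set ys = {}"
    using sorted by (fastforce simp: split sorted_wrt_append below_def)
  have interior: "\<not> ?P p" if "p \<in> set ys" for p
  proof
    assume "?P p"
    then have ne: "filter ?P ys \<noteq> []" using that by (auto simp: filter_empty_conv)
    have "last (filter ?P \<pi>) = last (filter ?P ys)" using ne by (simp add: split)
    then have "(x, 0) = last (filter ?P ys)" using ep by (simp add: exit_point_def)
    then have "(x, 0) \<in> set ys" using last_in_set[OF ne] by auto
    then show False using after[of "(x, 0)"] by (auto simp: below_def)
  qed
  have ys: "ys \<noteq> []" using last n by (auto simp: split)
  have succ_ys: "successively up_right_step ys" and step: "up_right_step (x, 0) (hd ys)"
    using succ ys by (auto simp: split successively_append_iff successively_Cons)
  have hd: "hd ys = (x, 1)"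
    using step interior[OF hd_in_set[OF ys]] by (auto simp: up_right_step_def)
  have last_ys: "last ys = (m, n)" using last ys by (simp add: split)
  define F where "F p = w p - lpp ?r (Suc m - fst p) (Suc n - snd p)" for p
  have "F (hd ys) + (\<Sum>p\<in>set ys. w p) \<le> F (last ys) + w (hd ys)"
  proof (rule path_sum_le[OF _ succ_ys ys])
    fix p q assume pq: "p \<in> set ys" "q \<in> set ys" "up_right_step p q"
    obtain a b where p: "p = (a, b)" by (cases p)
    have in_box: "1 \<le> a" "a \<le> m" "1 \<le> b" "b \<le> n"
      using interior[OF pq(1)] path_le_last[OF \<pi>, of p] pq(1) by (auto simp: p split)
    then have S: "Suc m - a = Suc (m - a)" "Suc n - b = Suc (n - b)" "m - (m - a) = a" "n - (n - b) = b" by auto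
    have wp: "?r (Suc (m - a), Suc (n - b)) = w p" by (simp add: S p)
    from pq(3) consider "q = (Suc a, b)" | "q = (a, Suc b)" by (auto simp: up_right_step_def p)
    then show "F p + w q \<le> F q"
    proof cases
      case 1
      then show ?thesis using lpp_step_right[of ?r "m - a" "Suc (n - b)"] wp by (simp add: F_def p S)
    next
      case 2
      then show ?thesis using lpp_step_up[of ?r "Suc (m - a)" "n - b"] wp by (simp add: F_def p S)
    qed
  qed
  moreover have "F (last ys) = 0" by (simp add: F_def last_ys)
  ultimately have 1: "(\<Sum>p\<in>set ys. w p) \<le> lpp ?r (Suc m - x) n" by (simp add: F_def hd)
  have "(\<Sum>p\<in>set (xs @ [(x, 0)]). w p) \<le> (\<Sum>p\<in>(\<lambda>i. (i, 0)) ` {0..x}. w p)"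
  proof (rule sum_mono2)
    show "set (xs @ [(x, 0)]) \<subseteq> (\<lambda>i. (i, 0)) ` {0..x}"
    proof
      fix p assume "p \<in> set (xs @ [(x, 0)])"
      then have "fst p \<le> x \<and> snd p = 0" using before[of p] by (auto simp: below_def)
      then show "p \<in> (\<lambda>i. (i, 0)) ` {0..x}" by (cases p) auto
    qed
  qed (use nn in auto)
  also have "\<dots> = (\<Sum>i\<in>{0..x}. w (i, 0))" by (subst sum.reindex) (auto simp: inj_on_def)
  also have "\<dots> = lpp w x 0" by (induction x) (auto simp: w0)
  finally have 2: "(\<Sum>p\<in>set (xs @ [(x, 0)]). w p) \<le> lpp w x 0" .
  have "set \<pi> = set (xs @ [(x, 0)]) \<union> set ys" by (auto simp: split)
  then have "path_weight w \<pi> = (\<Sum>p\<in>set (xs @ [(x, 0)]). w p) + (\<Sum>p\<in>set ys. w p)"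
    unfolding path_weight_def using disj by (simp only: sum.union_disjoint[OF List.finite_set List.finite_set])
  then show "path_weight w \<pi> \<le> route m n w x" using 1 2 by (simp add: route_def)
qed

text \<open>
  If in the reversed model with open boundaries the horizontal exit is the better one at
  \<open>(l, n)\<close>, it stays so further to the right. There the passage times are those of the model with
  closed vertical boundary, whose horizontal increments dominate those of the bulk.
\<close>

lemma rev_increment_le:
  assumes nn: "\<And>p. 0 \<le> W p" and bulk: "\<And>i j. W (Suc i, Suc j) = rev_bulk m n w (Suc i, Suc j)"
    and ev: "lpp (ver W) l n \<le> lpp (hor W) l n" and i: "l \<le> i"
  shows "hinc (rev_bulk m n w) (Suc i) n \<le> hinc W (Suc i) n"
proof -
  have "lpp (ver W) i n \<le> lpp (hor W) i n"
    using hor_minus_ver_mono[of W l i n, OF nn i] ev by linarith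
  then have 1: "lpp W i n = lpp (hor W) i n" using lpp_max[of W i n, OF nn] by simp
  have 2: "lpp (hor W) (Suc i) n \<le> lpp W (Suc i) n" using lpp_max[of W "Suc i" n, OF nn] by simp
  have "hinc (rev_bulk m n w) (Suc i) n \<le> hinc (hor W) (Suc i) n"
  proof (rule conjunct1[OF increments_compare])
    show "rev_bulk m n w (Suc a, Suc b) = hor W (Suc a, Suc b)" for a b using bulk by simp
    show "rev_bulk m n w (Suc a, 0) \<le> hor W (Suc a, 0)" for a using nn by simp
    show "hor W (0, Suc b) \<le> rev_bulk m n w (0, Suc b)" for b by simp
  qed
  then show ?thesis using 1 2 by (simp add: hinc_def)
qed

lemma route_step:
  assumes "1 \<le> i" "i < m"
  shows "route m n w (Suc i) - route m n w i = w (Suc i, 0) - hinc (rev_bulk m n w) (Suc (m - i)) n"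
proof -
  have "Suc m - i = Suc (m - i)" using assms by auto
  then show ?thesis by (simp add: route_def hinc_def)
qed

text \<open>
  If \<open>V\<close> is maximal on \<open>{1..k + L}\<close> at a point \<open>x \<le> k\<close> and its increments dominate the steps \<open>s\<close>, then the
  walk of the steps from \<open>k\<close> onwards cannot rise above \<open>g\<close>, unless the steps between some point of
  \<open>{1..k}\<close> and \<open>k\<close> add up to less than \<open>- g\<close>.
\<close>

lemma route_argmax_walk:
  fixes V s :: "nat \<Rightarrow> real"
  assumes step: "\<And>i. 1 \<le> i \<Longrightarrow> i < k + L \<Longrightarrow> s i \<le> V (Suc i) - V i"
    and x: "1 \<le> x" "x \<le> k" and max: "\<And>y. 1 \<le> y \<Longrightarrow> y \<le> k + L \<Longrightarrow> V y \<le> V x" and g: "0 \<le> g"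
    and backwards: "stays_below (k - 1) g (\<lambda>l. - s (k - 1 - l))"
  shows "stays_below L g (\<lambda>l. s (k + l))"
  unfolding stays_below_def
proof
  fix y assume y: "y \<in> {1..L}"
  have forward: "V k + (\<Sum>l<y. s (k + l)) \<le> V (k + y)" if "y \<le> L" for y
    using that
  proof (induction y)
    case (Suc y)
    have "s (k + y) \<le> V (Suc (k + y)) - V (k + y)" by (rule step) (use x Suc.prems in simp_all)
    moreover have "V k + (\<Sum>l<y. s (k + l)) \<le> V (k + y)" by (rule Suc.IH) (use Suc.prems in simp)
    ultimately show ?case by simp
  qed simp
  have backward: "V (k - d) \<le> V k + (\<Sum>l<d. - s (k - 1 - l))" if "d \<le> k - 1" for d
    using that
  proof (induction d)
    case (Suc d)
    have e: "Suc (k - 1 - d) = k - d" "k - Suc d = k - 1 - d" using Suc.prems by simp_all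
    have "s (k - 1 - d) \<le> V (Suc (k - 1 - d)) - V (k - 1 - d)" by (rule step) (use x Suc.prems in simp_all)
    moreover have "V (k - d) \<le> V k + (\<Sum>l<d. - s (k - 1 - l))" by (rule Suc.IH) (use Suc.prems in simp)
    ultimately show ?case unfolding e(2) sum.lessThan_Suc by (simp only: e(1))
  qed simp
  have "V x \<le> V k + g"
  proof (cases "x = k")
    case False
    have "V x = V (k - (k - x))" using x by simp
    also have "\<dots> \<le> V k + (\<Sum>l<k - x. - s (k - 1 - l))" by (rule backward) (use x in simp)
    also have "(\<Sum>l<k - x. - s (k - 1 - l)) \<le> g"
      by (rule backwards[unfolded stays_below_def, rule_format])
        (use x False in \<open>simp only: atLeastAtMost_iff, arith\<close>)
    finally show ?thesis by simp
  qed (use g in simp)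
  moreover have "V (k + y) \<le> V x" by (rule max) (use x y in simp_all)
  moreover have "V k + (\<Sum>l<y. s (k + l)) \<le> V (k + y)" by (rule forward) (use y in simp)
  ultimately show "(\<Sum>l<y. s (k + l)) \<le> g" by linarith
qed

text \<open>
  The reversed model needs boundary weights of its own. They are taken from the original weights in
  row \<open>n + 1\<close> and column \<open>m + 1\<close>, which are independent of the box, and are rescaled to the rates
  \<open>l\<close> and \<open>1 - l\<close>. The slots \<open>(m + x, 0)\<close> beyond the box keep the original horizontal boundary weights,
  so that one independent family contains the steps of the walk and the reversed environment.
\<close>

definition rev_index :: "nat \<Rightarrow> nat \<Rightarrow> nat \<times> nat \<Rightarrow> nat \<times> nat" where
  "rev_index m n = (\<lambda>(i, j). if j = 0 \<and> m < i then (i - m, 0) else (Suc m - i, Suc n - j))"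

definition rev_scale :: "nat \<Rightarrow> real \<Rightarrow> nat \<times> nat \<Rightarrow> real" where
  "rev_scale m l = (\<lambda>(i, j). if j = 0 then (if m < i then 1 else 1 / l) else if i = 0 then 1 / (1 - l) else 1)"

definition rev_weights :: "nat \<Rightarrow> nat \<Rightarrow> real \<Rightarrow> (nat \<times> nat \<Rightarrow> real) \<Rightarrow> nat \<times> nat \<Rightarrow> real" where
  "rev_weights m n l w e = rev_scale m l e * w (rev_index m n e)"

definition rev_rate :: "nat \<Rightarrow> real \<Rightarrow> real \<Rightarrow> nat \<times> nat \<Rightarrow> real" where
  "rev_rate m z l = (\<lambda>(i, j). if j = 0 then (if m < i then z else l) else if i = 0 then 1 - l else 1)"

definition rev_support :: "nat \<Rightarrow> nat \<Rightarrow> (nat \<times> nat) set" where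
  "rev_support m n = {(i, j). (i \<le> m \<and> j \<le> n \<and> (i, j) \<noteq> (0, 0)) \<or> (j = 0 \<and> m < i)}"

lemma rev_stationary:
  assumes F: "exp_family M (UNIV - {(0, 0)}) \<omega> (lpp_rate z)" and l: "0 < l" "l < 1"
  shows "stationary M (rev_support m n) (\<lambda>e x. rev_weights m n l (\<lambda>p. \<omega> p x) e) (rev_rate m z l) l (1 - l) m n"
proof -
  let ?S = "rev_support m n"
  have inj: "inj_on (rev_index m n) ?S"
  proof (rule inj_onI)
    fix e f assume "e \<in> ?S" "f \<in> ?S" "rev_index m n e = rev_index m n f"
    then show "e = f"
      by (cases e; cases f) (auto simp: rev_support_def rev_index_def split: if_splits)
  qed
  have sub: "rev_index m n ` ?S \<subseteq> UNIV - {(0, 0)}"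
    by (auto simp: rev_support_def rev_index_def)
  have "exp_family M ?S (\<lambda>e. \<omega> (rev_index m n e)) (\<lambda>e. lpp_rate z (rev_index m n e))"
    by (rule exp_family_reindex[OF F inj sub])
  then have "exp_family M ?S (\<lambda>e x. rev_scale m l e * \<omega> (rev_index m n e) x) (\<lambda>e. lpp_rate z (rev_index m n e) / rev_scale m l e)"
    by (rule exp_family_scale) (use l in \<open>auto simp: rev_scale_def\<close>)
  then have "exp_family M ?S (\<lambda>e x. rev_weights m n l (\<lambda>p. \<omega> p x) e) (rev_rate m z l)"
  proof (rule exp_family_cong)
    fix e assume e: "e \<in> ?S"
    then show "rev_rate m z l e = lpp_rate z (rev_index m n e) / rev_scale m l e"
      using l by (cases e) (auto simp: rev_rate_def lpp_rate_def rev_index_def rev_scale_def rev_support_def)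
  qed (simp add: rev_weights_def)
  then show ?thesis by (auto simp: stationary_def rev_support_def rev_rate_def)
qed

lemma emeasure_Collect_if:
  assumes "{x \<in> space M. P x} \<in> sets M"
  shows "emeasure M {x \<in> space M. P x} = (\<integral>\<^sup>+x. (if P x then 1 else 0) \<partial>M)"
proof -
  have "emeasure M {x \<in> space M. P x} = (\<integral>\<^sup>+x. indicator {x \<in> space M. P x} x \<partial>M)"
    using assms by simp
  also have "\<dots> = (\<integral>\<^sup>+x. (if P x then 1 else 0) \<partial>M)"
    by (intro nn_integral_cong) (simp add: indicator_def)
  finally show ?thesis .
qed

lemma emeasure_Collect_if_not:
  assumes "{x \<in> space M. \<not> P x} \<in> sets M"
  shows "emeasure M {x \<in> space M. \<not> P x} = (\<integral>\<^sup>+x. (if P x then 0 else 1) \<partial>M)"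
  unfolding emeasure_Collect_if[OF assms] by (intro nn_integral_cong) simp

text \<open>
  If \<open>1 \<le> Z \<le> k\<close>, then the maximum of the route weights over \<open>{1..k + L}\<close> is attained in \<open>{1..k}\<close>. The
  increments of the route weights are boundary weights minus bulk increments. Unless the reversed
  model of rate \<open>l\<close> has a vertical exit at \<open>(m - (k + L), n)\<close>, they dominate the steps of a walk made of
  independent \<open>Exp(z)\<close> variables minus the increments of the reversed model, which by Burke's theorem
  are independent \<open>Exp(l)\<close> variables. The three terms of the bound stand for the exit of the reversed
  model, the backward part and the forward part of the walk.
\<close>

lemma Z_near_origin:
  assumes st: "stationary_lpp M \<omega> \<rho>" and \<rho>: "0 < \<rho>" "\<rho> < 1" and z: "z = 1 - \<rho>"
    and mn: "m = nat \<lfloor>(1 - \<rho>)\<^sup>2 * t\<rfloor>" "n = nat \<lfloor>\<rho>\<^sup>2 * t\<rfloor>"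
    and k: "1 \<le> k" "k + L \<le> m" "1 \<le> n" and l: "0 < l" "l < z" and g: "0 \<le> g"
    and h: "0 < h" "2 * h < 1 - l"
    and t1: "0 \<le> \<theta>1" "\<theta>1 < l" "R1 = l / (l - \<theta>1) * (z / (z + \<theta>1))" "1 \<le> R1"
    and t2: "0 < \<theta>2" "\<theta>2 < z" "c = (z - \<theta>2) / z" "R2 = l / (c * (l + \<theta>2))" "1 \<le> R2"
  shows "measure M {x \<in> space M. 1 \<le> Z_exit (\<lambda>p. \<omega> p x) \<rho> t \<and> Z_exit (\<lambda>p. \<omega> p x) \<rho> t \<le> int k}
     \<le> exp (h\<^sup>2 / 2 * (real n / ((1 - l) * (1 - l - 2 * h)) - real (m - (k + L)) / (l + h)\<^sup>2))
       + exp (- \<theta>1 * g) * R1 ^ (k - 1) + (1 - c * (exp (- \<theta>2 * g) - inverse R2 ^ L))"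
proof -
  interpret stationary_lpp M \<omega> \<rho> by fact
  have z01: "0 < z" "z < 1" using \<rho> z by auto
  note F = stationary_lpp_exp_family[OF st \<rho>, folded z]
  note reg = stationary_lpp_regular[OF st \<rho>]
  let ?W = "\<lambda>x. rev_weights m n l (\<lambda>p. \<omega> p x)"
  have stW: "stationary M (rev_support m n) (\<lambda>e x. ?W x e) (rev_rate m z l) l (1 - l) m n"
    by (rule rev_stationary[OF F]) (use l z01 in auto)
  have W_nn: "0 \<le> ?W x e" if "\<forall>p. 0 \<le> \<omega> p x" for x e
  proof -
    have "0 \<le> rev_scale m l e" using l z01 by (cases e) (auto simp: rev_scale_def)
    moreover have "0 \<le> \<omega> (rev_index m n e) x" using that by blast
    ultimately show ?thesis by (simp add: rev_weights_def)
  qed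
  note B = burke_rectangle[OF stW]
  let ?Y = "\<lambda>p x. edge (?W x) (\<lambda>i. if 1 \<le> i \<and> i \<le> m then n else 0) (\<lambda>j. if 1 \<le> j \<and> j \<le> n then m else 0) p"
  let ?T = "rev_support m n - {1..m} \<times> {1..n}"
  have Y1: "?Y (Suc (m - i), 0) x = hinc (?W x) (Suc (m - i)) n" if "1 \<le> i" "i \<le> m" for i x
  proof -
    have "Suc (m - i) \<le> m" using that by linarith
    then show ?thesis by (simp add: edge_def)
  qed
  have Y2: "?Y (m + i, 0) x = \<omega> (i, 0) x" if "1 \<le> i" for i x
    using that by (cases i) (auto simp: edge_def rev_weights_def rev_scale_def rev_index_def)
  let ?s = "\<lambda>x i. \<omega> (Suc i, 0) x - hinc (?W x) (Suc (m - i)) n"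
  let ?\<sigma>1 = "\<lambda>(i, up). if up then (Suc (m - (k - 1 - i)), 0 :: nat) else (m + (k - i), 0)"
  let ?\<sigma>2 = "\<lambda>(i, up). if up then (m + Suc (k + i), 0 :: nat) else (Suc (m - (k + i)), 0)"
  have F1: "exp_family M ({..<k - 1} \<times> UNIV) (\<lambda>e. ?Y (?\<sigma>1 e)) (walk_rate l z)"
  proof -
    have "exp_family M ({..<k - 1} \<times> UNIV) (\<lambda>e. ?Y (?\<sigma>1 e)) (\<lambda>e. rev_rate m z l (?\<sigma>1 e))"
      by (rule exp_family_reindex[OF B]) (use k in \<open>auto simp: inj_on_def rev_support_def split: if_splits\<close>)
    then show ?thesis
      by (rule exp_family_cong) (use k in \<open>auto simp: walk_rate_def rev_rate_def\<close>)
  qed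
  have F2: "exp_family M ({..<L} \<times> UNIV) (\<lambda>e. ?Y (?\<sigma>2 e)) (walk_rate z l)"
  proof -
    have "exp_family M ({..<L} \<times> UNIV) (\<lambda>e. ?Y (?\<sigma>2 e)) (\<lambda>e. rev_rate m z l (?\<sigma>2 e))"
      by (rule exp_family_reindex[OF B]) (use k in \<open>auto simp: inj_on_def rev_support_def split: if_splits\<close>)
    then show ?thesis
      by (rule exp_family_cong) (use k in \<open>auto simp: walk_rate_def rev_rate_def\<close>)
  qed
  have w1: "stays_below (k - 1) g (walk_step (\<lambda>e. ?Y (?\<sigma>1 e)) x) \<longleftrightarrow> stays_below (k - 1) g (\<lambda>i. - ?s x (k - 1 - i))" for x
  proof (rule stays_below_cong)
    fix i assume i: "i < k - 1"
    then have "Suc (k - 1 - i) = k - i" by simp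
    then show "walk_step (\<lambda>e. ?Y (?\<sigma>1 e)) x i = - ?s x (k - 1 - i)"
      using Y1[of "k - 1 - i" x] Y2[of "k - i" x] i k by simp
  qed
  have w2: "stays_below L g (walk_step (\<lambda>e. ?Y (?\<sigma>2 e)) x) \<longleftrightarrow> stays_below L g (\<lambda>i. ?s x (k + i))" for x
  proof (rule stays_below_cong)
    fix i assume i: "i < L"
    show "walk_step (\<lambda>e. ?Y (?\<sigma>2 e)) x i = ?s x (k + i)"
      using Y1[of "k + i" x] Y2[of "Suc (k + i)" x] i k by simp
  qed
  let ?E = "{x \<in> space M. 1 \<le> Z_exit (\<lambda>p. \<omega> p x) \<rho> t \<and> Z_exit (\<lambda>p. \<omega> p x) \<rho> t \<le> int k}"
  let ?A = "{x \<in> space M. lpp (hor (?W x)) (m - (k + L)) n \<le> lpp (ver (?W x)) (m - (k + L)) n}"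
  let ?B = "{x \<in> space M. \<not> stays_below (k - 1) g (walk_step (\<lambda>e. ?Y (?\<sigma>1 e)) x)}"
  let ?C = "{x \<in> space M. stays_below L g (walk_step (\<lambda>e. ?Y (?\<sigma>2 e)) x)}"
  have imp: "AE x in M. x \<in> ?E \<longrightarrow> x \<in> ?A \<union> (?B \<union> ?C)"
    using reg
  proof eventually_elim
    case (elim x)
    let ?w = "\<lambda>p. \<omega> p x" and ?V = "route m n (\<lambda>p. \<omega> p x)"
    have nn: "0 \<le> ?w p" and w0: "?w (0, 0) = 0" for p using elim by blast+
    have M: "up_right_path m n (maximal_path ?w m n)" "path_weight ?w (maximal_path ?w m n) = lpp ?w m n"
      using maximal_path_correct[of ?w m n] elim by (auto simp: is_maximal_path_def)
    show ?case
    proof (intro impI, rule ccontr)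
      assume E: "x \<in> ?E" and neg: "x \<notin> ?A \<union> (?B \<union> ?C)"
      define y where "y = nat (Z_exit ?w \<rho> t)"
      have y: "signed_exit (exit_point (maximal_path ?w m n)) = int y" "1 \<le> y" "y \<le> k"
        using E by (auto simp: y_def Z_exit_def mn)
      note P = path_weight_le_route[of ?w, OF nn w0 M(1) k(3) y(1,2)]
      have A: "lpp (ver (?W x)) (m - (k + L)) n \<le> lpp (hor (?W x)) (m - (k + L)) n"
        and Bx: "stays_below (k - 1) g (\<lambda>i. - ?s x (k - 1 - i))"
        and Cx: "\<not> stays_below L g (\<lambda>i. ?s x (k + i))"
        using neg E w1[of x] w2[of x] by auto
      have "stays_below L g (\<lambda>i. ?s x (k + i))"
      proof (rule route_argmax_walk[where V = ?V and x = y])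
        fix i assume i: "1 \<le> i" "i < k + L"
        have "hinc (rev_bulk m n ?w) (Suc (m - i)) n \<le> hinc (?W x) (Suc (m - i)) n"
        proof (rule rev_increment_le[OF _ _ A])
          show "0 \<le> ?W x p" for p using W_nn elim by blast
          show "?W x (Suc a, Suc b) = rev_bulk m n ?w (Suc a, Suc b)" for a b
            by (simp add: rev_weights_def rev_scale_def rev_index_def)
        qed (use i in auto)
        then show "?s x i \<le> ?V (Suc i) - ?V i" using route_step[of i m n ?w] i k by simp
      next
        fix i assume i: "1 \<le> i" "i \<le> k + L"
        have "?V i \<le> lpp ?w m n" by (rule route_le_lpp[OF nn]) (use i k in auto)
        then show "?V i \<le> ?V y" using P(2) M(2) by simp
      qed (use y g Bx in auto)
      then show False using Cx by blast
    qed
  qed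
  have Ym: "?Y e \<in> borel_measurable M" if "e \<in> ?T" for e by (rule exp_familyD(3)[OF B that])
  have stA: "stationary M (rev_support m n) (\<lambda>e x. ?W x e) (rev_rate m z l) l (1 - l) (m - (k + L)) n"
    using stW by (auto simp: stationary_def)
  have Am: "?A \<in> sets M"
    using stationary_lpp_measurable(2,3)[OF stA, of "m - (k + L)" n] by measurable
  have steps: "(\<lambda>x. walk_step X x i) \<in> borel_measurable M"
    if "exp_family M ({..<K} \<times> UNIV) X q" "i < K" for X :: "nat \<times> bool \<Rightarrow> 'a \<Rightarrow> real" and K q i
    using that by (intro borel_measurable_diff exp_familyD(3)[OF that(1)]) auto
  have Bm: "?B \<in> sets M" and Cm: "?C \<in> sets M"
    using stays_below_measurable[of "k - 1" "\<lambda>x. walk_step (\<lambda>e. ?Y (?\<sigma>1 e)) x" M "\<lambda>_. g", OF steps[OF F1]]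
      stays_below_measurable[of L "\<lambda>x. walk_step (\<lambda>e. ?Y (?\<sigma>2 e)) x" M "\<lambda>_. g", OF steps[OF F2]]
    by measurable
  have "measure M ?E \<le> measure M (?A \<union> (?B \<union> ?C))"
    using imp Am Bm Cm by (intro finite_measure_mono_AE) auto
  also have "\<dots> \<le> measure M ?A + measure M (?B \<union> ?C)" using Am Bm Cm by (intro measure_Un_le) auto
  also have "measure M (?B \<union> ?C) \<le> measure M ?B + measure M ?C" using Bm Cm by (rule measure_Un_le)
  finally have sum: "measure M ?E \<le> measure M ?A + (measure M ?B + measure M ?C)" by simp
  have 1: "measure M ?A \<le> exp (h\<^sup>2 / 2 * (real n / ((1 - l) * (1 - l - 2 * h)) - real (m - (k + L)) / (l + h)\<^sup>2))"
  proof (rule exit_bound_transposed[OF stA _ _ h])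
    show "AE x in M. \<forall>e. 0 \<le> ?W x e" using reg by eventually_elim (use W_nn in blast)
  qed (use l z01 in auto)
  have 2: "measure M ?B \<le> exp (- \<theta>1 * g) * R1 ^ (k - 1)"
  proof -
    have "emeasure M ?B = (\<integral>\<^sup>+x. (if stays_below (k - 1) g (walk_step (\<lambda>e. ?Y (?\<sigma>1 e)) x) then 0 else 1) \<partial>M)"
      by (rule emeasure_Collect_if_not[OF Bm])
    also have "\<dots> \<le> ennreal (exp (- \<theta>1 * g) * R1 ^ (k - 1))"
      by (rule walk_max_chernoff[OF t1(1,2) z01(1) t1(3,4) F1])
    finally show ?thesis using t1(4) by (simp add: emeasure_eq_measure)
  qed
  have 3: "measure M ?C \<le> 1 - c * (exp (- \<theta>2 * g) - inverse R2 ^ L)"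
  proof -
    have "emeasure M ?C = (\<integral>\<^sup>+x. (if stays_below L g (walk_step (\<lambda>e. ?Y (?\<sigma>2 e)) x) then 1 else 0) \<partial>M)"
      by (rule emeasure_Collect_if[OF Cm])
    also have "\<dots> \<le> ennreal (1 - c * (exp (- \<theta>2 * g) - inverse R2 ^ L))"
      by (rule walk_stays_below[OF t2(1,2) l(1) t2(3,4,5) F2 g])
    finally have le: "ennreal (measure M ?C) \<le> ennreal (1 - c * (exp (- \<theta>2 * g) - inverse R2 ^ L))"
      by (simp add: emeasure_eq_measure)
    have "c * (exp (- \<theta>2 * g) - inverse R2 ^ L) \<le> 1"
    proof -
      have "0 \<le> c" "c \<le> 1" unfolding t2(3) using t2(1,2) z01 by (simp_all add: divide_le_eq)
      moreover have "exp (- \<theta>2 * g) \<le> 1" using t2(1) g by simp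
      moreover have "0 \<le> inverse R2 ^ L" using t2(5) by simp
      ultimately have "0 \<le> c" "c \<le> 1" "exp (- \<theta>2 * g) - inverse R2 ^ L \<le> 1" by linarith+
      then have "c * (exp (- \<theta>2 * g) - inverse R2 ^ L) \<le> c * 1" by (intro mult_left_mono)
      then show ?thesis using \<open>c \<le> 1\<close> by simp
    qed
    then show ?thesis using le by (simp add: ennreal_le_iff)
  qed
  show ?thesis using sum 1 2 3 by linarith
qed

section \<open>Exit points near the origin\<close>

text \<open>
  The exponent of the exit bound for the reversed model. Its rate \<open>l\<close> is smaller than \<open>z\<close> by
  \<open>\<beta> = b t\<^bsup>-1/3\<^esup>\<close>, which moves the characteristic direction by order \<open>b t\<^bsup>2/3\<^esup>\<close> away from the endpoint; for
  large \<open>b\<close> this beats the perturbation of the endpoint by at most \<open>3 t\<^bsup>2/3\<^esup>\<close>. Here \<open>T = t\<^bsup>1/3\<^esup>\<close>.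
\<close>

lemma drift_exponent:
  fixes z b T m n l h \<beta> :: real
  assumes z: "0 < z" "z < 1" and b: "24 / z \<le> b" and T: "0 < T"
    and \<beta>: "\<beta> = b / T" "\<beta> \<le> z / 2" and l: "l = z - \<beta>" and h: "h = \<beta> / 4"
    and n: "0 \<le> n" "n \<le> (1 - z)\<^sup>2 * T ^ 3" and m: "z\<^sup>2 * T ^ 3 - 3 * T\<^sup>2 \<le> m"
  shows "h\<^sup>2 / 2 * (n / ((1 - l) * (1 - l - 2 * h)) - m / (l + h)\<^sup>2) \<le> - (b ^ 3 / 32)"
proof -
  have b0: "0 < b" using b z by (smt (verit) divide_pos_pos)
  have \<beta>0: "0 < \<beta>" using b0 T \<beta> by simp
  have N: "n / ((1 - l) * (1 - l - 2 * h)) \<le> T ^ 3"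
  proof -
    have e: "1 - z \<le> 1 - l" "1 - z \<le> 1 - l - 2 * h" using \<beta>0 by (simp_all add: l h)
    have pos: "0 < (1 - l) * (1 - l - 2 * h)" using e z by (intro mult_pos_pos) linarith+
    have "(1 - z) * (1 - z) \<le> (1 - l) * (1 - l - 2 * h)"
      using e z by (intro mult_mono) linarith+
    then have "(1 - z)\<^sup>2 * T ^ 3 \<le> (1 - l) * (1 - l - 2 * h) * T ^ 3"
      using T unfolding power2_eq_square by (intro mult_right_mono) auto
    then have "n \<le> T ^ 3 * ((1 - l) * (1 - l - 2 * h))" using n by (simp add: mult.commute)
    then show ?thesis using pos by (simp add: pos_divide_le_eq)
  qed
  have M: "T ^ 3 * (1 + 3 * \<beta> / (2 * z)) - 12 * T\<^sup>2 / z\<^sup>2 \<le> m / (l + h)\<^sup>2"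
  proof -
    define p where "p = l + h"
    have p: "p = z - 3 * \<beta> / 4" by (simp add: p_def l h)
    have pz: "z / 2 \<le> p" "0 < p" using \<beta> z by (auto simp: p)
    define u where "u = 3 * \<beta> / (4 * z)"
    have u: "0 \<le> u" "u \<le> 1" using \<beta>(2) \<beta>0 z by (simp_all add: u_def field_simps)
    have pu: "p = z * (1 - u)" using z by (simp add: p u_def field_simps)
    have "(1 + 2 * u) * (1 - u)\<^sup>2 \<le> 1"
    proof -
      have "(1 + 2 * u) * (1 - u)\<^sup>2 = 1 - u\<^sup>2 * (3 - 2 * u)" by (simp add: power2_eq_square algebra_simps)
      moreover have "0 \<le> u\<^sup>2 * (3 - 2 * u)" using u by simp
      ultimately show ?thesis by simp
    qed
    then have "z\<^sup>2 * ((1 + 2 * u) * (1 - u)\<^sup>2) \<le> z\<^sup>2 * 1" by (intro mult_left_mono) auto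
    then have "(1 + 2 * u) * p\<^sup>2 \<le> z\<^sup>2" by (simp add: pu power_mult_distrib mult_ac)
    then have a: "1 + 2 * u \<le> z\<^sup>2 / p\<^sup>2" using pz by (simp add: pos_le_divide_eq)
    have "(z / 2)\<^sup>2 \<le> p\<^sup>2" using pz z by (intro power_mono) auto
    then have c: "3 * T\<^sup>2 / p\<^sup>2 \<le> 3 * T\<^sup>2 / (z / 2)\<^sup>2" using z pz by (intro divide_left_mono) auto
    have "T ^ 3 * (1 + 2 * u) - 3 * T\<^sup>2 / (z / 2)\<^sup>2 \<le> T ^ 3 * (z\<^sup>2 / p\<^sup>2) - 3 * T\<^sup>2 / p\<^sup>2"
      using a c T by (intro diff_mono mult_left_mono) auto
    also have "\<dots> = (z\<^sup>2 * T ^ 3 - 3 * T\<^sup>2) / p\<^sup>2" by (simp add: diff_divide_distrib)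
    also have "\<dots> \<le> m / p\<^sup>2" using m by (intro divide_right_mono) auto
    finally show ?thesis unfolding p_def[symmetric] using z by (simp add: u_def power_divide)
  qed
  have "n / ((1 - l) * (1 - l - 2 * h)) - m / (l + h)\<^sup>2 \<le> 12 * T\<^sup>2 / z\<^sup>2 - T ^ 3 * (3 * \<beta> / (2 * z))"
    using N M by (simp add: algebra_simps)
  also have "T ^ 3 * (3 * \<beta> / (2 * z)) = T\<^sup>2 * (3 * b / (2 * z))"
    using T by (simp add: \<beta>(1) power2_eq_square power3_eq_cube)
  also have "12 * T\<^sup>2 / z\<^sup>2 - T\<^sup>2 * (3 * b / (2 * z)) = T\<^sup>2 * (12 / z\<^sup>2 - 3 * b / (2 * z))"
    by (simp add: algebra_simps)
  also have "\<dots> \<le> T\<^sup>2 * (- b)"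
  proof (rule mult_left_mono)
    have "12 / z\<^sup>2 = 24 / z * (1 / (2 * z))" using z by (simp add: power2_eq_square)
    also have "\<dots> \<le> b * (1 / (2 * z))" using b z by (intro mult_right_mono) auto
    finally have "12 / z\<^sup>2 - 3 * b / (2 * z) \<le> - (b / z)" using z by (simp add: field_simps)
    moreover have "b \<le> b / z" using b0 z by (simp add: pos_le_divide_eq mult_left_le)
    ultimately show "12 / z\<^sup>2 - 3 * b / (2 * z) \<le> - b" by linarith
  qed simp
  finally have "h\<^sup>2 / 2 * (n / ((1 - l) * (1 - l - 2 * h)) - m / (l + h)\<^sup>2) \<le> h\<^sup>2 / 2 * (T\<^sup>2 * (- b))"
    by (intro mult_left_mono) auto
  also have "\<dots> = - (b ^ 3 / 32)"
    using T by (simp add: h \<beta>(1) power2_eq_square power3_eq_cube)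
  finally show ?thesis .
qed

lemma exp_minus_le_inverse:
  fixes y :: real assumes "0 < y" shows "exp (- y) \<le> 1 / y"
proof -
  have "y \<le> exp y" using exp_ge_add_one_self[of y] by linarith
  then show ?thesis using assms by (simp add: exp_minus field_simps)
qed

text \<open>
  On the scale \<open>T = t\<^bsup>1/3\<^esup>\<close> the walk of the previous bound makes \<open>T\<^sup>2\<close> steps with drift of order
  \<open>- b / T\<close>, so it fluctuates by order \<open>T\<close>. During the first \<open>\<delta> T\<^sup>2\<close> steps it moves by at most \<open>\<eta> T\<close>, and
  afterwards it climbs above \<open>\<eta> T\<close> with high probability. The constants are fixed one after the other:
  \<open>b\<close> makes the comparison with the reversed model likely, \<open>B\<close> is the exponential parameter that beats
  the drift \<open>b\<close>, the level \<open>\<eta>\<close> is small compared with \<open>1 / B\<close>, \<open>s\<close> is the Chernoff parameter for that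
  level, and \<open>\<delta>\<close> is small enough for the Chernoff bound.
\<close>

theorem exit_rarely_near_origin:
  assumes \<rho>: "0 < \<rho>" "\<rho> < 1" and \<epsilon>: "0 < \<epsilon>"
  shows "\<exists>\<delta>>0. \<forall>\<^sub>F t in at_top. \<forall>(M :: 'a measure) \<omega>. stationary_lpp M \<omega> \<rho> \<longrightarrow>
            measure M {x \<in> space M. 1 \<le> Z_exit (\<lambda>p. \<omega> p x) \<rho> t \<and>
                real_of_int (Z_exit (\<lambda>p. \<omega> p x) \<rho> t) \<le> \<delta> * t powr (2/3)} \<le> \<epsilon>"
proof -
  define z where "z = 1 - \<rho>"
  have z: "0 < z" "z < 1" using \<rho> by (auto simp: z_def)
  \<comment> \<open>The first summand serves \<open>drift_exponent\<close>, the second makes its bound at most \<open>\<epsilon> / 4\<close>.\<close>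
  define b where "b = 24 / z + 128 / \<epsilon>"
  have b: "24 / z \<le> b" "128 / \<epsilon> \<le> b" "1 \<le> b" "0 < b"
  proof -
    show "24 / z \<le> b" "128 / \<epsilon> \<le> b" using z \<epsilon> by (auto simp: b_def)
    have "1 \<le> 24 / z" using z by (simp add: field_simps)
    then show "1 \<le> b" "0 < b" using \<open>24 / z \<le> b\<close> by auto
  qed
  define B where "B = 2 * b + 96 / \<epsilon>"
  have B: "2 * b \<le> B" "96 / \<epsilon> \<le> B" "1 \<le> B" "0 < B" using b \<epsilon> by (auto simp: B_def add_increasing2 add_pos_pos)
  define \<eta> where "\<eta> = \<epsilon> / (12 * B)"
  have \<eta>: "0 < \<eta>" "B * \<eta> = \<epsilon> / 12" using \<epsilon> B by (auto simp: \<eta>_def)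
  define s where "s = (1 + 4 / \<epsilon>) / \<eta>"
  have s: "0 < s" "s * \<eta> = 1 + 4 / \<epsilon>" using \<eta> \<epsilon> by (auto simp: s_def add_pos_pos)
  \<comment> \<open>\<open>D \<delta>\<close> bounds the logarithm of the exponential moment of the backward walk after \<open>\<delta> T\<^sup>2\<close> steps.\<close>
  define D where "D = 4 * s * (b + s) / z\<^sup>2"
  have D: "0 < D" using s b z by (simp add: D_def)
  define \<delta> where "\<delta> = min 1 (1 / D)"
  have \<delta>: "0 < \<delta>" "\<delta> \<le> 1" "D * \<delta> \<le> 1"
  proof -
    show "0 < \<delta>" "\<delta> \<le> 1" using D by (auto simp: \<delta>_def)
    have "D * \<delta> \<le> D * (1 / D)" using D by (intro mult_left_mono) (auto simp: \<delta>_def)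
    then show "D * \<delta> \<le> 1" using D by simp
  qed
  \<comment> \<open>The thresholds beyond which \<open>t\<^bsup>1/3\<^esup>\<close> is large enough for the estimates below.\<close>
  define S where "S = {2, 2 * b / z, 2 * B / z, 12 * B / (z * \<epsilon>), 4 * s / z, D, 1 / \<rho>\<^sup>2, 3 / z\<^sup>2, 1 / \<delta>}"
  define T0 where "T0 = Max S"
  have T0: "a \<le> T0" if "a \<in> S" for a
    unfolding T0_def by (rule Max_ge) (use that in \<open>simp_all add: S_def\<close>)
  have main: "measure M {x \<in> space M. 1 \<le> Z_exit (\<lambda>p. \<omega> p x) \<rho> t \<and> real_of_int (Z_exit (\<lambda>p. \<omega> p x) \<rho> t) \<le> \<delta> * t powr (2/3)} \<le> \<epsilon>"
    if t: "T0 ^ 3 \<le> t" and st: "stationary_lpp M \<omega> \<rho>" for t and M :: "'a measure" and \<omega>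
  proof -
    interpret stationary_lpp M \<omega> \<rho> by fact
    have T00: "2 \<le> T0" by (rule T0) (simp add: S_def)
    have tpos: "0 < t" using t T00 by (smt (verit) zero_less_power)
    define T where "T = t powr (1/3)"
    have T3: "T ^ 3 = t" using tpos by (simp add: T_def powr_power)
    have T2: "t powr (2/3) = T\<^sup>2" using tpos by (simp add: T_def powr_power)
    have Tpos: "0 < T" using tpos by (simp add: T_def)
    have "T0 \<le> T"
    proof (rule ccontr)
      assume "\<not> T0 \<le> T"
      then have "T ^ 3 < T0 ^ 3" using Tpos by (intro power_strict_mono) auto
      then show False using t T3 by simp
    qed
    then have S_le: "a \<le> T" if "a \<in> S" for a using T0[OF that] by linarith
    have T: "2 \<le> T" "2 * b / z \<le> T" "2 * B / z \<le> T" "12 * B / (z * \<epsilon>) \<le> T" "4 * s / z \<le> T" "D \<le> T"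
      "1 / \<rho>\<^sup>2 \<le> T" "3 / z\<^sup>2 \<le> T" "1 / \<delta> \<le> T"
      by (rule S_le, simp only: S_def insert_iff simp_thms)+
    define k L m n where "k = nat \<lfloor>\<delta> * T\<^sup>2\<rfloor>" and "L = nat \<lfloor>T\<^sup>2\<rfloor>" and "m = nat \<lfloor>(1 - \<rho>)\<^sup>2 * t\<rfloor>" and "n = nat \<lfloor>\<rho>\<^sup>2 * t\<rfloor>"
    define \<beta> where "\<beta> = b / T"
    define l where "l = z - \<beta>"
    define h where "h = \<beta> / 4"
    define \<theta>1 where "\<theta>1 = s / T"
    define \<theta>2 where "\<theta>2 = B / T"
    define g where "g = \<eta> * T"
    define R1 where "R1 = l / (l - \<theta>1) * (z / (z + \<theta>1))"
    define c where "c = (z - \<theta>2) / z"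
    define R2 where "R2 = l / (c * (l + \<theta>2))"
    have TT: "T \<le> T\<^sup>2" "T\<^sup>2 \<le> T ^ 3" "4 \<le> T\<^sup>2"
    proof -
      show "T \<le> T\<^sup>2" "T\<^sup>2 \<le> T ^ 3" using T(1) by (auto intro: self_le_power power_increasing)
      show "4 \<le> T\<^sup>2" using power_mono[of 2 T 2] T(1) by simp
    qed
    have kk: "1 \<le> k" "real k \<le> \<delta> * T\<^sup>2" and LL: "real L \<le> T\<^sup>2" "T\<^sup>2 / 2 \<le> real L"
    proof -
      have "1 \<le> \<delta> * T" using T(9) \<delta> by (simp add: field_simps)
      also have "\<dots> \<le> \<delta> * T\<^sup>2" using TT \<delta> by (intro mult_left_mono) auto
      finally show "1 \<le> k" by (simp add: k_def le_nat_iff le_floor_iff)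
      show "real k \<le> \<delta> * T\<^sup>2" using \<delta> by (simp add: k_def)
      show "real L \<le> T\<^sup>2" by (simp add: L_def)
      have "T\<^sup>2 - 1 \<le> real L" by (simp add: L_def)
      then show "T\<^sup>2 / 2 \<le> real L" using TT by linarith
    qed
    have kL: "real k + real L \<le> 2 * T\<^sup>2"
      using kk LL \<delta> mult_right_mono[of \<delta> 1 "T\<^sup>2"] by simp
    have mm: "z\<^sup>2 * T ^ 3 - 1 \<le> real m" by (simp add: m_def z_def T3) linarith
    have "3 * T\<^sup>2 \<le> z\<^sup>2 * T ^ 3"
    proof -
      have "3 \<le> z\<^sup>2 * T" using T(8) z by (simp add: field_simps)
      then have "3 * T\<^sup>2 \<le> z\<^sup>2 * T * T\<^sup>2" by (intro mult_right_mono) auto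
      then show ?thesis by (simp add: power2_eq_square power3_eq_cube mult_ac)
    qed
    then have kLm: "k + L \<le> m" using mm kL TT by linarith
    have m': "z\<^sup>2 * T ^ 3 - 3 * T\<^sup>2 \<le> real (m - (k + L))"
      using mm kL TT kLm by (simp add: of_nat_diff)
    have n1: "1 \<le> n"
    proof -
      have "1 \<le> \<rho>\<^sup>2 * T" using T(7) \<rho> by (simp add: field_simps)
      also have "\<dots> \<le> \<rho>\<^sup>2 * t" using TT T3 by (intro mult_left_mono) auto
      finally show ?thesis by (simp add: n_def le_nat_iff le_floor_iff)
    qed
    have n': "real n \<le> (1 - z)\<^sup>2 * T ^ 3" using tpos by (simp add: n_def z_def T3)
    have \<beta>: "0 < \<beta>" "\<beta> \<le> z / 2" using b z Tpos T(2) by (auto simp: \<beta>_def field_simps)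
    have l: "0 < l" "l < z" "z / 2 \<le> l" using \<beta> z by (auto simp: l_def)
    have \<theta>1: "0 < \<theta>1" "\<theta>1 < l"
    proof -
      show "0 < \<theta>1" using s Tpos by (simp add: \<theta>1_def)
      have "\<theta>1 \<le> z / 4" using T(5) z Tpos by (simp add: \<theta>1_def field_simps)
      then show "\<theta>1 < l" using l z by linarith
    qed
    have \<theta>2: "0 < \<theta>2" "\<theta>2 < z" "\<theta>2 / z \<le> \<epsilon> / 12" "2 * \<beta> \<le> \<theta>2"
    proof -
      show "0 < \<theta>2" using B Tpos by (simp add: \<theta>2_def)
      have "\<theta>2 \<le> z / 2" using T(3) z Tpos by (simp add: \<theta>2_def field_simps)
      then show "\<theta>2 < z" using z by linarith
      show "\<theta>2 / z \<le> \<epsilon> / 12" using T(4) z \<epsilon> Tpos by (simp add: \<theta>2_def field_simps)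
      show "2 * \<beta> \<le> \<theta>2" using B(1) Tpos by (simp add: \<beta>_def \<theta>2_def divide_right_mono)
    qed
    have g: "0 \<le> g" using \<eta> Tpos by (simp add: g_def)
    have h: "0 < h" "2 * h < 1 - l" using \<beta> z by (auto simp: h_def l_def)
    define y where "y = \<theta>1 * (\<beta> + \<theta>1) / (l * z)"
    have y: "0 \<le> y" "y \<le> 1 / 2" "2 * y * real k \<le> 1"
    proof -
      show "0 \<le> y" using \<theta>1 \<beta> l z by (simp add: y_def)
      have "z * (z / 2) \<le> l * z" using l z by (simp add: mult.commute mult_left_mono)
      then have "y \<le> \<theta>1 * (\<beta> + \<theta>1) / (z * (z / 2))"
        unfolding y_def using \<theta>1 \<beta> l z by (intro divide_left_mono) auto
      also have "\<dots> = D / (2 * T\<^sup>2)"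
        using z Tpos by (simp add: \<theta>1_def \<beta>_def D_def power2_eq_square field_simps)
      finally have yD: "y \<le> D / (2 * T\<^sup>2)" .
      have "D \<le> T\<^sup>2" using T(6) TT by linarith
      then have "D / (2 * T\<^sup>2) \<le> 1 / 2" using Tpos by (simp add: field_simps)
      then show "y \<le> 1 / 2" using yD by linarith
      have "2 * y * real k \<le> 2 * (D / (2 * T\<^sup>2)) * (\<delta> * T\<^sup>2)"
        using yD kk \<open>0 \<le> y\<close> D by (intro mult_mono) auto
      also have "\<dots> = D * \<delta>" using Tpos by simp
      finally show "2 * y * real k \<le> 1" using \<delta> by simp
    qed
    have R1y: "R1 = 1 / (1 - y)"
    proof -
      have "(l - \<theta>1) * (z + \<theta>1) = l * z * (1 - y)" using l z by (simp add: y_def l_def field_simps)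
      then have "R1 = l * z / (l * z * (1 - y))" by (simp add: R1_def)
      then show ?thesis using l z by simp
    qed
    have R1: "1 \<le> R1" "R1 \<le> exp (2 * y)"
    proof -
      show "1 \<le> R1" using y by (simp add: R1y field_simps)
      have "1 / (1 - y) \<le> 1 + 2 * y"
      proof -
        have "1 \<le> (1 + 2 * y) * (1 - y)" using y mult_nonneg_nonneg[of y "1 - 2 * y"] by (simp add: algebra_simps)
        then show ?thesis using y by (simp add: pos_divide_le_eq)
      qed
      also have "\<dots> \<le> exp (2 * y)" by (rule exp_ge_add_one_self)
      finally show "R1 \<le> exp (2 * y)" by (simp add: R1y)
    qed
    have R2: "1 + \<theta>2\<^sup>2 / 2 \<le> R2"
    proof -
      have c0: "0 < c" using \<theta>2 z by (simp add: c_def)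
      have den: "0 < c * (l + \<theta>2)" using c0 l \<theta>2 by simp
      have "(z - \<theta>2) * (l + \<theta>2) = z * l - \<theta>2 * (\<theta>2 - \<beta>)" by (simp add: l_def algebra_simps)
      moreover have "\<theta>2 * (\<theta>2 / 2) \<le> \<theta>2 * (\<theta>2 - \<beta>)" using \<theta>2 by (intro mult_left_mono) auto
      ultimately have q: "(z - \<theta>2) * (l + \<theta>2) \<le> z * l - \<theta>2\<^sup>2 / 2" by (simp add: power2_eq_square)
      have zl: "z * l \<le> 1" using z l mult_mono[of z 1 l 1] by simp
      have "(1 + \<theta>2\<^sup>2 / 2) * ((z - \<theta>2) * (l + \<theta>2)) \<le> (1 + \<theta>2\<^sup>2 / 2) * (z * l - \<theta>2\<^sup>2 / 2)"
        using q by (intro mult_left_mono) auto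
      also have "\<dots> = z * l - \<theta>2\<^sup>2 / 2 * (1 - z * l) - (\<theta>2\<^sup>2 / 2)\<^sup>2"
      proof -
        have "(1 + e) * (w - e) = w - e * (1 - w) - e\<^sup>2" for e w :: real by (simp add: power2_eq_square algebra_simps)
        then show ?thesis .
      qed
      also have "\<dots> \<le> z * l"
      proof -
        have "0 \<le> \<theta>2\<^sup>2 / 2 * (1 - z * l)" using zl by (intro mult_nonneg_nonneg) auto
        moreover have "0 \<le> (\<theta>2\<^sup>2 / 2)\<^sup>2" by (rule zero_le_power2)
        ultimately show ?thesis by linarith
      qed
      finally have "(1 + \<theta>2\<^sup>2 / 2) * (c * (l + \<theta>2)) * z \<le> l * z" using z by (simp add: c_def mult_ac)
      then have "(1 + \<theta>2\<^sup>2 / 2) * (c * (l + \<theta>2)) \<le> l" using z by (simp only: mult_le_cancel_right)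
      then show ?thesis using den by (simp add: R2_def pos_le_divide_eq)
    qed
    have R2': "1 \<le> R2" using R2 zero_le_power2[of \<theta>2] by linarith
    have E_sub: "{x \<in> space M. 1 \<le> Z_exit (\<lambda>p. \<omega> p x) \<rho> t \<and> real_of_int (Z_exit (\<lambda>p. \<omega> p x) \<rho> t) \<le> \<delta> * t powr (2/3)}
       = {x \<in> space M. 1 \<le> Z_exit (\<lambda>p. \<omega> p x) \<rho> t \<and> Z_exit (\<lambda>p. \<omega> p x) \<rho> t \<le> int k}"
    proof -
      have "int k = \<lfloor>\<delta> * T\<^sup>2\<rfloor>" using \<delta> by (simp add: k_def)
      then show ?thesis by (simp add: T2 le_floor_iff)
    qed
    have term1: "exp (h\<^sup>2 / 2 * (real n / ((1 - l) * (1 - l - 2 * h)) - real (m - (k + L)) / (l + h)\<^sup>2)) \<le> \<epsilon> / 4"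
    proof -
      have "exp (h\<^sup>2 / 2 * (real n / ((1 - l) * (1 - l - 2 * h)) - real (m - (k + L)) / (l + h)\<^sup>2)) \<le> exp (- (b ^ 3 / 32))"
        using drift_exponent[OF z b(1) Tpos \<beta>_def \<beta>(2) l_def h_def _ n' m'] by simp
      also have "\<dots> \<le> 1 / (b ^ 3 / 32)" using b by (intro exp_minus_le_inverse) simp
      also have "\<dots> \<le> 32 / b"
      proof -
        have "b \<le> b ^ 3" using b by (intro self_le_power) auto
        then show ?thesis using b by (simp add: frac_le)
      qed
      also have "\<dots> \<le> \<epsilon> / 4" using b \<epsilon> by (simp add: field_simps)
      finally show ?thesis .
    qed
    have term2: "exp (- \<theta>1 * g) * R1 ^ (k - 1) \<le> \<epsilon> / 4"
    proof -
      have "R1 ^ (k - 1) \<le> exp (2 * y) ^ (k - 1)" using R1 by (intro power_mono) auto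
      also have "\<dots> = exp (2 * y * real (k - 1))" by (simp add: exp_of_nat_mult[symmetric] mult_ac)
      also have "\<dots> \<le> exp 1"
      proof -
        have "2 * y * real (k - 1) \<le> 2 * y * real k" using y by (intro mult_left_mono) auto
        then show ?thesis using y by simp
      qed
      finally have "exp (- \<theta>1 * g) * R1 ^ (k - 1) \<le> exp (- \<theta>1 * g) * exp 1" by (intro mult_left_mono) auto
      also have "\<dots> = exp (- (4 / \<epsilon>))"
      proof -
        have "\<theta>1 * g = 1 + 4 / \<epsilon>" using s Tpos by (simp add: \<theta>1_def g_def)
        then show ?thesis by (simp add: exp_add[symmetric])
      qed
      also have "\<dots> \<le> 1 / (4 / \<epsilon>)" using \<epsilon> by (intro exp_minus_le_inverse) simp
      finally show ?thesis by simp
    qed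
    have term3: "1 - c * (exp (- \<theta>2 * g) - inverse R2 ^ L) \<le> \<epsilon> / 4"
    proof -
      have c: "0 \<le> c" "c \<le> 1" "1 - c \<le> \<epsilon> / 12"
      proof -
        have ce: "c = 1 - \<theta>2 / z" using z by (simp add: c_def diff_divide_distrib)
        have "0 \<le> \<theta>2 / z" "\<theta>2 / z \<le> 1" using \<theta>2(1,2) z by (simp_all add: divide_le_eq)
        then show "0 \<le> c" "c \<le> 1" "1 - c \<le> \<epsilon> / 12" using \<theta>2(3) unfolding ce by linarith+
      qed
      have "\<theta>2 * g = \<epsilon> / 12" using \<eta>(2) Tpos by (simp add: \<theta>2_def g_def)
      then have e: "1 - \<epsilon> / 12 \<le> exp (- \<theta>2 * g)" using exp_ge_add_one_self[of "- \<theta>2 * g"] by simp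
      have i: "inverse R2 ^ L \<le> \<epsilon> / 12"
      proof -
        have "B\<^sup>2 / 4 \<le> real L * (\<theta>2\<^sup>2 / 2)"
        proof -
          have "T\<^sup>2 / 2 * (\<theta>2\<^sup>2 / 2) \<le> real L * (\<theta>2\<^sup>2 / 2)" using LL by (intro mult_right_mono) auto
          moreover have "T\<^sup>2 / 2 * (\<theta>2\<^sup>2 / 2) = B\<^sup>2 / 4" using Tpos by (simp add: \<theta>2_def power_divide)
          ultimately show ?thesis by simp
        qed
        also have "\<dots> \<le> 1 + real L * (\<theta>2\<^sup>2 / 2)" by simp
        also have "\<dots> \<le> (1 + \<theta>2\<^sup>2 / 2) ^ L"
          by (rule Bernoulli_inequality, rule order_trans[of _ 0]) simp_all
        also have "\<dots> \<le> R2 ^ L" using R2 by (intro power_mono) auto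
        finally have BR: "B\<^sup>2 / 4 \<le> R2 ^ L" .
        have "48 / \<epsilon> \<le> B\<^sup>2"
        proof -
          have "48 / \<epsilon> \<le> 96 / \<epsilon>" using \<epsilon> by (simp add: divide_right_mono)
          also have "\<dots> \<le> B" by (rule B)
          also have "\<dots> \<le> B\<^sup>2" using B by (intro self_le_power) auto
          finally show ?thesis .
        qed
        moreover have "12 / \<epsilon> = 48 / \<epsilon> / 4" by simp
        ultimately have "12 / \<epsilon> \<le> R2 ^ L" using BR by linarith
        then have "inverse (R2 ^ L) \<le> inverse (12 / \<epsilon>)" using \<epsilon> by (intro le_imp_inverse_le) auto
        then show ?thesis by (simp add: power_inverse)
      qed
      have "c * (exp (- \<theta>2 * g) - inverse R2 ^ L) \<ge> c * (1 - \<epsilon> / 12 - \<epsilon> / 12)"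
        using e i c by (intro mult_left_mono) auto
      moreover have "c * (1 - \<epsilon> / 12 - \<epsilon> / 12) \<ge> c - \<epsilon> / 6"
      proof -
        have "c * (\<epsilon> / 6) \<le> 1 * (\<epsilon> / 6)" using c \<epsilon> by (intro mult_right_mono) auto
        then show ?thesis by (simp add: algebra_simps)
      qed
      ultimately show ?thesis using c by linarith
    qed
    have "measure M {x \<in> space M. 1 \<le> Z_exit (\<lambda>p. \<omega> p x) \<rho> t \<and> Z_exit (\<lambda>p. \<omega> p x) \<rho> t \<le> int k}
      \<le> exp (h\<^sup>2 / 2 * (real n / ((1 - l) * (1 - l - 2 * h)) - real (m - (k + L)) / (l + h)\<^sup>2))
       + exp (- \<theta>1 * g) * R1 ^ (k - 1) + (1 - c * (exp (- \<theta>2 * g) - inverse R2 ^ L))"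
      by (rule Z_near_origin[OF st \<rho> z_def m_def n_def kk(1) kLm n1 l(1,2) g h _ \<theta>1(2) R1_def R1(1) \<theta>2(1,2) c_def R2_def R2'])
         (use \<theta>1 in simp)
    then show ?thesis unfolding E_sub using term1 term2 term3 \<epsilon> by linarith
  qed
  have "\<forall>\<^sub>F t in at_top. \<forall>(M :: 'a measure) \<omega>. stationary_lpp M \<omega> \<rho> \<longrightarrow>
            measure M {x \<in> space M. 1 \<le> Z_exit (\<lambda>p. \<omega> p x) \<rho> t \<and>
                real_of_int (Z_exit (\<lambda>p. \<omega> p x) \<rho> t) \<le> \<delta> * t powr (2/3)} \<le> \<epsilon>"
    by (rule eventually_mono[OF eventually_ge_at_top[of "T0 ^ 3"]], intro allI impI) (rule main)
  with \<delta>(1) show ?thesis by blast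
qed

theorem theorem2p2:
  fixes \<rho> :: real
  assumes "0 < \<rho>" and "\<rho> < 1"
  shows "(\<forall>t0>0. \<exists>C::real. \<forall>(M :: 'a measure) \<omega>. stationary_lpp M \<omega> \<rho> \<longrightarrow>
            (\<forall>a>0. \<forall>t\<ge>t0.
               measure M {x \<in> space M. real_of_int (Z_exit (\<lambda>p. \<omega> p x) \<rho> t) \<ge> a * t powr (2/3)}
                 \<le> C * a powi (-3)))
       \<and> (\<forall>\<epsilon>>0. \<exists>\<delta>>0. \<forall>\<^sub>F t in at_top. \<forall>(M :: 'a measure) \<omega>. stationary_lpp M \<omega> \<rho> \<longrightarrow>
            measure M {x \<in> space M. 1 \<le> Z_exit (\<lambda>p. \<omega> p x) \<rho> t \<and>
                real_of_int (Z_exit (\<lambda>p. \<omega> p x) \<rho> t) \<le> \<delta> * t powr (2/3)} \<le> \<epsilon>)"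
  using exit_upper_tail[OF assms] exit_rarely_near_origin[OF assms] by blast

end
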